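(* Let $k$ be a commutative associative ring with unit. Let $A$ be a dg $k$-algebra such that: a) $H^pA$ vanishes for $p<0$; b) $\mathrm{Mod}\,H^0(A)$ is a semisimple abelian category. Then for each graded simple module $S$ over the graded ring $H^*A$, there is a dg $A$-module $\tilde{S}$, unique up to isomorphism in the derived category $\mathcal{D}A$, such that the graded $H^*A$-module $H^*(\tilde{S})$ is isomorphic to $S$.
   Context: "Graded" means $\mathbb{Z}$-graded. $\mathcal{D}A$ denotes the (unbounded) derived category of (right) dg $A$-modules. $\mathrm{Mod}\,H^0(A)$ is the category of unital right $H^0(A)$-modules. A graded simple module is a nonzero graded module without proper nonzero graded submodules. *)

theory Defs
  imports "HOL-Algebra.Module" "HOL-Algebra.QuotRing"
begin

text \<open>
  A graded object is given by its family of homogeneous parts, indexed by the integers. The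
  additive groups are HOL-Algebra \<open>monoid\<close> records satisfying \<^const>\<open>comm_group\<close>, so
  their multiplicative notation stands for sum, zero and negative.  All modules are unital right modules.
\<close>

section \<open>Graded rings and graded modules\<close>

record 'a graded_ring =
  rgrp :: "int \<Rightarrow> 'a monoid"
  rmul :: "int \<Rightarrow> int \<Rightarrow> 'a \<Rightarrow> 'a \<Rightarrow> 'a"
  rone :: 'a

record ('a, 'm) graded_module =
  mgrp :: "int \<Rightarrow> 'm monoid"
  mact :: "int \<Rightarrow> int \<Rightarrow> 'm \<Rightarrow> 'a \<Rightarrow> 'm"

locale graded_ring =
  fixes R :: "('a, 'z) graded_ring_scheme"
  assumes rgrp: "comm_group (rgrp R p)"
    and rone: "rone R \<in> carrier (rgrp R 0)"
    and rmul_right: "a \<in> carrier (rgrp R p) \<Longrightarrow> rmul R p q a \<in> hom (rgrp R q) (rgrp R (p + q))"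
    and rmul_left: "b \<in> carrier (rgrp R q) \<Longrightarrow> (\<lambda>a. rmul R p q a b) \<in> hom (rgrp R p) (rgrp R (p + q))"
    and rmul_assoc: "\<lbrakk>a \<in> carrier (rgrp R p); b \<in> carrier (rgrp R q); c \<in> carrier (rgrp R r)\<rbrakk> \<Longrightarrow>
          rmul R (p + q) r (rmul R p q a b) c = rmul R p (q + r) a (rmul R q r b c)"
    and rone_left: "a \<in> carrier (rgrp R p) \<Longrightarrow> rmul R 0 p (rone R) a = a"
    and rone_right: "a \<in> carrier (rgrp R p) \<Longrightarrow> rmul R p 0 a (rone R) = a"

locale graded_module = graded_ring R
  for R :: "('a, 'z) graded_ring_scheme" +
  fixes M :: "('a, 'm, 'w) graded_module_scheme"
  assumes mgrp: "comm_group (mgrp M p)"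
    and mact_right: "x \<in> carrier (mgrp M p) \<Longrightarrow> mact M p q x \<in> hom (rgrp R q) (mgrp M (p + q))"
    and mact_left: "a \<in> carrier (rgrp R q) \<Longrightarrow> (\<lambda>x. mact M p q x a) \<in> hom (mgrp M p) (mgrp M (p + q))"
    and mact_assoc: "\<lbrakk>x \<in> carrier (mgrp M p); a \<in> carrier (rgrp R q); b \<in> carrier (rgrp R r)\<rbrakk> \<Longrightarrow>
          mact M (p + q) r (mact M p q x a) b = mact M p (q + r) x (rmul R q r a b)"
    and mact_one: "x \<in> carrier (mgrp M p) \<Longrightarrow> mact M p 0 x (rone R) = x"

definition graded_submodule ::
  "('a, 'z) graded_ring_scheme \<Rightarrow> ('a, 'm, 'w) graded_module_scheme \<Rightarrow> (int \<Rightarrow> 'm set) \<Rightarrow> bool"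
  where "graded_submodule R M N \<longleftrightarrow>
    (\<forall>p. subgroup (N p) (mgrp M p)) \<and>
    (\<forall>p q. \<forall>x\<in>N p. \<forall>a\<in>carrier (rgrp R q). mact M p q x a \<in> N (p + q))"

definition graded_simple ::
  "('a, 'z) graded_ring_scheme \<Rightarrow> ('a, 'm, 'w) graded_module_scheme \<Rightarrow> bool"
  where "graded_simple R M \<longleftrightarrow>
    graded_module R M \<and>
    (\<exists>p. carrier (mgrp M p) \<noteq> {\<one>\<^bsub>mgrp M p\<^esub>}) \<and>
    (\<forall>N. graded_submodule R M N \<longrightarrow>
      (\<forall>p. N p = {\<one>\<^bsub>mgrp M p\<^esub>}) \<or> (\<forall>p. N p = carrier (mgrp M p)))"

definition graded_iso ::
  "('a, 'z) graded_ring_scheme \<Rightarrow> ('a, 'm, 'w) graded_module_scheme \<Rightarrow>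
    ('a, 'n, 'v) graded_module_scheme \<Rightarrow> bool"
  where "graded_iso R M N \<longleftrightarrow>
    (\<exists>f. (\<forall>p. f p \<in> iso (mgrp M p) (mgrp N p)) \<and>
      (\<forall>p q. \<forall>x\<in>carrier (mgrp M p). \<forall>a\<in>carrier (rgrp R q).
        f (p + q) (mact M p q x a) = mact N p q (f p x) a))"

section \<open>Dg algebras and dg modules\<close>

record ('k, 'a) dg_algebra = "'a graded_ring" +
  rsmul :: "int \<Rightarrow> 'k \<Rightarrow> 'a \<Rightarrow> 'a"
  rdiff :: "int \<Rightarrow> 'a \<Rightarrow> 'a"

record ('a, 'm) dg_module = "('a, 'm) graded_module" +
  mdiff :: "int \<Rightarrow> 'm \<Rightarrow> 'm"

text \<open>The locale \<^locale>\<open>module\<close> ignores the ring multiplication and unit of its second argument.\<close>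

definition scalar_module :: "'a monoid \<Rightarrow> ('k \<Rightarrow> 'a \<Rightarrow> 'a) \<Rightarrow> ('k, 'a) module"
  where "scalar_module G s =
    \<lparr>carrier = carrier G, monoid.mult = monoid.mult G, one = one G,
     ring.zero = one G, ring.add = monoid.mult G, smult = s\<rparr>"

definition signed :: "int \<Rightarrow> 'a monoid \<Rightarrow> 'a \<Rightarrow> 'a"  \<comment> \<open>multiplication by \<open>(-1)^p\<close>\<close>
  where "signed p G x = (if even p then x else inv\<^bsub>G\<^esub> x)"

locale dg_algebra = graded_ring A
  for K :: "'k ring" and A :: "('k, 'a) dg_algebra" +
  assumes base: "cring K"
    and rsmul_module: "module K (scalar_module (rgrp A p) (rsmul A p))"
    and rsmul_left: "\<lbrakk>l \<in> carrier K; a \<in> carrier (rgrp A p); b \<in> carrier (rgrp A q)\<rbrakk> \<Longrightarrow>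
          rsmul A (p + q) l (rmul A p q a b) = rmul A p q (rsmul A p l a) b"
    and rsmul_right: "\<lbrakk>l \<in> carrier K; a \<in> carrier (rgrp A p); b \<in> carrier (rgrp A q)\<rbrakk> \<Longrightarrow>
          rsmul A (p + q) l (rmul A p q a b) = rmul A p q a (rsmul A q l b)"
    and rdiff: "rdiff A p \<in> hom (rgrp A p) (rgrp A (p + 1))"
    and rdiff_smul: "\<lbrakk>l \<in> carrier K; a \<in> carrier (rgrp A p)\<rbrakk> \<Longrightarrow>
          rdiff A p (rsmul A p l a) = rsmul A (p + 1) l (rdiff A p a)"
    and rdiff_rdiff: "a \<in> carrier (rgrp A p) \<Longrightarrow>
          rdiff A (p + 1) (rdiff A p a) = \<one>\<^bsub>rgrp A (p + 2)\<^esub>"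
    and rdiff_rmul: "\<lbrakk>a \<in> carrier (rgrp A p); b \<in> carrier (rgrp A q)\<rbrakk> \<Longrightarrow>
          rdiff A (p + q) (rmul A p q a b) =
            rmul A (p + 1) q (rdiff A p a) b \<otimes>\<^bsub>rgrp A (p + q + 1)\<^esub>
            signed p (rgrp A (p + q + 1)) (rmul A p (q + 1) a (rdiff A q b))"

text \<open>
  The action of \<open>k\<close> on a dg module is not a separate datum: the modules are unital, so
  \<open>\<lambda>\<close> in \<open>k\<close> has to act as \<open>\<lambda> 1\<close> in \<open>A\<close>, and the differential and all \<open>A\<close>-linear maps
  are then \<open>k\<close>-linear.
\<close>

locale dg_module = graded_module A M
  for A :: "('k, 'a) dg_algebra" and M :: "('a, 'm) dg_module" +
  assumes mdiff: "mdiff M p \<in> hom (mgrp M p) (mgrp M (p + 1))"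
    and mdiff_mdiff: "x \<in> carrier (mgrp M p) \<Longrightarrow>
          mdiff M (p + 1) (mdiff M p x) = \<one>\<^bsub>mgrp M (p + 2)\<^esub>"
    and mdiff_mact: "\<lbrakk>x \<in> carrier (mgrp M p); a \<in> carrier (rgrp A q)\<rbrakk> \<Longrightarrow>
          mdiff M (p + q) (mact M p q x a) =
            mact M (p + 1) q (mdiff M p x) a \<otimes>\<^bsub>mgrp M (p + q + 1)\<^esub>
            signed p (mgrp M (p + q + 1)) (mact M p (q + 1) x (rdiff A q a))"

section \<open>Cohomology\<close>

definition cocycles :: "(int \<Rightarrow> 'x monoid) \<Rightarrow> (int \<Rightarrow> 'x \<Rightarrow> 'x) \<Rightarrow> int \<Rightarrow> 'x set"
  where "cocycles G d p = kernel (G p) (G (p + 1)) (d p)"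

definition coboundaries :: "(int \<Rightarrow> 'x monoid) \<Rightarrow> (int \<Rightarrow> 'x \<Rightarrow> 'x) \<Rightarrow> int \<Rightarrow> 'x set"
  where "coboundaries G d p = d (p - 1) ` carrier (G (p - 1))"

definition cohomology_group :: "(int \<Rightarrow> 'x monoid) \<Rightarrow> (int \<Rightarrow> 'x \<Rightarrow> 'x) \<Rightarrow> int \<Rightarrow> 'x set monoid"
  where "cohomology_group G d p = (G p)\<lparr>carrier := cocycles G d p\<rparr> Mod coboundaries G d p"

definition cohomology_class :: "(int \<Rightarrow> 'x monoid) \<Rightarrow> (int \<Rightarrow> 'x \<Rightarrow> 'x) \<Rightarrow> int \<Rightarrow> 'x \<Rightarrow> 'x set"
  where "cohomology_class G d p x = coboundaries G d p #>\<^bsub>G p\<^esub> x"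

text \<open>
  Operations on classes are written as unions over all representatives, as in
  \<^const>\<open>rcoset_mult\<close>; all the classes in such a union coincide.
\<close>

definition cohomology_ring :: "('k, 'a) dg_algebra \<Rightarrow> 'a set graded_ring"
  where "cohomology_ring A =
    \<lparr>rgrp = cohomology_group (rgrp A) (rdiff A),
     rmul = (\<lambda>p q X Y. \<Union>a\<in>X. \<Union>b\<in>Y. cohomology_class (rgrp A) (rdiff A) (p + q) (rmul A p q a b)),
     rone = cohomology_class (rgrp A) (rdiff A) 0 (rone A)\<rparr>"

definition cohomology_module :: "('a, 'm) dg_module \<Rightarrow> ('a set, 'm set) graded_module"
  where "cohomology_module M =
    \<lparr>mgrp = cohomology_group (mgrp M) (mdiff M),
     mact = (\<lambda>p q X Y. \<Union>x\<in>X. \<Union>a\<in>Y. cohomology_class (mgrp M) (mdiff M) (p + q) (mact M p q x a))\<rparr>"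

definition degree_zero_ring :: "'a graded_ring \<Rightarrow> 'a ring"
  where "degree_zero_ring R =
    \<lparr>carrier = carrier (rgrp R 0), monoid.mult = rmul R 0 0, one = rone R,
     ring.zero = \<one>\<^bsub>rgrp R 0\<^esub>, ring.add = monoid.mult (rgrp R 0)\<rparr>"

section \<open>Semisimplicity of a module category\<close>

locale right_module = ring R
  for R :: "'r ring" +
  fixes M :: "'m monoid" and act :: "'m \<Rightarrow> 'r \<Rightarrow> 'm"
  assumes grp: "comm_group M"
    and act_closed: "\<lbrakk>x \<in> carrier M; a \<in> carrier R\<rbrakk> \<Longrightarrow> act x a \<in> carrier M"
    and act_add_left: "\<lbrakk>x \<in> carrier M; y \<in> carrier M; a \<in> carrier R\<rbrakk> \<Longrightarrow>
          act (x \<otimes>\<^bsub>M\<^esub> y) a = act x a \<otimes>\<^bsub>M\<^esub> act y a"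
    and act_add_right: "\<lbrakk>x \<in> carrier M; a \<in> carrier R; b \<in> carrier R\<rbrakk> \<Longrightarrow>
          act x (a \<oplus>\<^bsub>R\<^esub> b) = act x a \<otimes>\<^bsub>M\<^esub> act x b"
    and act_assoc: "\<lbrakk>x \<in> carrier M; a \<in> carrier R; b \<in> carrier R\<rbrakk> \<Longrightarrow>
          act (act x a) b = act x (a \<otimes>\<^bsub>R\<^esub> b)"
    and act_one: "x \<in> carrier M \<Longrightarrow> act x \<one>\<^bsub>R\<^esub> = x"

definition right_module_hom ::
  "'r ring \<Rightarrow> 'm monoid \<Rightarrow> ('m \<Rightarrow> 'r \<Rightarrow> 'm) \<Rightarrow> 'n monoid \<Rightarrow> ('n \<Rightarrow> 'r \<Rightarrow> 'n) \<Rightarrow> ('m \<Rightarrow> 'n) \<Rightarrow> bool"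
  where "right_module_hom R M actM N actN f \<longleftrightarrow>
    f \<in> hom M N \<and> (\<forall>x\<in>carrier M. \<forall>a\<in>carrier R. f (actM x a) = actN (f x) a)"

text \<open>
  An abelian category is semisimple if all its short exact sequences split.  The type \<open>'u\<close>
  is the universe in which the modules live.
\<close>

definition Mod_semisimple :: "'u itself \<Rightarrow> 'r ring \<Rightarrow> bool"
  where "Mod_semisimple U R \<longleftrightarrow>
    (\<forall>(L :: 'u monoid) actL (M :: 'u monoid) actM (N :: 'u monoid) actN f g.
      right_module R L actL \<and> right_module R M actM \<and> right_module R N actN \<and>
      right_module_hom R L actL M actM f \<and> right_module_hom R M actM N actN g \<and>
      inj_on f (carrier L) \<and> f ` carrier L = kernel M N g \<and> g ` carrier M = carrier N \<longrightarrow>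
      (\<exists>s. right_module_hom R N actN M actM s \<and> (\<forall>x\<in>carrier N. g (s x) = x)))"

section \<open>The derived category\<close>

definition dg_hom ::
  "('k, 'a) dg_algebra \<Rightarrow> ('a, 'm) dg_module \<Rightarrow> ('a, 'm) dg_module \<Rightarrow> (int \<Rightarrow> 'm \<Rightarrow> 'm) \<Rightarrow> bool"
  where "dg_hom A M N f \<longleftrightarrow>
    dg_module A M \<and> dg_module A N \<and>
    (\<forall>p. f p \<in> hom (mgrp M p) (mgrp N p)) \<and>
    (\<forall>p q. \<forall>x\<in>carrier (mgrp M p). \<forall>a\<in>carrier (rgrp A q).
      f (p + q) (mact M p q x a) = mact N p q (f p x) a) \<and>
    (\<forall>p. \<forall>x\<in>carrier (mgrp M p). f (p + 1) (mdiff M p x) = mdiff N p (f p x))"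

definition homotopic ::
  "('k, 'a) dg_algebra \<Rightarrow> ('a, 'm) dg_module \<Rightarrow> ('a, 'm) dg_module \<Rightarrow>
    (int \<Rightarrow> 'm \<Rightarrow> 'm) \<Rightarrow> (int \<Rightarrow> 'm \<Rightarrow> 'm) \<Rightarrow> bool"
  where "homotopic A M N f g \<longleftrightarrow>
    dg_hom A M N f \<and> dg_hom A M N g \<and>
    (\<exists>h. (\<forall>p. h p \<in> hom (mgrp M p) (mgrp N (p - 1))) \<and>
      (\<forall>p q. \<forall>x\<in>carrier (mgrp M p). \<forall>a\<in>carrier (rgrp A q).
        h (p + q) (mact M p q x a) = mact N (p - 1) q (h p x) a) \<and>
      (\<forall>p. \<forall>x\<in>carrier (mgrp M p).
        f p x = g p x \<otimes>\<^bsub>mgrp N p\<^esub> (mdiff N (p - 1) (h p x) \<otimes>\<^bsub>mgrp N p\<^esub> h (p + 1) (mdiff M p x))))"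

definition cohomology_map :: "('a, 'm) dg_module \<Rightarrow> (int \<Rightarrow> 'm \<Rightarrow> 'm) \<Rightarrow> int \<Rightarrow> 'm set \<Rightarrow> 'm set"
  where "cohomology_map N f p X = (\<Union>x\<in>X. cohomology_class (mgrp N) (mdiff N) p (f p x))"

definition quasi_iso ::
  "('k, 'a) dg_algebra \<Rightarrow> ('a, 'm) dg_module \<Rightarrow> ('a, 'm) dg_module \<Rightarrow> (int \<Rightarrow> 'm \<Rightarrow> 'm) \<Rightarrow> bool"
  where "quasi_iso A M N s \<longleftrightarrow>
    dg_hom A M N s \<and>
    (\<forall>p. cohomology_map N s p \<in>
      iso (mgrp (cohomology_module M) p) (mgrp (cohomology_module N) p))"

text \<open>
  The derived category is the localisation (in the sense of Gabriel and Zisman) of the homotopy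
  category of dg modules at the quasi-isomorphisms.  Its objects are the dg modules with elements
  in \<open>'m\<close>; its morphisms are the zigzags of morphisms and of formal inverses of
  quasi-isomorphisms, modulo the congruence \<open>zigzag_eq\<close>; composition is concatenation, in
  diagrammatic order.  \<open>Fwd X Y f\<close> is a step from \<open>X\<close> to \<open>Y\<close>, and \<open>Bwd X Y s\<close> is the formal
  inverse of \<open>s\<close>, a step from \<open>Y\<close> to \<open>X\<close>.
\<close>

datatype ('a, 'm) step =
    Fwd "('a, 'm) dg_module" "('a, 'm) dg_module" "int \<Rightarrow> 'm \<Rightarrow> 'm"
  | Bwd "('a, 'm) dg_module" "('a, 'm) dg_module" "int \<Rightarrow> 'm \<Rightarrow> 'm"

fun zigzag ::
  "('k, 'a) dg_algebra \<Rightarrow> ('a, 'm) dg_module \<Rightarrow> ('a, 'm) step list \<Rightarrow> ('a, 'm) dg_module \<Rightarrow> bool"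
  where
    "zigzag A M [] N \<longleftrightarrow> dg_module A M \<and> M = N"
  | "zigzag A M (Fwd X Y f # w) N \<longleftrightarrow> M = X \<and> dg_hom A X Y f \<and> zigzag A Y w N"
  | "zigzag A M (Bwd X Y s # w) N \<longleftrightarrow> M = Y \<and> quasi_iso A X Y s \<and> zigzag A X w N"

inductive zigzag_eq ::
  "('k, 'a) dg_algebra \<Rightarrow> ('a, 'm) dg_module \<Rightarrow> ('a, 'm) dg_module \<Rightarrow>
    ('a, 'm) step list \<Rightarrow> ('a, 'm) step list \<Rightarrow> bool"
  for A :: "('k, 'a) dg_algebra"
  where
    refl: "zigzag A M w N \<Longrightarrow> zigzag_eq A M N w w"
  | sym: "zigzag_eq A M N w v \<Longrightarrow> zigzag_eq A M N v w"
  | trans: "zigzag_eq A M N w v \<Longrightarrow> zigzag_eq A M N v u \<Longrightarrow> zigzag_eq A M N w u"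
  | cong: "zigzag A L u M \<Longrightarrow> zigzag_eq A M N w w' \<Longrightarrow> zigzag A N v P \<Longrightarrow>
      zigzag_eq A L P (u @ w @ v) (u @ w' @ v)"
  | id: "dg_module A M \<Longrightarrow> zigzag_eq A M M [Fwd M M (\<lambda>p x. x)] []"
  | comp: "dg_hom A L M f \<Longrightarrow> dg_hom A M N g \<Longrightarrow>
      zigzag_eq A L N [Fwd L M f, Fwd M N g] [Fwd L N (\<lambda>p x. g p (f p x))]"
  | homotopic: "homotopic A M N f g \<Longrightarrow> zigzag_eq A M N [Fwd M N f] [Fwd M N g]"
  | inverse_right: "quasi_iso A M N s \<Longrightarrow> zigzag_eq A M M [Fwd M N s, Bwd M N s] []"
  | inverse_left: "quasi_iso A M N s \<Longrightarrow> zigzag_eq A N N [Bwd M N s, Fwd M N s] []"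

definition derived_iso ::
  "('k, 'a) dg_algebra \<Rightarrow> ('a, 'm) dg_module \<Rightarrow> ('a, 'm) dg_module \<Rightarrow> bool"
  where "derived_iso A M N \<longleftrightarrow>
    (\<exists>w v. zigzag A M w N \<and> zigzag A N v M \<and>
      zigzag_eq A M M (w @ v) [] \<and> zigzag_eq A N N (v @ w) [])"

end

theory Submission
  imports Defs "HOL-Algebra.Free_Abelian_Groups" "HOL-Library.Function_Algebras" "HOL-Library.Product_Plus"
begin

text \<open>
  Since \<open>H\<^sup>*A\<close> lives in degrees \<open>\<ge> 0\<close>, the simple module \<open>S\<close> is concentrated in one degree \<open>n\<close>, where
  semisimplicity makes it \<open>e H\<^sup>0A\<close> for an idempotent \<open>e\<close> of \<open>H\<^sup>0A\<close>.  Realising \<open>e\<close> as a homotopy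
  direct summand of \<open>A[-n]\<close> gives a dg module with the right cohomology in degrees \<open>\<le> n\<close>.  Its
  cohomology in degrees \<open>> n\<close> is killed by attaching cells countably often.  A cell \<open>A[-m]\<close> with
  \<open>m > n + 1\<close> does not disturb the degrees \<open>\<le> n\<close>; for \<open>m = n + 1\<close> one attaches a projective cover
  of \<open>H\<^bsup>n+1\<^esup>\<close> instead of a free module, which exists by semisimplicity and again is a homotopy
  summand of a free dg module.  All cells have degree \<open>> n\<close>, so by obstruction theory a generator of
  \<open>S\<close> in \<open>H\<^sup>n(T)\<close> extends to a quasi-isomorphism from the colimit to any other realisation \<open>T\<close>.

  To compute with \<open>+\<close> and \<open>-\<close>, all groups are first embedded into types of class
  \<^class>\<open>ab_group_add\<close>; there the operations of a graded object need no degree arguments.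
\<close>

section \<open>Differential graded modules inside additive types\<close>

text \<open>In the cone of P -> N, cohomology in degree p sees H^{p+1}(P). Cells generated in degree
  n + 1 are therefore the only ones that can add classes in degree n: there the map on H^{n+1} has
  to be injective, and a free module on all cocycles is too big. Cutting out the right summand means
  splitting a map that is idempotent only up to homotopy; its image is built as the cone of an
  explicit self-map of countably many copies. Such a cone has cells one degree below its generators,
  where a test module may have cohomology, so null-homotopies on it need a correction by the
  retraction. The second constraint is size. Existence, uniqueness and semisimplicity all concern
  modules with elements in \<open>'u\<close>. Hence every stage must inject into \<open>'u\<close>,
  quotients are modelled by codes of representatives, and the tower lives in a type fixed in
  advance, with one free slot per stage. The comparison with another realisation is a single
  quasi-isomorphism, which is a zigzag of length one in the derived category.\<close>

definition sg :: "int \<Rightarrow> 'a::ab_group_add \<Rightarrow> 'a"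
  where "sg p x = (if even p then x else - x)"

lemma sg_simps [simp]:
  "sg p 0 = 0" "sg p (sg p x) = x" "sg p (- x) = - sg p x" "sg 0 x = x"
  "sg (p + 1) x = - sg p x" "sg (1 + p) x = - sg p x" "sg (p - 1) x = - sg p x" "sg (-1) x = -x" "sg 1 x = -x"
  "sg p (x + y) = sg p x + sg p y" "sg p (x - y) = sg p x - sg p y"
  "sg p x = 0 \<longleftrightarrow> x = 0"
  by (auto simp: sg_def)

lemma sg_sg: "sg p (sg q x) = sg (p + q) x" "sg p (sg (q - p) x) = sg q x"
  by (auto simp: sg_def)

lemma sg_sum: "sg p (\<Sum>i\<in>I. f i) = (\<Sum>i\<in>I. sg p (f i))"
  by (simp add: sg_def sum_negf)

record 'b alg =
  ac :: "int \<Rightarrow> 'b set"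
  am :: "'b \<Rightarrow> 'b \<Rightarrow> 'b"
  au :: 'b
  ad :: "'b \<Rightarrow> 'b"

record ('b, 'm) mdl =
  mc :: "int \<Rightarrow> 'm set"
  ma :: "'m \<Rightarrow> 'b \<Rightarrow> 'm"
  md :: "'m \<Rightarrow> 'm"

locale mdl =
  fixes A :: "'b::ab_group_add alg" and M :: "('b, 'm::ab_group_add) mdl"
  assumes zero: "0 \<in> mc M p"
    and diff: "\<lbrakk>x \<in> mc M p; y \<in> mc M p\<rbrakk> \<Longrightarrow> x - y \<in> mc M p"
    and act: "\<lbrakk>x \<in> mc M p; a \<in> ac A q\<rbrakk> \<Longrightarrow> ma M x a \<in> mc M (p + q)"
    and act_addl: "\<lbrakk>x \<in> mc M p; y \<in> mc M p; a \<in> ac A q\<rbrakk> \<Longrightarrow> ma M (x + y) a = ma M x a + ma M y a"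
    and act_addr: "\<lbrakk>x \<in> mc M p; a \<in> ac A q; b \<in> ac A q\<rbrakk> \<Longrightarrow> ma M x (a + b) = ma M x a + ma M x b"
    and act_act: "\<lbrakk>x \<in> mc M p; a \<in> ac A q; b \<in> ac A r\<rbrakk> \<Longrightarrow> ma M (ma M x a) b = ma M x (am A a b)"
    and act_unit: "x \<in> mc M p \<Longrightarrow> ma M x (au A) = x"
    and d: "x \<in> mc M p \<Longrightarrow> md M x \<in> mc M (p + 1)"
    and d_add: "\<lbrakk>x \<in> mc M p; y \<in> mc M p\<rbrakk> \<Longrightarrow> md M (x + y) = md M x + md M y"
    and d_d: "x \<in> mc M p \<Longrightarrow> md M (md M x) = 0"
    and d_act: "\<lbrakk>x \<in> mc M p; a \<in> ac A q\<rbrakk> \<Longrightarrow> md M (ma M x a) = ma M (md M x) a + sg p (ma M x (ad A a))"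
begin

lemma neg: "x \<in> mc M p \<Longrightarrow> - x \<in> mc M p"
  using diff[OF zero] by force

lemma add: "\<lbrakk>x \<in> mc M p; y \<in> mc M p\<rbrakk> \<Longrightarrow> x + y \<in> mc M p"
  using diff[OF _ neg] by force

lemma sg_in: "x \<in> mc M p \<Longrightarrow> sg k x \<in> mc M p"
  by (auto simp: sg_def neg)

lemma sum_in: "(\<And>i. i \<in> I \<Longrightarrow> f i \<in> mc M p) \<Longrightarrow> sum f I \<in> mc M p"
  by (induction I rule: infinite_finite_induct) (auto simp: zero intro: add)

lemma d_zero: "md M 0 = 0"
  using d_add[OF zero zero] by simp

lemma d_neg: "x \<in> mc M p \<Longrightarrow> md M (- x) = - md M x"
  using d_add[of x p "- x"] neg d_zero by (simp add: eq_neg_iff_add_eq_0 add.commute)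

lemma d_diff: "\<lbrakk>x \<in> mc M p; y \<in> mc M p\<rbrakk> \<Longrightarrow> md M (x - y) = md M x - md M y"
  using d_add[of x p "- y"] d_neg[of y p] neg by simp

lemma d_sg: "x \<in> mc M p \<Longrightarrow> md M (sg k x) = sg k (md M x)"
  by (auto simp: sg_def d_neg)

lemma d_sum: "(\<And>i. i \<in> I \<Longrightarrow> f i \<in> mc M p) \<Longrightarrow> md M (sum f I) = (\<Sum>i\<in>I. md M (f i))"
  by (induction I rule: infinite_finite_induct) (auto simp: d_zero d_add[where p = p] sum_in)

lemma act_zerol: "a \<in> ac A q \<Longrightarrow> ma M 0 a = 0"
  using act_addl[OF zero zero] by force

lemma act_negl: "\<lbrakk>x \<in> mc M p; a \<in> ac A q\<rbrakk> \<Longrightarrow> ma M (- x) a = - ma M x a"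
  using act_addl[of x p "- x" a q] neg act_zerol[of a q] by (simp add: eq_neg_iff_add_eq_0 add.commute)

lemma act_diffl: "\<lbrakk>x \<in> mc M p; y \<in> mc M p; a \<in> ac A q\<rbrakk> \<Longrightarrow> ma M (x - y) a = ma M x a - ma M y a"
  using act_addl[of x p "- y" a q] act_negl[of y p a q] neg by simp

lemma act_sgl: "\<lbrakk>x \<in> mc M p; a \<in> ac A q\<rbrakk> \<Longrightarrow> ma M (sg k x) a = sg k (ma M x a)"
  by (auto simp: sg_def act_negl)

lemma act_suml: "\<lbrakk>\<And>i. i \<in> I \<Longrightarrow> f i \<in> mc M p; a \<in> ac A q\<rbrakk> \<Longrightarrow> ma M (sum f I) a = (\<Sum>i\<in>I. ma M (f i) a)"
  by (induction I rule: infinite_finite_induct) (auto simp: act_zerol act_addl[where p = p and q = q] sum_in)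

end

definition self :: "'b alg \<Rightarrow> ('b, 'b) mdl"
  where "self A = \<lparr>mc = ac A, ma = am A, md = ad A\<rparr>"

lemma self_simps [simp]: "mc (self A) = ac A" "ma (self A) = am A" "md (self A) = ad A"
  by (simp_all add: self_def)

text \<open>The module laws for \<open>self A\<close> already contain the additive structure,
  associativity, the right unit law and the Leibniz rule of \<open>A\<close>; only the degree of the
  unit and the left unit law are left to state.\<close>

locale dga =
  fixes A :: "'b::ab_group_add alg"
  assumes self: "mdl A (self A)"
    and unit: "au A \<in> ac A 0"
    and unit_left: "a \<in> ac A p \<Longrightarrow> am A (au A) a = a"
begin

sublocale A: mdl A "self A" by (rule self)

text \<open>The Leibniz rule for the product of 1 with itself gives d 1 = d 1 + d 1.\<close>

lemma d_unit: "ad A (au A) = 0"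
  using A.d_act[of "au A" 0 "au A" 0] unit A.act_unit[of "ad A (au A)" 1] A.d[of "au A" 0]
  by (simp add: unit_left[where p = 1] unit_left[OF unit])

end

context mdl
begin

text \<open>Zero and negatives of scalars are available only through \<open>dga A\<close>, since
  \<open>mdl\<close> by itself does not make the sets \<open>ac A q\<close> subgroups.\<close>

lemma act_zeror: "\<lbrakk>dga A; x \<in> mc M p\<rbrakk> \<Longrightarrow> ma M x 0 = 0"
  using act_addr[of x p 0 0 0] mdl.zero[OF dga.self, of A 0] by simp

lemma act_negr: "\<lbrakk>dga A; x \<in> mc M p; a \<in> ac A q\<rbrakk> \<Longrightarrow> ma M x (- a) = - ma M x a"
  using act_addr[of x p a q "- a"] mdl.neg[OF dga.self, of A a q] act_zeror[of x p]
  by (simp add: eq_neg_iff_add_eq_0 add.commute)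

lemma act_diffr: "\<lbrakk>dga A; x \<in> mc M p; a \<in> ac A q; b \<in> ac A q\<rbrakk> \<Longrightarrow> ma M x (a - b) = ma M x a - ma M x b"
  using act_addr[of x p a q "- b"] mdl.neg[OF dga.self, of A b q] act_negr[of x p b q] by simp

lemma act_sgr: "\<lbrakk>dga A; x \<in> mc M p; a \<in> ac A q\<rbrakk> \<Longrightarrow> ma M x (sg k a) = sg k (ma M x a)"
  by (auto simp: sg_def act_negr)

end

section \<open>Cocycles, coboundaries and their products\<close>

definition cyc :: "('b, 'm::ab_group_add) mdl \<Rightarrow> int \<Rightarrow> 'm set"
  where "cyc M p = {x \<in> mc M p. md M x = 0}"

definition bdy :: "('b, 'm::ab_group_add) mdl \<Rightarrow> int \<Rightarrow> 'm set"
  where "bdy M p = md M ` mc M (p - 1)"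

lemma cyc_mc: "x \<in> cyc M p \<Longrightarrow> x \<in> mc M p" and cyc_d: "x \<in> cyc M p \<Longrightarrow> md M x = 0"
  by (simp_all add: cyc_def)

lemma bdyI: "x \<in> mc M (p - 1) \<Longrightarrow> y = md M x \<Longrightarrow> y \<in> bdy M p"
  by (auto simp: bdy_def)

lemma bdyE: assumes "y \<in> bdy M p" obtains x where "x \<in> mc M (p - 1)" "y = md M x"
  using assms by (auto simp: bdy_def)

context mdl
begin

lemma cyc_zero: "0 \<in> cyc M p"
  by (simp add: cyc_def zero d_zero)

lemma cyc_diff: "\<lbrakk>x \<in> cyc M p; y \<in> cyc M p\<rbrakk> \<Longrightarrow> x - y \<in> cyc M p"
  by (simp add: cyc_def d_diff[where p = p] diff)

lemma cyc_add: "\<lbrakk>x \<in> cyc M p; y \<in> cyc M p\<rbrakk> \<Longrightarrow> x + y \<in> cyc M p"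
  by (simp add: cyc_def d_add[where p = p] add)

lemma cyc_neg: "x \<in> cyc M p \<Longrightarrow> - x \<in> cyc M p"
  by (simp add: cyc_def d_neg[where p = p] neg)

lemma bdy_cyc: "x \<in> bdy M p \<Longrightarrow> x \<in> cyc M p"
  using d[of _ "p - 1"] by (auto simp: bdy_def cyc_def d_d[where p = "p - 1"])

lemma bdy_zero: "0 \<in> bdy M p"
  by (rule bdyI[of 0]) (simp_all add: zero d_zero)

lemma bdy_diff: "\<lbrakk>x \<in> bdy M p; y \<in> bdy M p\<rbrakk> \<Longrightarrow> x - y \<in> bdy M p"
  by (smt (verit) bdy_def d_diff diff imageE imageI)

lemma bdy_neg: "x \<in> bdy M p \<Longrightarrow> - x \<in> bdy M p"
  using bdy_diff[OF bdy_zero] by force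

lemma bdy_add: "\<lbrakk>x \<in> bdy M p; y \<in> bdy M p\<rbrakk> \<Longrightarrow> x + y \<in> bdy M p"
  using bdy_diff[OF _ bdy_neg] by force

lemma bdy_sg: "x \<in> bdy M p \<Longrightarrow> sg k x \<in> bdy M p"
  by (auto simp: sg_def bdy_neg)

lemma bdy_cong: "x - y \<in> bdy M p \<Longrightarrow> x \<in> bdy M p \<longleftrightarrow> y \<in> bdy M p"
  using bdy_add[of "x - y" p y] bdy_diff[of x p "x - y"] by auto

lemma cyc_act: "\<lbrakk>dga A; x \<in> cyc M p; a \<in> cyc (self A) q\<rbrakk> \<Longrightarrow> ma M x a \<in> cyc M (p + q)"
  using act[of x p a q] d_act[of x p a q] act_zerol[of a q] act_zeror[of x p]
  by (auto simp: cyc_def)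

lemma bdy_act: "\<lbrakk>dga A; x \<in> bdy M p; a \<in> cyc (self A) q\<rbrakk> \<Longrightarrow> ma M x a \<in> bdy M (p + q)"
proof (elim bdyE)
  fix y assume *: "dga A" "a \<in> cyc (self A) q" "y \<in> mc M (p - 1)" "x = md M y"
  then have "md M (ma M y a) = ma M x a" "ma M y a \<in> mc M (p - 1 + q)"
    using act[of y "p - 1" a q] d_act[of y "p - 1" a q] act_zeror[of y "p - 1"] by (auto simp: cyc_def)
  then show ?thesis by (intro bdyI[of "ma M y a"]) (simp_all add: algebra_simps)
qed

text \<open>If \<open>x\<close> is a cocycle of degree \<open>p\<close>, then d (x b) = (-1)^p x (d
  b); the sign is absorbed into the primitive \<open>sg p (ma M x b)\<close>.\<close>

lemma act_bdy: "\<lbrakk>dga A; x \<in> cyc M p; a \<in> bdy (self A) q\<rbrakk> \<Longrightarrow> ma M x a \<in> bdy M (p + q)"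
proof (elim bdyE)
  fix b assume *: "dga A" "x \<in> cyc M p" "b \<in> mc (self A) (q - 1)" "a = md (self A) b"
  then have "b \<in> ac A (q - 1)" by simp
  then have "md M (sg p (ma M x b)) = ma M x a" "sg p (ma M x b) \<in> mc M (p + q - 1)"
    using * act[of x p b "q - 1"] d_act[of x p b "q - 1"] act_zerol[of b "q - 1"]
    by (auto simp: cyc_def d_sg[where p = "p + q - 1"] sg_in algebra_simps)
  then show ?thesis by (metis bdyI)
qed

end

section \<open>Linear maps and closed maps of arbitrary degree\<close>

definition lmap :: "'b::ab_group_add alg \<Rightarrow> ('b, 'm::ab_group_add) mdl \<Rightarrow> ('b, 'n::ab_group_add) mdl \<Rightarrow> int \<Rightarrow> ('m \<Rightarrow> 'n) \<Rightarrow> bool"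
  where "lmap A M N r f \<longleftrightarrow>
    (\<forall>p. \<forall>x\<in>mc M p. f x \<in> mc N (p + r)) \<and>
    (\<forall>p. \<forall>x\<in>mc M p. \<forall>y\<in>mc M p. f (x + y) = f x + f y) \<and>
    (\<forall>p q. \<forall>x\<in>mc M p. \<forall>a\<in>ac A q. f (ma M x a) = ma N (f x) a)"

text \<open>These are the cocycles of degree \<open>r\<close> in the Hom complex, whose differential
  sends f to d f - (-1)^r f d. Degree 0 gives the chain maps; degree -1 occurs for the obstruction
  to extending a homotopy.\<close>

definition cmap :: "'b::ab_group_add alg \<Rightarrow> ('b, 'm::ab_group_add) mdl \<Rightarrow> ('b, 'n::ab_group_add) mdl \<Rightarrow> int \<Rightarrow> ('m \<Rightarrow> 'n) \<Rightarrow> bool"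
  where "cmap A M N r f \<longleftrightarrow> lmap A M N r f \<and> (\<forall>p. \<forall>x\<in>mc M p. md N (f x) = sg r (f (md M x)))"

lemma lmap_in: "lmap A M N r f \<Longrightarrow> x \<in> mc M p \<Longrightarrow> f x \<in> mc N (p + r)"
  and lmap_add: "lmap A M N r f \<Longrightarrow> x \<in> mc M p \<Longrightarrow> y \<in> mc M p \<Longrightarrow> f (x + y) = f x + f y"
  and lmap_act: "lmap A M N r f \<Longrightarrow> x \<in> mc M p \<Longrightarrow> a \<in> ac A q \<Longrightarrow> f (ma M x a) = ma N (f x) a"
  by (auto simp: lmap_def)

lemma lmap_in0: "lmap A M N 0 f \<Longrightarrow> x \<in> mc M p \<Longrightarrow> f x \<in> mc N p"
  using lmap_in by fastforce

lemma cmap_lmap: "cmap A M N r f \<Longrightarrow> lmap A M N r f"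
  and cmap_d: "cmap A M N r f \<Longrightarrow> x \<in> mc M p \<Longrightarrow> md N (f x) = sg r (f (md M x))"
  by (auto simp: cmap_def)

lemma cmap_d0: "cmap A M N 0 f \<Longrightarrow> x \<in> mc M p \<Longrightarrow> md N (f x) = f (md M x)"
  using cmap_d by fastforce

lemma cmap_id: "cmap A M M 0 (\<lambda>x. x)"
  by (simp add: lmap_def cmap_def)

lemma lmap_comp:
  assumes "lmap A L M r f" "lmap A M N s g" shows "lmap A L N (r + s) (\<lambda>x. g (f x))"
  unfolding lmap_def
proof (intro conjI allI ballI)
  fix p x assume x: "x \<in> mc L p"
  show "g (f x) \<in> mc N (p + (r + s))"
    using lmap_in[OF assms(2) lmap_in[OF assms(1) x]] by (simp add: algebra_simps)
  show "g (f (x + y)) = g (f x) + g (f y)" if "y \<in> mc L p" for y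
    using lmap_add[OF assms(1) x that] lmap_add[OF assms(2) lmap_in[OF assms(1) x] lmap_in[OF assms(1) that]] by simp
  show "g (f (ma L x a)) = ma N (g (f x)) a" if "a \<in> ac A q" for a q
    using lmap_act[OF assms(1) x that] lmap_act[OF assms(2) lmap_in[OF assms(1) x] that] by simp
qed

context
  fixes A :: "'b::ab_group_add alg" and M :: "('b, 'm::ab_group_add) mdl" and N :: "('b, 'n::ab_group_add) mdl"
  assumes M: "mdl A M" and N: "mdl A N"
begin

interpretation M: mdl A M by (rule M)
interpretation N: mdl A N by (rule N)

lemma lmap_zero: "lmap A M N r f \<Longrightarrow> f 0 = 0"
  using lmap_add[of A M N r f 0 0 0] M.zero by simp

lemma lmap_neg: "lmap A M N r f \<Longrightarrow> x \<in> mc M p \<Longrightarrow> f (- x) = - f x"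
  using lmap_add[of A M N r f x p "- x"] M.neg lmap_zero[of r f] by (simp add: eq_neg_iff_add_eq_0 add.commute)

lemma lmap_diff: "lmap A M N r f \<Longrightarrow> x \<in> mc M p \<Longrightarrow> y \<in> mc M p \<Longrightarrow> f (x - y) = f x - f y"
  using lmap_add[of A M N r f x p "- y"] lmap_neg[of r f y p] M.neg by simp

lemma lmap_sg: "lmap A M N r f \<Longrightarrow> x \<in> mc M p \<Longrightarrow> f (sg k x) = sg k (f x)"
  by (auto simp: sg_def lmap_neg)

lemma lmap_sum: "lmap A M N r f \<Longrightarrow> (\<And>i. i \<in> I \<Longrightarrow> x i \<in> mc M p) \<Longrightarrow> f (sum x I) = (\<Sum>i\<in>I. f (x i))"
  by (induction I rule: infinite_finite_induct) (auto simp: lmap_zero lmap_add[where p = p] M.sum_in)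

lemma lmap_plus:
  assumes "lmap A M N r f" "lmap A M N r g" shows "lmap A M N r (\<lambda>x. f x + g x)"
  unfolding lmap_def
proof (intro conjI allI ballI)
  fix p x assume x: "x \<in> mc M p"
  note in' = lmap_in[OF assms(1) x] lmap_in[OF assms(2) x]
  show "f x + g x \<in> mc N (p + r)" using in' N.add by blast
  show "f (x + y) + g (x + y) = f x + g x + (f y + g y)" if "y \<in> mc M p" for y
    using lmap_add[OF assms(1) x that] lmap_add[OF assms(2) x that] by (simp add: algebra_simps)
  show "f (ma M x a) + g (ma M x a) = ma N (f x + g x) a" if "a \<in> ac A q" for a q
    using lmap_act[OF assms(1) x that] lmap_act[OF assms(2) x that] N.act_addl[OF in' that] by simp
qed

lemma lmap_uminus:
  assumes "lmap A M N r g" shows "lmap A M N r (\<lambda>x. - g x)"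
  unfolding lmap_def
proof (intro conjI allI ballI)
  fix p x assume x: "x \<in> mc M p"
  note in' = lmap_in[OF assms x]
  show "- g x \<in> mc N (p + r)" using in' N.neg by blast
  show "- g (x + y) = - g x + - g y" if "y \<in> mc M p" for y
    using lmap_add[OF assms x that] by simp
  show "- g (ma M x a) = ma N (- g x) a" if "a \<in> ac A q" for a q
    using lmap_act[OF assms x that] N.act_negl[OF in' that] by simp
qed

lemma lmap_minus: "lmap A M N r f \<Longrightarrow> lmap A M N r g \<Longrightarrow> lmap A M N r (\<lambda>x. f x - g x)"
  using lmap_plus[of r f "\<lambda>x. - g x"] lmap_uminus[of r g] by simp

lemma cmap_plus:
  assumes "cmap A M N r f" "cmap A M N r g" shows "cmap A M N r (\<lambda>x. f x + g x)"
  unfolding cmap_def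
proof (intro conjI allI ballI)
  show "lmap A M N r (\<lambda>x. f x + g x)" using assms lmap_plus cmap_lmap by blast
  fix p x assume x: "x \<in> mc M p"
  show "md N (f x + g x) = sg r (f (md M x) + g (md M x))"
    using cmap_d[OF assms(1) x] cmap_d[OF assms(2) x] N.d_add lmap_in[OF cmap_lmap[OF assms(1)] x]
      lmap_in[OF cmap_lmap[OF assms(2)] x] by simp
qed

lemma cmap_uminus:
  assumes "cmap A M N r g" shows "cmap A M N r (\<lambda>x. - g x)"
  unfolding cmap_def
proof (intro conjI allI ballI)
  show "lmap A M N r (\<lambda>x. - g x)" using assms lmap_uminus cmap_lmap by blast
  fix p x assume x: "x \<in> mc M p"
  show "md N (- g x) = sg r (- g (md M x))"
    using cmap_d[OF assms(1) x] N.d_neg lmap_in[OF cmap_lmap[OF assms(1)] x] by simp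
qed

lemma cmap_minus: "cmap A M N r f \<Longrightarrow> cmap A M N r g \<Longrightarrow> cmap A M N r (\<lambda>x. f x - g x)"
  using cmap_plus[of r f "\<lambda>x. - g x"] cmap_uminus[of r g] by simp

lemma cmap_cyc: "cmap A M N r f \<Longrightarrow> x \<in> cyc M p \<Longrightarrow> f x \<in> cyc N (p + r)"
  using cmap_d[of A M N r f x p] lmap_in[OF cmap_lmap, of A M N r f x p] lmap_zero[OF cmap_lmap, of r f]
  by (auto simp: cyc_def)

lemma cmap_bdy: "cmap A M N r f \<Longrightarrow> x \<in> bdy M p \<Longrightarrow> f x \<in> bdy N (p + r)"
proof (elim bdyE)
  fix y assume *: "cmap A M N r f" "y \<in> mc M (p - 1)" "x = md M y"
  have fy: "f y \<in> mc N (p + r - 1)" using lmap_in[OF cmap_lmap[OF *(1)] *(2)] by (simp add: algebra_simps)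
  have "md N (sg r (f y)) = sg r (md N (f y))" using N.d_sg[OF fy] by blast
  also have "\<dots> = f x" using cmap_d[OF *(1,2)] *(3) by simp
  finally show ?thesis using N.sg_in[OF fy] by (metis bdyI)
qed

lemma cmap_cyc0: "cmap A M N 0 f \<Longrightarrow> x \<in> cyc M p \<Longrightarrow> f x \<in> cyc N p"
  and cmap_bdy0: "cmap A M N 0 f \<Longrightarrow> x \<in> bdy M p \<Longrightarrow> f x \<in> bdy N p"
  using cmap_cyc cmap_bdy by fastforce+

end

lemma cmap_comp: "\<lbrakk>mdl A L; mdl A M; mdl A N; cmap A L M r f; cmap A M N s g\<rbrakk> \<Longrightarrow> cmap A L N (r + s) (\<lambda>x. g (f x))"
  unfolding cmap_def
proof (intro conjI allI ballI)
  assume *: "mdl A L" "mdl A M" "mdl A N"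
    "lmap A L M r f \<and> (\<forall>p. \<forall>x\<in>mc L p. md M (f x) = sg r (f (md L x)))"
    "lmap A M N s g \<and> (\<forall>p. \<forall>x\<in>mc M p. md N (g x) = sg s (g (md M x)))"
  then show "lmap A L N (r + s) (\<lambda>x. g (f x))" using lmap_comp by blast
  fix p x assume x: "x \<in> mc L p"
  have "f (md L x) \<in> mc M (p + 1 + r)" using * x lmap_in mdl.d by blast
  then have "g (sg r (f (md L x))) = sg r (g (f (md L x)))" using * lmap_sg by blast
  then show "md N (g (f x)) = sg (r + s) (g (f (md L x)))"
    using * x lmap_in[of A L M r f x p] by (metis add.commute sg_sg(1))
qed

lemma cmap_comp0: "\<lbrakk>mdl A L; mdl A M; mdl A N; cmap A L M 0 f; cmap A M N 0 g\<rbrakk> \<Longrightarrow> cmap A L N 0 (\<lambda>x. g (f x))"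
  using cmap_comp[of A L M N 0 f 0 g] by simp

section \<open>Free modules and mapping cones\<close>

text \<open>The direct sum of the shifts A[-deg g]. The generator stands to the left of its
  coefficient, so the differential passes a symbol of degree \<open>deg g\<close> and picks up its
  sign.\<close>

definition free_mdl :: "'b::ab_group_add alg \<Rightarrow> 'g set \<Rightarrow> ('g \<Rightarrow> int) \<Rightarrow> ('b, 'g \<Rightarrow> 'b) mdl"
  where "free_mdl A G deg =
    \<lparr>mc = (\<lambda>p. {q. finite {g. q g \<noteq> 0} \<and> (\<forall>g. q g \<in> ac A (p - deg g)) \<and> (\<forall>g. g \<notin> G \<longrightarrow> q g = 0)}),
     ma = (\<lambda>q a g. am A (q g) a),
     md = (\<lambda>q g. sg (deg g) (ad A (q g)))\<rparr>"

definition sngl :: "'g \<Rightarrow> 'b::zero \<Rightarrow> 'g \<Rightarrow> 'b"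
  where "sngl g a = (\<lambda>h. if h = g then a else 0)"

definition lin :: "('b::ab_group_add, 'n::ab_group_add) mdl \<Rightarrow> ('g \<Rightarrow> 'n) \<Rightarrow> ('g \<Rightarrow> 'b) \<Rightarrow> 'n"
  where "lin N t q = (\<Sum>g | q g \<noteq> 0. ma N (t g) (q g))"

context dga
begin

lemma free_mdl_mc: "q \<in> mc (free_mdl A G deg) p \<longleftrightarrow>
    finite {g. q g \<noteq> 0} \<and> (\<forall>g. q g \<in> ac A (p - deg g)) \<and> (\<forall>g. g \<notin> G \<longrightarrow> q g = 0)"
  by (simp add: free_mdl_def)

lemma free_mdl_ma: "ma (free_mdl A G deg) q a = (\<lambda>g. am A (q g) a)"
  and free_mdl_md: "md (free_mdl A G deg) q = (\<lambda>g. sg (deg g) (ad A (q g)))"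
  by (simp_all add: free_mdl_def)

lemma free_mdl_in: "q \<in> mc (free_mdl A G deg) p \<Longrightarrow> q g \<in> ac A (p - deg g)"
  and free_mdl_finite: "q \<in> mc (free_mdl A G deg) p \<Longrightarrow> finite {g. q g \<noteq> 0}"
  and free_mdl_supp: "q \<in> mc (free_mdl A G deg) p \<Longrightarrow> q g \<noteq> 0 \<Longrightarrow> g \<in> G"
  by (auto simp: free_mdl_mc)

lemma free_mdl_mdl: "mdl A (free_mdl A G deg)"
proof
  fix p q r x y a b
  show "0 \<in> mc (free_mdl A G deg) p" using A.zero by (simp add: free_mdl_mc)
  assume x: "x \<in> mc (free_mdl A G deg) p"
  note x' = free_mdl_in[OF x]
  have supp: "\<And>f. {g. f g \<noteq> 0} \<subseteq> {g. x g \<noteq> 0} \<Longrightarrow> finite {g. f g \<noteq> 0}"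
    using free_mdl_finite[OF x] finite_subset by blast
  show "ma (free_mdl A G deg) x (au A) = x"
    using A.act_unit x' by (fastforce simp: free_mdl_ma)
  have *: "sg (deg g) (ad A (x g)) \<in> ac A (p + 1 - deg g)" for g
    using A.sg_in[OF A.d, of "x g" "p - deg g"] x'[of g] by (simp add: algebra_simps)
  have "finite {g. sg (deg g) (ad A (x g)) \<noteq> 0}" by (rule supp) (use A.d_zero in auto)
  then show "md (free_mdl A G deg) x \<in> mc (free_mdl A G deg) (p + 1)"
    using x * A.d_zero by (auto simp: free_mdl_mc free_mdl_md)
  show "md (free_mdl A G deg) (md (free_mdl A G deg) x) = 0"
  proof
    fix g
    show "md (free_mdl A G deg) (md (free_mdl A G deg) x) g = 0 g"
      using A.d_sg[OF A.d, of "x g" "p - deg g"] A.d_d[of "x g" "p - deg g"] x'[of g] by (simp add: free_mdl_md)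
  qed
  show "x - y \<in> mc (free_mdl A G deg) p" if y: "y \<in> mc (free_mdl A G deg) p"
  proof -
    have "finite ({g. x g \<noteq> 0} \<union> {g. y g \<noteq> 0})" using free_mdl_finite[OF x] free_mdl_finite[OF y] by blast
    moreover have "{g. (x - y) g \<noteq> 0} \<subseteq> {g. x g \<noteq> 0} \<union> {g. y g \<noteq> 0}" by auto
    ultimately have "finite {g. (x - y) g \<noteq> 0}" by (rule rev_finite_subset)
    then show ?thesis using x y A.diff by (simp add: free_mdl_mc)
  qed
  show "md (free_mdl A G deg) (x + y) = md (free_mdl A G deg) x + md (free_mdl A G deg) y" if "y \<in> mc (free_mdl A G deg) p"
  proof
    fix g
    show "md (free_mdl A G deg) (x + y) g = (md (free_mdl A G deg) x + md (free_mdl A G deg) y) g"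
      using A.d_add[of "x g" _ "y g"] x'[of g] free_mdl_in[OF that, of g] by (simp add: free_mdl_md)
  qed
  assume a: "a \<in> ac A q"
  have *: "am A (x g) a \<in> ac A (p + q - deg g)" for g
    using A.act[of "x g" "p - deg g" a q] x'[of g] a by (simp add: algebra_simps)
  have "finite {g. am A (x g) a \<noteq> 0}" by (rule supp) (use A.act_zerol a in auto)
  then show "ma (free_mdl A G deg) x a \<in> mc (free_mdl A G deg) (p + q)"
    using x * A.act_zerol a by (auto simp: free_mdl_mc free_mdl_ma)
  show "ma (free_mdl A G deg) (x + y) a = ma (free_mdl A G deg) x a + ma (free_mdl A G deg) y a" if "y \<in> mc (free_mdl A G deg) p"
  proof
    fix g
    show "(ma (free_mdl A G deg) (x + y) a) g = (ma (free_mdl A G deg) x a + ma (free_mdl A G deg) y a) g" using A.act_addl[of "x g" "p - deg g" "y g" a q] x'[of g] free_mdl_in[OF that, of g] a by (simp add: free_mdl_ma)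
  qed
  show "ma (free_mdl A G deg) x (a + b) = ma (free_mdl A G deg) x a + ma (free_mdl A G deg) x b" if "b \<in> ac A q"
  proof
    fix g
    show "(ma (free_mdl A G deg) x (a + b)) g = (ma (free_mdl A G deg) x a + ma (free_mdl A G deg) x b) g" using A.act_addr[of "x g" "p - deg g" a q b] x'[of g] that a by (simp add: free_mdl_ma)
  qed
  show "ma (free_mdl A G deg) (ma (free_mdl A G deg) x a) b = ma (free_mdl A G deg) x (am A a b)" if "b \<in> ac A r"
  proof
    fix g
    show "(ma (free_mdl A G deg) (ma (free_mdl A G deg) x a) b) g = (ma (free_mdl A G deg) x (am A a b)) g" using A.act_act[of "x g" "p - deg g" a q b r] x'[of g] that a by (simp add: free_mdl_ma)
  qed
  show "md (free_mdl A G deg) (ma (free_mdl A G deg) x a) = ma (free_mdl A G deg) (md (free_mdl A G deg) x) a + sg p (ma (free_mdl A G deg) x (ad A a))"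
  proof
    fix g
    have "ad A (am A (x g) a) = am A (ad A (x g)) a + sg (p - deg g) (am A (x g) (ad A a))"
      using A.d_act[of "x g" "p - deg g" a q] x'[of g] a by simp
    then show "md (free_mdl A G deg) (ma (free_mdl A G deg) x a) g = (ma (free_mdl A G deg) (md (free_mdl A G deg) x) a + sg p (ma (free_mdl A G deg) x (ad A a))) g"
      using A.act_sgl[OF A.d, of "x g" "p - deg g" a q "deg g"] x'[of g] a
      by (simp add: free_mdl_md free_mdl_ma sg_sg) (simp add: sg_def)
  qed
qed

lemma sngl_in: "g \<in> G \<Longrightarrow> a \<in> ac A p \<Longrightarrow> sngl g a \<in> mc (free_mdl A G deg) (deg g + p)"
  using A.zero by (auto simp: free_mdl_mc sngl_def)

lemma sngl_unit: "g \<in> G \<Longrightarrow> sngl g (au A) \<in> cyc (free_mdl A G deg) (deg g)"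
  using sngl_in[OF _ unit] d_unit A.d_zero by (fastforce simp: cyc_def free_mdl_md sngl_def)

lemma sngl_unit_act: "a \<in> ac A p \<Longrightarrow> ma (free_mdl A G deg) (sngl g (au A)) a = sngl g a"
  using A.act_zerol unit_left by (auto simp: free_mdl_ma sngl_def)

lemma sum_sngl:
  assumes "finite S" "{g. q g \<noteq> (0::'b)} \<subseteq> S" shows "q = (\<Sum>g\<in>S. sngl g (q g))"
proof
  fix h
  have "(\<Sum>g\<in>S. sngl g (q g)) h = (\<Sum>g\<in>S. if h = g then q g else 0)"
    by (induction S rule: infinite_finite_induct) (auto simp: sngl_def)
  also have "\<dots> = q h" using assms by (simp add: sum.delta) blast
  finally show "q h = (\<Sum>g\<in>S. sngl g (q g)) h" ..
qed

context
  fixes N :: "('b, 'n::ab_group_add) mdl"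
  assumes N: "mdl A N"
begin

interpretation N: mdl A N by (rule N)

context
  fixes G :: "'g set" and deg :: "'g \<Rightarrow> int"
begin

interpretation F: mdl A "free_mdl A G deg" by (rule free_mdl_mdl)

lemma lin_superset:
  assumes "\<And>g. g \<in> S \<Longrightarrow> t g \<in> mc N (deg g + r)" "finite S" "{g. q g \<noteq> 0} \<subseteq> S"
  shows "lin N t q = (\<Sum>g\<in>S. ma N (t g) (q g))"
  unfolding lin_def
proof (rule sum.mono_neutral_left[OF assms(2,3)], rule ballI)
  fix g assume "g \<in> S - {g. q g \<noteq> 0}"
  then show "ma N (t g) (q g) = 0" using N.act_zeror[OF dga_axioms assms(1)] by simp
qed

context
  fixes t :: "'g \<Rightarrow> 'n" and r :: int
  assumes t: "\<And>g. g \<in> G \<Longrightarrow> t g \<in> mc N (deg g + r)"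
begin

lemma lin_sngl: "g \<in> G \<Longrightarrow> a \<in> ac A p \<Longrightarrow> lin N t (sngl g a) = ma N (t g) a"
proof -
  assume g: "g \<in> G"
  have "{h. sngl g a h \<noteq> 0} \<subseteq> {g}" by (auto simp: sngl_def)
  then show ?thesis using lin_superset[of "{g}" t r "sngl g a"] t g by (simp add: sngl_def)
qed

lemma lin_unit: "g \<in> G \<Longrightarrow> lin N t (sngl g (au A)) = t g"
  using lin_sngl[OF _ unit] N.act_unit t by fastforce

lemma lin_term: "g \<in> G \<Longrightarrow> q \<in> mc (free_mdl A G deg) p \<Longrightarrow> ma N (t g) (q g) \<in> mc N (p + r)"
  using N.act[OF t free_mdl_in, of g q G deg p g] by (simp add: algebra_simps)

lemma lin_lmap: "lmap A (free_mdl A G deg) N r (lin N t)"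
  unfolding lmap_def
proof (intro conjI allI ballI)
  fix p q assume q: "q \<in> mc (free_mdl A G deg) p"
  have tin: "\<And>g. q g \<noteq> 0 \<Longrightarrow> t g \<in> mc N (deg g + r)" using t free_mdl_supp[OF q] by blast
  show "lin N t q \<in> mc N (p + r)"
    unfolding lin_def by (intro N.sum_in) (use lin_term q free_mdl_supp[OF q] in auto)
  show "lin N t (q + q') = lin N t q + lin N t q'" if q': "q' \<in> mc (free_mdl A G deg) p" for q'
  proof -
    let ?S = "{g. q g \<noteq> 0} \<union> {g. q' g \<noteq> 0}"
    have S: "finite ?S" "?S \<subseteq> G" using free_mdl_finite[OF q] free_mdl_finite[OF q'] free_mdl_supp[OF q] free_mdl_supp[OF q'] by auto
    have tS: "g \<in> ?S \<Longrightarrow> t g \<in> mc N (deg g + r)" for g using S(2) t by blast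
    have "lin N t (q + q') = (\<Sum>g\<in>?S. ma N (t g) ((q + q') g))"
      by (rule lin_superset[of _ _ r]) (use S tS in auto)
    also have "\<dots> = (\<Sum>g\<in>?S. ma N (t g) (q g) + ma N (t g) (q' g))"
      by (intro sum.cong HOL.refl) (use N.act_addr[OF tS free_mdl_in[OF q] free_mdl_in[OF q']] in auto)
    also have "\<dots> = lin N t q + lin N t q'"
      using lin_superset[of ?S t r q] lin_superset[of ?S t r q'] S tS by (simp add: sum.distrib)
    finally show ?thesis .
  qed
  show "lin N t (ma (free_mdl A G deg) q a) = ma N (lin N t q) a" if a: "a \<in> ac A k" for a k
  proof -
    let ?S = "{g. q g \<noteq> 0}"
    have "lin N t (ma (free_mdl A G deg) q a) = (\<Sum>g\<in>?S. ma N (t g) (am A (q g) a))"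
      using A.act_zerol a by (subst lin_superset[of ?S t r]) (use free_mdl_finite[OF q] tin in \<open>auto simp: free_mdl_ma\<close>)
    also have "\<dots> = (\<Sum>g\<in>?S. ma N (ma N (t g) (q g)) a)"
      by (intro sum.cong HOL.refl) (use N.act_act[OF tin free_mdl_in[OF q] a] in auto)
    also have "\<dots> = ma N (lin N t q) a"
      unfolding lin_def by (rule N.act_suml[symmetric, where p = "p + r"]) (use lin_term q free_mdl_supp[OF q] a in auto)
    finally show ?thesis .
  qed
qed

end

text \<open>Leibniz rule summed over the support: in the Hom complex the differential of
  \<open>lin N t\<close> is the linear extension of the values d (t g). Hence cocycles as values on
  generators give a closed map, and primitives as values give a homotopy.\<close>

lemma lin_d:
  assumes t: "\<And>g. g \<in> G \<Longrightarrow> t g \<in> mc N (deg g + r)" and q: "q \<in> mc (free_mdl A G deg) p"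
  shows "md N (lin N t q) = lin N (\<lambda>g. md N (t g)) q + sg r (lin N t (md (free_mdl A G deg) q))"
proof -
  let ?S = "{g. q g \<noteq> 0}"
  have tin: "\<And>g. q g \<noteq> 0 \<Longrightarrow> t g \<in> mc N (deg g + r)" using t free_mdl_supp[OF q] by blast
  have *: "md N (ma N (t g) (q g)) = ma N (md N (t g)) (q g) + sg r (ma N (t g) (sg (deg g) (ad A (q g))))"
    if "g \<in> ?S" for g
    using that N.d_act[OF tin free_mdl_in[OF q], of g g] N.act_sgr[OF dga_axioms tin A.d[simplified], of g "q g" "p - deg g" "deg g"]
      free_mdl_in[OF q, of g]
    by (simp add: sg_sg add.commute)
  have "md N (lin N t q) = (\<Sum>g\<in>?S. md N (ma N (t g) (q g)))"
    unfolding lin_def by (rule N.d_sum[where p = "p + r"]) (use lin_term[OF t] q free_mdl_supp[OF q] in auto)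
  also have "\<dots> = lin N (\<lambda>g. md N (t g)) q + sg r (\<Sum>g\<in>?S. ma N (t g) (sg (deg g) (ad A (q g))))"
    using * by (simp add: sum.distrib sg_sum lin_def)
  also have "(\<Sum>g\<in>?S. ma N (t g) (sg (deg g) (ad A (q g)))) = lin N t (md (free_mdl A G deg) q)"
    using A.d_zero by (subst lin_superset[of ?S t r]) (use free_mdl_finite[OF q] tin in \<open>auto simp: free_mdl_md\<close>)
  finally show ?thesis .
qed

lemma lin_zero: "q \<in> mc (free_mdl A G deg) p \<Longrightarrow> (\<And>g. g \<in> G \<Longrightarrow> t g = 0) \<Longrightarrow> lin N t q = 0"
  unfolding lin_def
proof (rule sum.neutral, rule ballI)
  fix g assume q: "q \<in> mc (free_mdl A G deg) p" and "\<And>g. g \<in> G \<Longrightarrow> t g = 0" "g \<in> {g. q g \<noteq> 0}"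
  then have "t g = 0" using free_mdl_supp[OF q] by blast
  then show "ma N (t g) (q g) = 0" using N.act_zerol[OF free_mdl_in[OF q]] by simp
qed

lemma lin_cong: "q \<in> mc (free_mdl A G deg) p \<Longrightarrow> (\<And>g. g \<in> G \<Longrightarrow> t g = t' g) \<Longrightarrow> lin N t q = lin N t' q"
  unfolding lin_def
proof (rule sum.cong[OF HOL.refl])
  fix g assume "q \<in> mc (free_mdl A G deg) p" "\<And>g. g \<in> G \<Longrightarrow> t g = t' g" "g \<in> {g. q g \<noteq> 0}"
  then show "ma N (t g) (q g) = ma N (t' g) (q g)" using free_mdl_supp[of q G deg p g] by simp
qed

lemma lin_cmap:
  assumes t: "\<And>g. g \<in> G \<Longrightarrow> t g \<in> cyc N (deg g + r)"
  shows "cmap A (free_mdl A G deg) N r (lin N t)"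
proof -
  have "lmap A (free_mdl A G deg) N r (lin N t)" using lin_lmap t cyc_mc by metis
  moreover have "md N (lin N t q) = sg r (lin N t (md (free_mdl A G deg) q))" if "q \<in> mc (free_mdl A G deg) p" for p q
    using lin_d[of t r q p] t that lin_zero[OF that, of "\<lambda>g. md N (t g)"] by (simp add: cyc_def)
  ultimately show ?thesis by (auto simp: cmap_def)
qed

lemma lmap_lin:
  assumes f: "lmap A (free_mdl A G deg) N r f" and q: "q \<in> mc (free_mdl A G deg) p"
  shows "f q = lin N (\<lambda>g. f (sngl g (au A))) q"
proof -
  have q': "sngl g (q g) \<in> mc (free_mdl A G deg) p" for g
  \<comment> \<open>A zero coefficient may sit at an index outside \<open>G\<close>, where
    \<open>sngl_in\<close> says nothing.\<close>
  proof (cases "q g = 0")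
    case True
    then have "sngl g (q g) = 0" by (simp add: sngl_def fun_eq_iff)
    then show ?thesis using F.zero by simp
  next
    case False
    then show ?thesis using sngl_in[OF free_mdl_supp[OF q] free_mdl_in[OF q], of g g deg] by simp
  qed
  have "f q = f (\<Sum>g | q g \<noteq> 0. sngl g (q g))"
    by (rule arg_cong[where f = f], rule sum_sngl[OF free_mdl_finite[OF q] subset_refl])
  also have "\<dots> = (\<Sum>g | q g \<noteq> 0. f (sngl g (q g)))"
    by (rule lmap_sum[OF free_mdl_mdl N f q'])
  also have "\<dots> = (\<Sum>g | q g \<noteq> 0. ma N (f (sngl g (au A))) (q g))"
  proof (rule sum.cong[OF HOL.refl])
    fix g assume "g \<in> {g. q g \<noteq> 0}"
    then have g: "g \<in> G" using free_mdl_supp[OF q] by blast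
    show "f (sngl g (q g)) = ma N (f (sngl g (au A))) (q g)"
      using lmap_act[OF f cyc_mc[OF sngl_unit[OF g]] free_mdl_in[OF q], of g] sngl_unit_act[OF free_mdl_in[OF q], of G deg g g]
      by simp
  qed
  finally show ?thesis by (simp add: lin_def)
qed

lemma lmap_eqI:
  assumes "lmap A (free_mdl A G deg) N r f" "lmap A (free_mdl A G deg) N r f'" "q \<in> mc (free_mdl A G deg) p"
    and "\<And>g. g \<in> G \<Longrightarrow> f (sngl g (au A)) = f' (sngl g (au A))"
  shows "f q = f' q"
  using lmap_lin[OF assms(1,3)] lmap_lin[OF assms(2,3)]
    lin_cong[OF assms(3), of "\<lambda>g. f (sngl g (au A))" "\<lambda>g. f' (sngl g (au A))", OF assms(4)] by simp

text \<open>Freeness turns pointwise data into a homotopy: one primitive \<open>s g\<close> per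
  generator, extended linearly, is enough because no relation has to be respected.\<close>

lemma null_homotopy:
  assumes f: "cmap A (free_mdl A G deg) N r f"
    and bdy: "\<And>g. g \<in> G \<Longrightarrow> f (sngl g (au A)) \<in> bdy N (deg g + r)"
  obtains h where "lmap A (free_mdl A G deg) N (r - 1) h"
    "\<And>p q. q \<in> mc (free_mdl A G deg) p \<Longrightarrow> f q = md N (h q) + sg r (h (md (free_mdl A G deg) q))"
proof -
  have "\<forall>g. \<exists>s. g \<in> G \<longrightarrow> s \<in> mc N (deg g + (r - 1)) \<and> f (sngl g (au A)) = md N s"
    using bdy by (metis add_diff_eq bdyE)
  then obtain s where s: "\<And>g. g \<in> G \<Longrightarrow> s g \<in> mc N (deg g + (r - 1))"
    "\<And>g. g \<in> G \<Longrightarrow> f (sngl g (au A)) = md N (s g)" by metis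
  have "f q = md N (lin N s q) + sg r (lin N s (md (free_mdl A G deg) q))" if q: "q \<in> mc (free_mdl A G deg) p" for p q
  proof -
    have "f q = lin N (\<lambda>g. md N (s g)) q"
      using lmap_lin[OF cmap_lmap[OF f] q] lin_cong[OF q, of "\<lambda>g. f (sngl g (au A))" "\<lambda>g. md N (s g)"] s(2) by simp
    then show ?thesis using lin_d[of s "r - 1" q p, OF s(1) q] by simp
  qed
  then show ?thesis using that lin_lmap[of s "r - 1"] s(1) by blast
qed

text \<open>Applied to differences of closed maps, this checks an identity in cohomology on
  generators alone.\<close>

lemma bdy_of_gens:
  assumes f: "cmap A (free_mdl A G deg) N r f"
    and bdy: "\<And>g. g \<in> G \<Longrightarrow> f (sngl g (au A)) \<in> bdy N (deg g + r)"
    and q: "q \<in> cyc (free_mdl A G deg) p"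
  shows "f q \<in> bdy N (p + r)"
proof -
  obtain h where h: "lmap A (free_mdl A G deg) N (r - 1) h"
    "\<And>p q. q \<in> mc (free_mdl A G deg) p \<Longrightarrow> f q = md N (h q) + sg r (h (md (free_mdl A G deg) q))"
    using null_homotopy[OF f bdy] by blast
  have "h 0 = 0" using lmap_zero[OF free_mdl_mdl N h(1)] .
  then have "f q = md N (h q)" using h(2)[OF cyc_mc[OF q]] cyc_d[OF q] by simp
  moreover have "h q \<in> mc N (p + r - 1)" using lmap_in[OF h(1) cyc_mc[OF q]] by (simp add: algebra_simps)
  ultimately show ?thesis by (metis bdyI)
qed

lemma bdy_of_gens0:
  assumes "cmap A (free_mdl A G deg) N 0 f" "\<And>g. g \<in> G \<Longrightarrow> f (sngl g (au A)) \<in> bdy N (deg g)"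
    and "q \<in> cyc (free_mdl A G deg) p"
  shows "f q \<in> bdy N p"
  using bdy_of_gens[OF assms(1) _ assms(3)] assms(2) by simp

end
end

text \<open>Each coefficient of \<open>q\<close> is a cocycle of negative degree
  \<open>p - deg g\<close>, hence bounds; the primitives are collected coordinatewise, with the sign
  of the shift.\<close>

lemma free_mdl_low:
  assumes van: "\<And>p. p < 0 \<Longrightarrow> cyc (self A) p \<subseteq> bdy (self A) p"
    and deg: "\<And>g. g \<in> G \<Longrightarrow> deg g \<ge> m" and p: "p < m" and q: "q \<in> cyc (free_mdl A G deg) p"
  shows "q \<in> bdy (free_mdl A G deg) p"
proof -
  \<comment> \<open>The last conjunct keeps the support of the primitive finite and inside
    \<open>G\<close>.\<close>
  have "\<exists>c. c \<in> ac A (p - 1 - deg g) \<and> q g = ad A c \<and> (q g = 0 \<longrightarrow> c = 0)" for g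
  proof (cases "q g = 0")
    case True then show ?thesis using A.zero A.d_zero by auto
  next
    case False
    then have "p - deg g < 0" using deg free_mdl_supp[OF cyc_mc[OF q]] p by fastforce
    moreover have "q g \<in> cyc (self A) (p - deg g)"
      using free_mdl_in[OF cyc_mc[OF q], of g] cyc_d[OF q] by (auto simp: cyc_def free_mdl_md dest: fun_cong[of _ _ g])
    ultimately have "q g \<in> bdy (self A) (p - deg g)" using van by blast
    then show ?thesis using False by (auto simp: bdy_def algebra_simps)
  qed
  then obtain c where c: "\<And>g. c g \<in> ac A (p - 1 - deg g)" "\<And>g. q g = ad A (c g)" "\<And>g. q g = 0 \<Longrightarrow> c g = 0" by metis
  let ?s = "\<lambda>g. sg (deg g) (c g)"
  have fin: "finite {g. ?s g \<noteq> 0}"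
    by (rule finite_subset[OF _ free_mdl_finite[OF cyc_mc[OF q]]]) (use c(3) in auto)
  have "?s \<in> mc (free_mdl A G deg) (p - 1)"
  proof -
    have "?s g \<in> ac A (p - 1 - deg g)" for g using A.sg_in[of "c g"] c(1) by simp
    moreover have "g \<notin> G \<Longrightarrow> ?s g = 0" for g using c(3)[of g] free_mdl_supp[OF cyc_mc[OF q], of g] by force
    ultimately show ?thesis unfolding free_mdl_mc using fin by blast
  qed
  moreover have "md (free_mdl A G deg) ?s = q"
  proof
    fix g
    have "ad A (sg (deg g) (c g)) = sg (deg g) (ad A (c g))" using A.d_sg[of "c g" "p - 1 - deg g"] c(1)[of g] by simp
    then show "md (free_mdl A G deg) ?s g = q g" using c(2)[of g] by (simp add: free_mdl_md)
  qed
  ultimately show ?thesis by (metis bdyI)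
qed

end

text \<open>
  Pairing and projections of a cone are parameters, since a cone has to be formed both on a product type and
  by filling an empty slot of a sequence.
\<close>

definition cone :: "('n \<Rightarrow> 'p \<Rightarrow> 'c) \<Rightarrow> ('c \<Rightarrow> 'n) \<Rightarrow> ('c \<Rightarrow> 'p) \<Rightarrow>
    ('b, 'p::ab_group_add) mdl \<Rightarrow> ('b, 'n::ab_group_add) mdl \<Rightarrow> ('p \<Rightarrow> 'n) \<Rightarrow> ('b, 'c::ab_group_add) mdl"
  where "cone pr fs sn P N f =
    \<lparr>mc = (\<lambda>p. {c. fs c \<in> mc N p \<and> sn c \<in> mc P (p + 1)}),
     ma = (\<lambda>c a. pr (ma N (fs c) a) (ma P (sn c) a)),
     md = (\<lambda>c. pr (md N (fs c) + f (sn c)) (- md P (sn c)))\<rparr>"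

text \<open>Degree p of the cone is N^p plus P^{p+1}. The projection laws for \<open>pr\<close> ask
  only for first components in \<open>N\<close>: when a slot of a sequence is filled, clearing it
  again recovers just those sequences that vanish there.\<close>

locale mapping_cone = dga A + P: mdl A P + N: mdl A N
  for A :: "'b::ab_group_add alg" and P :: "('b, 'p::ab_group_add) mdl" and N :: "('b, 'n::ab_group_add) mdl" +
  fixes pr :: "'n \<Rightarrow> 'p \<Rightarrow> 'c::ab_group_add" and fs :: "'c \<Rightarrow> 'n" and sn :: "'c \<Rightarrow> 'p" and f :: "'p \<Rightarrow> 'n"
  assumes f: "cmap A P N 0 f"
    and fs_add [simp]: "fs (c + c') = fs c + fs c'" and sn_add [simp]: "sn (c + c') = sn c + sn c'"
    and ext: "fs c = fs c' \<Longrightarrow> sn c = sn c' \<Longrightarrow> c = c'"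
    and fs_pr: "x \<in> mc N p \<Longrightarrow> fs (pr x w) = x" and sn_pr: "x \<in> mc N p \<Longrightarrow> sn (pr x w) = w"
begin

lemma fs_zero [simp]: "fs 0 = 0" and sn_zero [simp]: "sn 0 = 0"
  using fs_add[of 0 0] sn_add[of 0 0] by simp_all

lemma fs_neg [simp]: "fs (- c) = - fs c" and sn_neg [simp]: "sn (- c) = - sn c"
  using fs_add[of c "- c"] sn_add[of c "- c"] by (simp_all add: eq_neg_iff_add_eq_0 add.commute)

lemma fs_diff [simp]: "fs (c - c') = fs c - fs c'" and sn_diff [simp]: "sn (c - c') = sn c - sn c'"
  using fs_add[of c "- c'"] sn_add[of c "- c'"] by simp_all

lemma fs_sg [simp]: "fs (sg k c) = sg k (fs c)" and sn_sg [simp]: "sn (sg k c) = sg k (sn c)"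
  by (simp_all add: sg_def)

abbreviation C :: "('b, 'c) mdl" where "C \<equiv> cone pr fs sn P N f"

lemma C_mc: "c \<in> mc C p \<longleftrightarrow> fs c \<in> mc N p \<and> sn c \<in> mc P (p + 1)"
  by (simp add: cone_def)

lemma d_in: "\<lbrakk>x \<in> mc N p; w \<in> mc P (p + 1)\<rbrakk> \<Longrightarrow> md N x + f w \<in> mc N (p + 1)"
  using N.add N.d lmap_in0[OF cmap_lmap[OF f]] by blast

lemma C_fs: "\<lbrakk>c \<in> mc C p; a \<in> ac A q\<rbrakk> \<Longrightarrow> fs (ma C c a) = ma N (fs c) a"
    "\<lbrakk>c \<in> mc C p; a \<in> ac A q\<rbrakk> \<Longrightarrow> sn (ma C c a) = ma P (sn c) a"
    "c \<in> mc C p \<Longrightarrow> fs (md C c) = md N (fs c) + f (sn c)"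
    "c \<in> mc C p \<Longrightarrow> sn (md C c) = - md P (sn c)"
  using fs_pr[OF N.act, of "fs c" p a q] sn_pr[OF N.act, of "fs c" p a q]
    fs_pr[OF d_in, of "fs c" p "sn c"] sn_pr[OF d_in, of "fs c" p "sn c"]
  by (simp_all add: cone_def)

lemma mdl_C: "mdl A C"
proof
  fix p q r x y a b
  show "0 \<in> mc C p" by (simp add: C_mc N.zero P.zero)
  assume x: "x \<in> mc C p"
  then have x': "fs x \<in> mc N p" "sn x \<in> mc P (p + 1)" by (simp_all add: C_mc)
  have fin: "f (sn x) \<in> mc N (p + 1)" using lmap_in0[OF cmap_lmap[OF f] x'(2)] .
  show in_d: "md C x \<in> mc C (p + 1)"
    using C_fs(3,4)[OF x] d_in[OF x'] P.d[OF x'(2)] P.neg by (simp add: C_mc)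
  show "md C (md C x) = 0"
    using C_fs(3,4)[OF x] C_fs(3,4)[OF in_d] N.d_add[OF N.d fin] x' N.d_d P.d_d P.d_neg[OF P.d]
      cmap_d0[OF f x'(2)] lmap_neg[OF P.mdl_axioms N.mdl_axioms cmap_lmap[OF f] P.d[OF x'(2)]]
    by (intro ext) simp_all
  show in_diff: "x - y \<in> mc C p" if "y \<in> mc C p"
    using x that N.diff P.diff by (simp add: C_mc)
  show "md C (x + y) = md C x + md C y" if y: "y \<in> mc C p"
  proof -
    have "x + y \<in> mc C p" using x y N.add P.add by (simp add: C_mc)
    moreover have y': "fs y \<in> mc N p" "sn y \<in> mc P (p + 1)" using y by (simp_all add: C_mc)
    ultimately show ?thesis
      using C_fs(3,4)[OF x] C_fs(3,4)[OF y] C_fs(3,4)[of "x + y" p]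
        N.d_add[OF x'(1) y'(1)] P.d_add[OF x'(2) y'(2)] lmap_add[OF cmap_lmap[OF f] x'(2) y'(2)]
      by (intro ext) simp_all
  qed
  show "ma C x (au A) = x"
    using C_fs(1,2)[OF x unit] x' N.act_unit P.act_unit by (intro ext) auto
  assume a: "a \<in> ac A q"
  show in_act: "ma C x a \<in> mc C (p + q)"
    using C_fs(1,2)[OF x a] N.act[OF x'(1) a] P.act[OF x'(2) a] by (simp add: C_mc algebra_simps)
  show "ma C (x + y) a = ma C x a + ma C y a" if y: "y \<in> mc C p"
  proof -
    have "x + y \<in> mc C p" using x y N.add P.add by (simp add: C_mc)
    moreover have y': "fs y \<in> mc N p" "sn y \<in> mc P (p + 1)" using y by (simp_all add: C_mc)
    ultimately show ?thesis
      using C_fs(1,2)[OF x a] C_fs(1,2)[OF y a] C_fs(1,2)[OF _ a, of "x + y" p]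
        N.act_addl[OF x'(1) y'(1) a] P.act_addl[OF x'(2) y'(2) a]
      by (intro ext) simp_all
  qed
  show "ma C x (a + b) = ma C x a + ma C x b" if "b \<in> ac A q"
    using C_fs(1,2)[OF x a] C_fs(1,2)[OF x that] C_fs(1,2)[OF x, of "a + b" q] A.add[of a q b] a that
      N.act_addr[OF x'(1) a that] P.act_addr[OF x'(2) a that] by (intro ext) simp_all
  show "ma C (ma C x a) b = ma C x (am A a b)" if b: "b \<in> ac A r"
    using C_fs(1,2)[OF x a] C_fs(1,2)[OF in_act b] C_fs(1,2)[OF x, of "am A a b" "q + r"] A.act[of a q b r] a b
      N.act_act[OF x'(1) a b] P.act_act[OF x'(2) a b] by (intro ext) simp_all
  have da: "ad A a \<in> ac A (q + 1)" using A.d[of a q] a by simp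
  have in2: "ma C (md C x) a + sg p (ma C x (ad A a)) = md C (ma C x a)"
  proof (rule ext)
    show "fs (ma C (md C x) a + sg p (ma C x (ad A a))) = fs (md C (ma C x a))"
      using C_fs(3,4)[OF x] C_fs(1,2)[OF x a] C_fs(1,2)[OF x da] C_fs(1,2)[OF in_d a] C_fs(3,4)[OF in_act] a da x' fin N.act_addl[OF N.d[OF x'(1)] fin a] N.d_act[OF x'(1) a]
        lmap_act[OF cmap_lmap[OF f] x'(2) a] by (simp add: add.assoc add.commute[of _ "ma N (f (sn x)) a"])
    show "sn (ma C (md C x) a + sg p (ma C x (ad A a))) = sn (md C (ma C x a))"
      using C_fs(3,4)[OF x] C_fs(1,2)[OF x a] C_fs(1,2)[OF x da] C_fs(1,2)[OF in_d a] C_fs(3,4)[OF in_act] a da x' P.d_act[OF x'(2) a] P.act_negl[OF P.d[OF x'(2)] a]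
      by (simp add: algebra_simps)
  qed
  then show "md C (ma C x a) = ma C (md C x) a + sg p (ma C x (ad A a))" ..
qed

text \<open>A map out of the cone is a map \<open>g\<close> on \<open>N\<close> together with a
  null-homotopy \<open>h\<close> of g o f; the minus sign in the second component of the
  differential of the cone accounts for the term h d.\<close>

lemma cmap_from_cone:
  assumes T: "mdl A T" and g: "cmap A N T 0 g" and h: "lmap A P T (- 1) h"
    and gh: "\<And>p w. w \<in> mc P p \<Longrightarrow> g (f w) = md T (h w) + h (md P w)"
  shows "cmap A C T 0 (\<lambda>c. g (fs c) + h (sn c))"
  unfolding cmap_def lmap_def
proof (intro conjI allI ballI)
  interpret T: mdl A T by (rule T)
  note gl = cmap_lmap[OF g]
  fix p c assume c: "c \<in> mc C p"
  then have c': "fs c \<in> mc N p" "sn c \<in> mc P (p + 1)" by (simp_all add: C_mc)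
  have g1: "g (fs c) \<in> mc T p" using lmap_in0[OF gl c'(1)] .
  have h1: "h (sn c) \<in> mc T p" using lmap_in[OF h c'(2)] by simp
  show "g (fs c) + h (sn c) \<in> mc T (p + 0)" using T.add[OF g1 h1] by simp
  show "g (fs (c + y)) + h (sn (c + y)) = g (fs c) + h (sn c) + (g (fs y) + h (sn y))" if y: "y \<in> mc C p" for y
  proof -
    have "fs y \<in> mc N p" "sn y \<in> mc P (p + 1)" using y by (simp_all add: C_mc)
    then show ?thesis using lmap_add[OF gl c'(1), of "fs y"] lmap_add[OF h c'(2), of "sn y"] by simp
  qed
  show "g (fs (ma C c a)) + h (sn (ma C c a)) = ma T (g (fs c) + h (sn c)) a" if a: "a \<in> ac A q" for a q
    using C_fs(1,2)[OF c a] lmap_act[OF gl c'(1) a] lmap_act[OF h c'(2) a] T.act_addl[OF g1 h1 a] by simp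
  show "md T (g (fs c) + h (sn c)) = sg 0 (g (fs (md C c)) + h (sn (md C c)))"
    using C_fs(3,4)[OF c] T.d_add[OF g1 h1] cmap_d0[OF g c'(1)] gh[OF c'(2)]
      lmap_add[OF gl N.d[OF c'(1)] lmap_in0[OF cmap_lmap[OF f] c'(2)]]
      lmap_neg[OF P.mdl_axioms T h P.d[OF c'(2)]] by simp
qed

end

section \<open>Cones of split injections between free modules\<close>

text \<open>Up to homotopy, \<open>\<rho>\<close> is a retraction of \<open>D\<close> and \<open>\<pi>\<close> the projection to a complement of its image.\<close>

locale split_block = dga A
  for A :: "'b::ab_group_add alg" +
  fixes G :: "'g set" and deg :: "'g \<Rightarrow> int" and D \<rho> \<pi> :: "('g \<Rightarrow> 'b) \<Rightarrow> 'g \<Rightarrow> 'b"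
  assumes D: "cmap A (free_mdl A G deg) (free_mdl A G deg) 0 D"
    and \<rho>: "cmap A (free_mdl A G deg) (free_mdl A G deg) 0 \<rho>"
    and \<pi>: "cmap A (free_mdl A G deg) (free_mdl A G deg) 0 \<pi>"
    and \<rho>D: "g \<in> G \<Longrightarrow> sngl g (au A) - \<rho> (D (sngl g (au A))) \<in> bdy (free_mdl A G deg) (deg g)"
    and D\<rho>: "g \<in> G \<Longrightarrow> sngl g (au A) - D (\<rho> (sngl g (au A))) - \<pi> (sngl g (au A)) \<in> bdy (free_mdl A G deg) (deg g)"
begin

abbreviation "F \<equiv> free_mdl A G deg"
abbreviation "P \<equiv> cone Pair fst snd F F D"

sublocale F: mdl A F by (rule free_mdl_mdl)

sublocale P: mapping_cone A F F Pair fst snd D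
  by unfold_locales (auto simp: D prod_eq_iff)

sublocale P: mdl A P by (rule P.mdl_C)

lemma P_in: "c \<in> mc P p \<longleftrightarrow> fst c \<in> mc F p \<and> snd c \<in> mc F (p + 1)"
  by (simp add: P.C_mc)

lemma P_d: "md P (q, r) = (md F q + D r, - md F r)"
  by (simp add: cone_def)

lemma P_act: "ma P (q, r) a = (ma F q a, ma F r a)"
  by (simp add: cone_def)

lemma D_zero: "D 0 = 0"
  by (rule lmap_zero[OF F.mdl_axioms F.mdl_axioms cmap_lmap[OF D]])

lemma D_in: "r \<in> mc F p \<Longrightarrow> D r \<in> mc F p"
  by (rule lmap_in0[OF cmap_lmap[OF D]])

lemma cmap_\<rho>D: "cmap A F F 0 (\<lambda>q. \<rho> (D q))"
  by (rule cmap_comp0[OF free_mdl_mdl free_mdl_mdl free_mdl_mdl D \<rho>])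

lemma cmap_D\<rho>: "cmap A F F 0 (\<lambda>q. D (\<rho> q))"
  by (rule cmap_comp0[OF free_mdl_mdl free_mdl_mdl free_mdl_mdl \<rho> D])

lemma \<rho>D_cyc: "q \<in> cyc F p \<Longrightarrow> q - \<rho> (D q) \<in> bdy F p"
  by (rule bdy_of_gens0[OF free_mdl_mdl cmap_minus[OF free_mdl_mdl free_mdl_mdl cmap_id cmap_\<rho>D]]) (use \<rho>D in auto)

lemma D\<rho>_cyc: "q \<in> cyc F p \<Longrightarrow> q - D (\<rho> q) - \<pi> q \<in> bdy F p"
  by (rule bdy_of_gens0[OF free_mdl_mdl cmap_minus[OF free_mdl_mdl free_mdl_mdl cmap_minus[OF free_mdl_mdl free_mdl_mdl cmap_id cmap_D\<rho>] \<pi>]])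
    (use D\<rho> in auto)

lemma cmap_base: "cmap A F P 0 (\<lambda>q. (q, 0))"
proof -
  have "ma F 0 a = 0" if "a \<in> ac A p" for a p using F.act_zerol that by blast
  then show ?thesis
    using F.zero F.d_zero D_zero by (auto simp: cmap_def lmap_def P_in P_act P_d)
qed

text \<open>\<open>D\<close> is injective on cohomology, so the base copy of \<open>F\<close>
  carries all classes of the cone: for a cocycle (q, r) the element \<open>D r\<close> bounds, hence
  so does \<rho> (D r), hence so does \<open>r\<close>, which can then be removed.\<close>

lemma cyc_normal:
  assumes c: "c \<in> cyc P p"
  obtains q where "q \<in> cyc F p" "c - (q, 0) \<in> bdy P p"
proof -
  obtain q r where qr: "c = (q, r)" by (cases c)
  have q: "q \<in> mc F p" and r: "r \<in> mc F (p + 1)" and "md F q + D r = 0" "md F r = 0"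
    using c by (simp_all add: qr cyc_def P_in P_d zero_prod_def)
  then have rc: "r \<in> cyc F (p + 1)" and "D r = md F (- q)"
    using F.d_neg[OF q] minus_unique[of "md F q" "D r"] by (simp_all add: cyc_def)
  then have "D r \<in> bdy F (p + 1)" using bdyI[of "- q" F "p + 1"] F.neg[OF q] by simp
  then have "\<rho> (D r) \<in> bdy F (p + 1)" by (rule cmap_bdy0[OF free_mdl_mdl free_mdl_mdl \<rho>])
  then have "r \<in> bdy F (p + 1)" using F.bdy_cong[OF \<rho>D_cyc[OF rc]] by blast
  then obtain s where s: "s \<in> mc F p" "r = md F s" by (auto elim: bdyE)
  \<comment> \<open>With r = d s the boundary of (0, -s) is (- D s, r), so subtracting it clears the
    second component.\<close>
  have "c - (q + D s, 0) = md P (0, - s)"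
    using s lmap_neg[OF free_mdl_mdl free_mdl_mdl cmap_lmap[OF D] s(1)] F.d_neg[OF s(1)] by (simp add: P_d qr F.d_zero)
  moreover have "(0, - s) \<in> mc P (p - 1)" using F.neg[OF s(1)] F.zero by (simp add: P_in)
  ultimately have 1: "c - (q + D s, 0) \<in> bdy P p" by (metis bdyI)
  have 2: "md F (q + D s) = 0"
    using F.d_add[OF q D_in[OF s(1)]] cmap_d0[OF D s(1)] s(2) \<open>md F q + D r = 0\<close> by simp
  show ?thesis using 1 that[of "q + D s"] 2 F.add[OF q D_in[OF s(1)]] by (simp add: cyc_def)
qed

lemma base_D: "q \<in> cyc F p \<Longrightarrow> (D q, 0) \<in> bdy P p"
  by (rule bdyI[of "(0, q)"]) (auto simp: cyc_def P_in P_d F.zero F.d_zero)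

text \<open>In cohomology q = D (\<rho> q) + \<pi> q, and the image of \<open>D\<close> dies in its
  cone.\<close>

lemma base_\<pi>: assumes q: "q \<in> cyc F p" shows "(q, 0) - (\<pi> q, 0) \<in> bdy P p"
proof -
  have "(q - D (\<rho> q) - \<pi> q, 0) \<in> bdy P p"
    using cmap_bdy0[OF free_mdl_mdl P.mdl_axioms cmap_base D\<rho>_cyc[OF q]] .
  from P.bdy_add[OF this base_D[OF cmap_cyc0[OF free_mdl_mdl free_mdl_mdl \<rho> q]]] show ?thesis by simp
qed

text \<open>Cocycles can be moved into the base copy, where \<open>free_mdl_low\<close>
  applies.\<close>

lemma P_low:
  assumes "\<And>p. p < 0 \<Longrightarrow> cyc (self A) p \<subseteq> bdy (self A) p" "\<And>g. g \<in> G \<Longrightarrow> deg g \<ge> m" "p < m" "c \<in> cyc P p"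
  shows "c \<in> bdy P p"
proof -
  obtain q where q: "q \<in> cyc F p" "c - (q, 0) \<in> bdy P p" using cyc_normal[OF assms(4)] by blast
  have "q \<in> bdy F p" by (rule free_mdl_low[OF assms(1,2,3) q(1)])
  then have "(q, 0) \<in> bdy P p" by (rule cmap_bdy0[OF free_mdl_mdl P.mdl_axioms cmap_base])
  then show ?thesis using P.bdy_cong[OF q(2)] by blast
qed

lemma cmap_from_P:
  assumes T: "mdl A T" and f: "cmap A F T 0 f" and bdy: "\<And>g. g \<in> G \<Longrightarrow> f (D (sngl g (au A))) \<in> bdy T (deg g)"
  obtains \<Phi> where "cmap A P T 0 \<Phi>" "\<And>q. \<Phi> (q, 0) = f q"
proof -
  obtain h where h: "lmap A F T (- 1) h" "\<And>p q. q \<in> mc F p \<Longrightarrow> f (D q) = md T (h q) + h (md F q)"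
    using null_homotopy[OF T cmap_comp0[OF free_mdl_mdl free_mdl_mdl T D f]] bdy by auto
  have "h 0 = 0" by (rule lmap_zero[OF free_mdl_mdl T h(1)])
  moreover have "cmap A P T 0 (\<lambda>c. f (fst c) + h (snd c))"
    by (rule P.cmap_from_cone[OF T f h(1)]) (rule h(2))
  ultimately show ?thesis using that by simp
qed

text \<open>The cone has cells in degrees \<open>deg g\<close> and \<open>deg g - 1\<close>, but
  \<open>T\<close> is only known to be acyclic in the degrees \<open>deg g\<close>. A cell by cell
  extension would stop at the lower cells; the retraction \<open>\<rho>\<close> makes up for this,
  since it splits \<open>D\<close> up to homotopy.\<close>

lemma P_null_homotopy:
  assumes T: "mdl A T" and \<Phi>: "cmap A P T 0 \<Phi>" and van: "\<And>g. g \<in> G \<Longrightarrow> cyc T (deg g) \<subseteq> bdy T (deg g)"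
  obtains H where "lmap A P T (- 1) H" "\<And>p w. w \<in> mc P p \<Longrightarrow> \<Phi> w = md T (H w) + H (md P w)"
proof -
  interpret T: mdl A T by (rule T)
  \<comment> \<open>By the universal property of the cone, \<open>\<Phi>\<close> amounts to the map
    \<open>f\<close> on the base and the null-homotopy \<open>k\<close> of f o D.\<close>
  define f where "f = (\<lambda>q. \<Phi> (q, 0))"
  define k where "k = (\<lambda>r. \<Phi> (0, r))"
  have f: "cmap A F T 0 f" unfolding f_def by (rule cmap_comp0[OF free_mdl_mdl P.mdl_axioms T cmap_base \<Phi>])
  have in0: "(0, r) \<in> mc P (p - 1)" if "r \<in> mc F p" for r p using that F.zero by (simp add: P_in)
  have k: "lmap A F T (- 1) k"
    unfolding lmap_def k_def
  proof (intro conjI allI ballI)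
    fix p r assume r: "r \<in> mc F p"
    show "\<Phi> (0, r) \<in> mc T (p + - 1)" using lmap_in0[OF cmap_lmap[OF \<Phi>] in0[OF r]] by simp
    show "\<Phi> (0, r + r') = \<Phi> (0, r) + \<Phi> (0, r')" if "r' \<in> mc F p" for r'
      using lmap_add[OF cmap_lmap[OF \<Phi>] in0[OF r] in0[OF that]] by simp
    show "\<Phi> (0, ma F r a) = ma T (\<Phi> (0, r)) a" if a: "a \<in> ac A q" for a q
      using lmap_act[OF cmap_lmap[OF \<Phi>] in0[OF r] a] F.act_zerol[OF a] by (simp add: P_act)
  qed
  have split: "\<Phi> (q, r) = f q + k r" if "q \<in> mc F p" "r \<in> mc F (p + 1)" for q r p
    using lmap_add[OF cmap_lmap[OF \<Phi>], of "(q, 0)" p "(0, r)"] that F.zero by (simp add: P_in f_def k_def)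
  have dk: "md T (k r) = f (D r) - k (md F r)" if r: "r \<in> mc F p" for r p
  proof -
    have "md T (k r) = \<Phi> (D r, - md F r)"
      using cmap_d0[OF \<Phi> in0[OF r]] by (simp add: k_def P_d F.d_zero)
    also have "\<dots> = f (D r) + k (- md F r)" by (rule split[OF D_in[OF r] F.neg[OF F.d[OF r]]])
    finally show ?thesis using lmap_neg[OF free_mdl_mdl T k F.d[OF r]] by simp
  qed
  have "f (sngl g (au A)) \<in> bdy T (deg g)" if "g \<in> G" for g
    using cmap_cyc0[OF free_mdl_mdl T f sngl_unit[OF that]] van[OF that] by blast
  then obtain h where h: "lmap A F T (- 1) h" "\<And>p q. q \<in> mc F p \<Longrightarrow> f q = md T (h q) + h (md F q)"
    using null_homotopy[OF T f] by auto
  \<comment> \<open>The obstruction \<open>c\<close> to extending \<open>h\<close> to the cone is removed by adding \<open>c \<circ> \<rho>\<close> to \<open>h\<close>.\<close>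
  define c where "c = (\<lambda>r. k r - h (D r))"
  have hD: "lmap A F T (- 1) (\<lambda>r. h (D r))"
    using lmap_comp[OF cmap_lmap[OF D] h(1)] by simp
  have cl: "lmap A F T (- 1) c" unfolding c_def by (rule lmap_minus[OF free_mdl_mdl T k hD])
  have dc: "md T (c r) = - c (md F r)" if r: "r \<in> mc F p" for r p
  proof -
    have "md T (c r) = md T (k r) - md T (h (D r))"
      unfolding c_def using T.d_diff[OF lmap_in[OF k r] lmap_in[OF hD r]] .
    also have "md T (h (D r)) = f (D r) - h (D (md F r))"
      using h(2)[OF D_in[OF r]] cmap_d0[OF D r] by simp
    finally show ?thesis using dk[OF r] by (simp add: c_def)
  qed
  have c: "cmap A F T (- 1) c" using cl dc by (auto simp: cmap_def)
  \<comment> \<open>\<open>c\<close> need not be null-homotopic, but its difference with c o \<rho>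
    o D is: on a generator x this is the value of the closed map \<open>c\<close> at the boundary x
    - \<rho> (D x).\<close>
  define \<psi> where "\<psi> = (\<lambda>r. c r - c (\<rho> (D r)))"
  have c\<rho>D: "cmap A F T (- 1) (\<lambda>r. c (\<rho> (D r)))"
    using cmap_comp[OF free_mdl_mdl free_mdl_mdl T cmap_\<rho>D c] by simp
  have \<psi>: "cmap A F T (- 1) \<psi>" unfolding \<psi>_def by (rule cmap_minus[OF free_mdl_mdl T c c\<rho>D])
  have "\<psi> (sngl g (au A)) \<in> bdy T (deg g + - 1)" if g: "g \<in> G" for g
  proof -
    let ?x = "sngl g (au A)"
    have x: "?x \<in> mc F (deg g)" by (rule cyc_mc[OF sngl_unit[OF g]])
    have "\<psi> ?x = c (?x - \<rho> (D ?x))"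
      unfolding \<psi>_def using lmap_diff[OF free_mdl_mdl T cl x lmap_in0[OF cmap_lmap[OF cmap_\<rho>D] x]] by simp
    then show ?thesis using cmap_bdy[OF free_mdl_mdl T c \<rho>D[OF g]] by simp
  qed
  then obtain l where l: "lmap A F T (- 1 - 1) l" "\<And>p q. q \<in> mc F p \<Longrightarrow> \<psi> q = md T (l q) + sg (- 1) (l (md F q))"
    using null_homotopy[OF T \<psi>] by blast
  \<comment> \<open>The map c o \<rho> is closed of degree -1, so adding it keeps a null-homotopy of
    \<open>f\<close>, while the obstruction changes from \<open>c\<close> to
    \<open>\<psi>\<close>.\<close>
  define h' where "h' = (\<lambda>q. h q + c (\<rho> q))"
  have c\<rho>: "cmap A F T (- 1) (\<lambda>q. c (\<rho> q))" using cmap_comp[OF free_mdl_mdl free_mdl_mdl T \<rho> c] by simp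
  have h': "lmap A F T (- 1) h'" unfolding h'_def by (rule lmap_plus[OF free_mdl_mdl T h(1) cmap_lmap[OF c\<rho>]])
  have fh': "f q = md T (h' q) + h' (md F q)" if q: "q \<in> mc F p" for q p
    unfolding h'_def using T.d_add[OF lmap_in[OF h(1) q] lmap_in[OF cmap_lmap[OF c\<rho>] q]] h(2)[OF q] cmap_d[OF c\<rho> q]
    by simp
  define H where "H = (\<lambda>w. h' (fst w) + l (snd w))"
  have H: "lmap A P T (- 1) H"
    unfolding lmap_def H_def
  proof (intro conjI allI ballI)
    fix p w assume "w \<in> mc P p"
    then have w: "fst w \<in> mc F p" "snd w \<in> mc F (p + 1)" by (simp_all add: P_in)
    have in': "h' (fst w) \<in> mc T (p - 1)" "l (snd w) \<in> mc T (p - 1)"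
      using lmap_in[OF h' w(1)] lmap_in[OF l(1) w(2)] by simp_all
    then show "h' (fst w) + l (snd w) \<in> mc T (p + - 1)" using T.add by simp
    show "h' (fst (w + w')) + l (snd (w + w')) = h' (fst w) + l (snd w) + (h' (fst w') + l (snd w'))"
      if "w' \<in> mc P p" for w'
      using that lmap_add[OF h' w(1), of "fst w'"] lmap_add[OF l(1) w(2), of "snd w'"] by (simp add: P_in)
    show "h' (fst (ma P w a)) + l (snd (ma P w a)) = ma T (h' (fst w) + l (snd w)) a" if a: "a \<in> ac A q" for a q
      using lmap_act[OF h' w(1) a] lmap_act[OF l(1) w(2) a] T.act_addl[OF in' a] by (cases w) (simp add: P_act)
  qed
  have "\<Phi> w = md T (H w) + H (md P w)" if "w \<in> mc P p" for w p
  proof -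
    obtain q r where w: "w = (q, r)" by (cases w)
    have q: "q \<in> mc F p" and r: "r \<in> mc F (p + 1)" using that by (simp_all add: w P_in)
    have in': "h' q \<in> mc T (p - 1)" "l r \<in> mc T (p - 1)"
      using lmap_in[OF h' q] lmap_in[OF l(1) r] by simp_all
    have "md T (H w) + H (md P w) = md T (h' q) + md T (l r) + (h' (md F q) + h' (D r) - l (md F r))"
      using T.d_add[OF in'] lmap_add[OF h' F.d[OF q] D_in[OF r]] lmap_neg[OF free_mdl_mdl T l(1) F.d[OF r]]
      by (simp add: H_def w P_d)
    also have "\<dots> = f q + (\<psi> r + h' (D r))"
      using fh'[OF q] l(2)[OF r] by simp
    also have "\<dots> = f q + k r" by (simp add: \<psi>_def h'_def c_def)
    finally show ?thesis using split[OF q r] by (simp add: w)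
  qed
  then show ?thesis using that H by blast
qed

end

section \<open>The image of a homotopy idempotent as a cone\<close>

definition lab :: "nat \<Rightarrow> ('g \<Rightarrow> 'b) \<Rightarrow> nat \<times> 'g \<Rightarrow> 'b::zero"
  where "lab i q = (\<lambda>(j, g). if j = i then q g else 0)"

text \<open>
  \<open>E\<close> is idempotent up to homotopy on a free module \<open>Q\<close>. On countably many copies of \<open>Q\<close>, the map
  \<open>D\<close> sends the kernel part of each copy identically to itself and shifts the image part to the next
  copy; so \<open>D\<close> is split injective, with cokernel the image of \<open>E\<close> (an Eilenberg swindle).
\<close>

locale idem_block = dga A
  for A :: "'b::ab_group_add alg" +
  fixes G :: "'g set" and deg :: "'g \<Rightarrow> int" and E :: "('g \<Rightarrow> 'b) \<Rightarrow> 'g \<Rightarrow> 'b"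
  assumes E: "cmap A (free_mdl A G deg) (free_mdl A G deg) 0 E"
    and EE: "g \<in> G \<Longrightarrow> E (sngl g (au A)) - E (E (sngl g (au A))) \<in> bdy (free_mdl A G deg) (deg g)"
begin

abbreviation "Q \<equiv> free_mdl A G deg"
abbreviation "FN \<equiv> free_mdl A (UNIV \<times> G) (\<lambda>(i :: nat, g). deg g)"

sublocale Q: mdl A Q by (rule free_mdl_mdl)
sublocale FN: mdl A FN by (rule free_mdl_mdl)

lemma lab_add: "lab i (x + y) = lab i x + lab i (y :: 'g \<Rightarrow> 'b)"
  and lab_diff: "lab i (x - y) = lab i x - lab i (y :: 'g \<Rightarrow> 'b)"
  and lab_sngl: "lab i (sngl g a) = sngl (i, g) (a :: 'b)"
  by (auto simp: lab_def sngl_def fun_eq_iff)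

lemma lab_cmap: "cmap A Q FN 0 (lab i)"
proof -
  have "lab i q \<in> mc FN p" if q: "q \<in> mc Q p" for p q
  proof -
    have "{x. lab i q x \<noteq> 0} = Pair i ` {g. q g \<noteq> 0}" by (auto simp: lab_def split: if_splits)
    then show ?thesis using q A.zero by (auto simp: free_mdl_mc) (auto simp: lab_def)
  qed
  then show ?thesis
    using A.act_zerol A.d_zero by (auto simp: cmap_def lmap_def lab_add free_mdl_ma free_mdl_md) (auto simp: lab_def fun_eq_iff)
qed

lemma lab_in: "q \<in> mc Q p \<Longrightarrow> lab i q \<in> mc FN p"
  by (rule lmap_in0[OF cmap_lmap[OF lab_cmap]])

lemma lab_cyc: "q \<in> cyc Q p \<Longrightarrow> lab i q \<in> cyc FN p"
  by (rule cmap_cyc0[OF free_mdl_mdl free_mdl_mdl lab_cmap])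

lemma lab_bdy: "q \<in> bdy Q p \<Longrightarrow> lab i q \<in> bdy FN p"
  by (rule cmap_bdy0[OF free_mdl_mdl free_mdl_mdl lab_cmap])

definition "fst_copy q = (\<lambda>g. q (0 :: nat, g :: 'g) :: 'b)"

lemma fst_copy_cmap: "cmap A FN Q 0 fst_copy"
proof -
  have "fst_copy q \<in> mc Q p" if q: "q \<in> mc FN p" for p q
  proof -
    have "{g. fst_copy q g \<noteq> 0} = Pair 0 -` {x. q x \<noteq> 0}" by (auto simp: fst_copy_def)
    then have "finite {g. fst_copy q g \<noteq> 0}"
      using free_mdl_finite[OF q] by (metis finite_vimageI inj_onI prod.inject)
    then show ?thesis using q by (auto simp: free_mdl_mc fst_copy_def)
  qed
  then show ?thesis by (auto simp: cmap_def lmap_def free_mdl_ma free_mdl_md fst_copy_def fun_eq_iff)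
qed

lemma fst_copy_lab: "fst_copy (lab 0 q) = q" "fst_copy (lab (Suc i) q) = 0"
  and fst_copy_add: "fst_copy (x + y) = fst_copy x + fst_copy y"
  by (auto simp: fst_copy_def lab_def fun_eq_iff)

lemma E_in: "q \<in> mc Q p \<Longrightarrow> E q \<in> mc Q p"
  by (rule lmap_in0[OF cmap_lmap[OF E]])

lemma E_cyc: "q \<in> cyc Q p \<Longrightarrow> E q \<in> cyc Q p"
  by (rule cmap_cyc0[OF free_mdl_mdl free_mdl_mdl E])

lemma E_bdy: "q \<in> bdy Q p \<Longrightarrow> E q \<in> bdy Q p"
  by (rule cmap_bdy0[OF free_mdl_mdl free_mdl_mdl E])

lemma E_diff: "x \<in> mc Q p \<Longrightarrow> y \<in> mc Q p \<Longrightarrow> E (x - y) = E x - E y"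
  by (rule lmap_diff[OF free_mdl_mdl free_mdl_mdl cmap_lmap[OF E]])

lemma cmap_EE: "cmap A Q Q 0 (\<lambda>q. E (E q))"
  by (rule cmap_comp0[OF free_mdl_mdl free_mdl_mdl free_mdl_mdl E E])

lemma EE_cyc: "q \<in> cyc Q p \<Longrightarrow> E q - E (E q) \<in> bdy Q p"
  by (rule bdy_of_gens0[OF free_mdl_mdl cmap_minus[OF free_mdl_mdl free_mdl_mdl E cmap_EE]]) (use EE in auto)

definition "D = lin FN (\<lambda>(i, g). lab i (sngl g (au A) - E (sngl g (au A))) + lab (Suc i) (E (sngl g (au A))))"

text \<open>The backward shift on the image parts. The image part of copy 0 has no predecessor and
  is dropped; it is what \<open>\<pi>\<close> keeps.\<close>

definition "\<rho> = lin FN (\<lambda>(i, g). lab i (sngl g (au A) - E (sngl g (au A))) +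
  (case i of 0 \<Rightarrow> 0 | Suc j \<Rightarrow> lab j (E (sngl g (au A)))))"

definition "\<pi> q = lab 0 (E (fst_copy q))"

lemma gen_cyc: "g \<in> G \<Longrightarrow> sngl g (au A) \<in> cyc Q (deg g)"
  by (rule sngl_unit)

lemma D_cmap: "cmap A FN FN 0 D"
  unfolding D_def
  by (rule lin_cmap[OF free_mdl_mdl]) (auto intro!: FN.cyc_add lab_cyc Q.cyc_diff gen_cyc E_cyc)

lemma \<rho>_cmap: "cmap A FN FN 0 \<rho>"
  unfolding \<rho>_def
  by (rule lin_cmap[OF free_mdl_mdl]) (auto intro!: FN.cyc_add FN.cyc_zero lab_cyc Q.cyc_diff gen_cyc E_cyc split: nat.split)

lemma \<pi>_cmap: "cmap A FN FN 0 \<pi>"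
  unfolding \<pi>_def
  by (rule cmap_comp0[OF free_mdl_mdl free_mdl_mdl free_mdl_mdl cmap_comp0[OF free_mdl_mdl free_mdl_mdl free_mdl_mdl fst_copy_cmap E] lab_cmap])

text \<open>\<open>D\<close> and \<open>\<rho>\<close> are defined on generators; by linearity this
  gives their values on whole copies of \<open>Q\<close>.\<close>

lemma copy_eqI:
  assumes f: "cmap A FN FN 0 f" and f': "cmap A Q FN 0 f'" and q: "q \<in> mc Q p"
    and "\<And>g. g \<in> G \<Longrightarrow> f (sngl (i, g) (au A)) = f' (sngl g (au A))"
  shows "f (lab i q) = f' q"
  by (rule lmap_eqI[OF free_mdl_mdl cmap_lmap[OF cmap_comp0[OF free_mdl_mdl free_mdl_mdl free_mdl_mdl lab_cmap f]] cmap_lmap[OF f'] q])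
    (simp add: lab_sngl assms(4))

lemma lab_E_cmap: "cmap A Q FN 0 (\<lambda>q. lab i (E q))"
  by (rule cmap_comp0[OF free_mdl_mdl free_mdl_mdl free_mdl_mdl E lab_cmap])

lemma lab_id_E_cmap: "cmap A Q FN 0 (\<lambda>q. lab i (q - E q))"
  by (rule cmap_comp0[OF free_mdl_mdl free_mdl_mdl free_mdl_mdl cmap_minus[OF free_mdl_mdl free_mdl_mdl cmap_id E] lab_cmap])

lemma D_gen: "g \<in> G \<Longrightarrow> D (sngl (i, g) (au A)) = lab i (sngl g (au A) - E (sngl g (au A))) + lab (Suc i) (E (sngl g (au A)))"
  unfolding D_def
  by (subst lin_unit[OF free_mdl_mdl, where G = "UNIV \<times> G" and deg = "\<lambda>(i, g). deg g" and r = 0])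
    (auto intro!: FN.add lab_in Q.diff E_in cyc_mc[OF gen_cyc])

lemma \<rho>_gen: "g \<in> G \<Longrightarrow> \<rho> (sngl (i, g) (au A)) = lab i (sngl g (au A) - E (sngl g (au A))) +
    (case i of 0 \<Rightarrow> 0 | Suc j \<Rightarrow> lab j (E (sngl g (au A))))"
  unfolding \<rho>_def
  by (subst lin_unit[OF free_mdl_mdl, where G = "UNIV \<times> G" and deg = "\<lambda>(i, g). deg g" and r = 0])
    (auto intro!: FN.add FN.zero lab_in Q.diff E_in cyc_mc[OF gen_cyc] split: nat.split)

lemma D_lab: "q \<in> mc Q p \<Longrightarrow> D (lab i q) = lab i (q - E q) + lab (Suc i) (E q)"
  by (rule copy_eqI[OF D_cmap cmap_plus[OF free_mdl_mdl free_mdl_mdl lab_id_E_cmap lab_E_cmap]]) (simp_all add: D_gen)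

lemma \<rho>_lab: "q \<in> mc Q p \<Longrightarrow> \<rho> (lab 0 q) = lab 0 (q - E q)"
    "q \<in> mc Q p \<Longrightarrow> \<rho> (lab (Suc i) q) = lab (Suc i) (q - E q) + lab i (E q)"
  by (rule copy_eqI[OF \<rho>_cmap lab_id_E_cmap], simp_all add: \<rho>_gen)
    (rule copy_eqI[OF \<rho>_cmap cmap_plus[OF free_mdl_mdl free_mdl_mdl lab_id_E_cmap lab_E_cmap]], simp_all add: \<rho>_gen)

sublocale split_block A "UNIV \<times> G" "\<lambda>(i :: nat, g). deg g" D \<rho> \<pi>
proof
  show "cmap A FN FN 0 D" "cmap A FN FN 0 \<rho>" "cmap A FN FN 0 \<pi>" by (rule D_cmap \<rho>_cmap \<pi>_cmap)+
  fix ig :: "nat \<times> 'g" assume "ig \<in> UNIV \<times> G"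
  then obtain i g where ig: "ig = (i, g)" and g: "g \<in> G" by auto
  define x e where "x = sngl g (au A)" and "e = E x"
  have x: "x \<in> mc Q (deg g)" and e: "e \<in> mc Q (deg g)" and xe: "x - e \<in> mc Q (deg g)"
    using cyc_mc[OF gen_cyc[OF g]] E_in Q.diff by (auto simp: x_def e_def)
  have Exe: "E (x - e) = e - E e" using E_diff[OF x e] by (simp add: e_def)
  \<comment> \<open>\<open>E\<close> is idempotent only up to boundaries. After expansion the errors
    in both identities are sums and differences of copies of e - E e, so this one fact settles all
    cases.\<close>
  have \<beta>: "lab j (e - E e) \<in> bdy FN (deg g)" for j using lab_bdy[OF EE[OF g]] by (simp add: x_def e_def)
  have xlab: "sngl ig (au A) = lab i x" by (simp add: ig x_def lab_sngl)
  note \<rho>_add = lmap_add[OF cmap_lmap[OF \<rho>_cmap] lab_in lab_in]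
  note D_add = lmap_add[OF cmap_lmap[OF D_cmap] lab_in lab_in]
  have Dx: "D (lab i x) = lab i (x - e) + lab (Suc i) e" using D_lab[OF x] by (simp add: e_def)
  show "sngl ig (au A) - \<rho> (D (sngl ig (au A))) \<in> bdy FN (case ig of (i, g) \<Rightarrow> deg g)"
  proof (cases i)
    case 0
    have "\<rho> (D (lab i x)) = lab 0 (x - e - (e - E e)) + (lab 1 (e - E e) + lab 0 (E e))"
      unfolding Dx using \<rho>_add[OF xe e] \<rho>_lab(1)[OF xe] \<rho>_lab(2)[OF e] Exe by (simp add: 0)
    then have "lab i x - \<rho> (D (lab i x)) = lab 0 (e - E e) + lab 0 (e - E e) - lab 1 (e - E e)"
      by (simp add: 0 lab_diff lab_add algebra_simps)
    then show ?thesis unfolding xlab by (simp only: ig prod.case) (intro FN.bdy_add FN.bdy_diff \<beta>)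
  next
    case (Suc j)
    have "\<rho> (D (lab i x)) = lab i (x - e - (e - E e)) + lab j (e - E e) + (lab (Suc i) (e - E e) + lab i (E e))"
      unfolding Dx using \<rho>_add[OF xe e] \<rho>_lab(2)[OF xe] \<rho>_lab(2)[OF e] Exe by (simp add: Suc)
    then have "lab i x - \<rho> (D (lab i x)) = lab i (e - E e) + lab i (e - E e) - lab j (e - E e) - lab (Suc i) (e - E e)"
      by (simp add: lab_diff lab_add algebra_simps)
    then show ?thesis unfolding xlab by (simp only: ig prod.case) (intro FN.bdy_add FN.bdy_diff \<beta>)
  qed
  show "sngl ig (au A) - D (\<rho> (sngl ig (au A))) - \<pi> (sngl ig (au A)) \<in> bdy FN (case ig of (i, g) \<Rightarrow> deg g)"
  proof (cases i)
    case 0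
    have "D (\<rho> (lab i x)) = lab 0 (x - e - (e - E e)) + lab 1 (e - E e)"
      using \<rho>_lab(1)[OF x] D_lab[OF xe] Exe by (simp add: 0 e_def)
    then have "lab i x - D (\<rho> (lab i x)) - \<pi> (lab i x) = lab 0 (e - E e) - lab 1 (e - E e)"
      by (simp add: 0 lab_diff lab_add \<pi>_def fst_copy_lab e_def algebra_simps)
    then show ?thesis unfolding xlab by (simp only: ig prod.case) (intro FN.bdy_add FN.bdy_diff \<beta>)
  next
    case (Suc j)
    have "\<rho> (lab i x) = lab i (x - e) + lab j e" using \<rho>_lab(2)[OF x] by (simp add: Suc e_def)
    then have "D (\<rho> (lab i x)) = lab i (x - e - (e - E e)) + lab (Suc i) (e - E e) + (lab j (e - E e) + lab i (E e))"
      using D_add[OF xe e] D_lab[OF xe] D_lab[OF e] Exe by (simp add: Suc)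
    moreover have "\<pi> (lab i x) = lab 0 0"
      using lmap_zero[OF free_mdl_mdl free_mdl_mdl cmap_lmap[OF E]] by (simp add: Suc \<pi>_def fst_copy_lab)
    moreover have "lab 0 (0 :: 'g \<Rightarrow> 'b) = 0" by (simp add: lab_def fun_eq_iff)
    ultimately have "lab i x - D (\<rho> (lab i x)) - \<pi> (lab i x) = lab i (e - E e) + lab i (e - E e) - lab j (e - E e) - lab (Suc i) (e - E e)"
      by (simp add: lab_diff lab_add algebra_simps)
    then show ?thesis unfolding xlab by (simp only: ig prod.case) (intro FN.bdy_add FN.bdy_diff \<beta>)
  qed
qed

definition "incl q = (lab 0 q, 0 :: nat \<times> 'g \<Rightarrow> 'b)"

lemma incl_cmap: "cmap A Q P 0 incl"
  unfolding incl_def by (rule cmap_comp0[OF free_mdl_mdl free_mdl_mdl P.mdl_axioms lab_cmap cmap_base])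

text \<open>\<open>base_\<pi>\<close> moves a class into the image part of copy 0; thus every class
  of the cone comes from the image of \<open>E\<close> on the cohomology of
  \<open>Q\<close>.\<close>

lemma P_normal:
  assumes c: "c \<in> cyc P p"
  obtains q where "q \<in> cyc Q p" "c - incl (E q) \<in> bdy P p"
proof -
  obtain q where q: "q \<in> cyc FN p" "c - (q, 0) \<in> bdy P p" using cyc_normal[OF c] by blast
  have "c - incl (E (fst_copy q)) \<in> bdy P p"
    using P.bdy_add[OF q(2) base_\<pi>[OF q(1)]] unfolding diff_add_eq_diff_diff_swap add_diff_eq diff_add_cancel
    by (simp add: incl_def \<pi>_def)
  then show ?thesis using that cmap_cyc0[OF free_mdl_mdl free_mdl_mdl fst_copy_cmap q(1)] by blast
qed

text \<open>Extend \<open>f\<close> by 0 on the copies of positive index. Only copy 0 can then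
  obstruct the extension over the cone, and there \<open>D\<close> contributes x - E x, which is
  what \<open>fE\<close> controls.\<close>

lemma cmap_on_P:
  assumes T: "mdl A T" and f: "cmap A Q T 0 f"
    and fE: "\<And>g. g \<in> G \<Longrightarrow> f (sngl g (au A)) - f (E (sngl g (au A))) \<in> bdy T (deg g)"
  obtains \<Phi> where "cmap A P T 0 \<Phi>" "\<And>q. \<Phi> (incl q) = f q"
proof -
  interpret T: mdl A T by (rule T)
  have "f (fst_copy (D (sngl ig (au A)))) \<in> bdy T (case ig of (i, g) \<Rightarrow> deg g)" if ig': "ig \<in> UNIV \<times> G" for ig
  proof -
    obtain i g where ig: "ig = (i, g)" and g: "g \<in> G" using ig' by blast
    have x: "sngl g (au A) \<in> mc Q (deg g)" by (rule cyc_mc[OF gen_cyc[OF g]])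
    show ?thesis
      using fE[OF g] lmap_diff[OF free_mdl_mdl T cmap_lmap[OF f] x E_in[OF x]] lmap_zero[OF free_mdl_mdl T cmap_lmap[OF f]] T.bdy_zero
      by (cases i) (simp_all add: ig D_gen[OF g] fst_copy_add fst_copy_lab)
  qed
  from cmap_from_P[OF T cmap_comp0[OF free_mdl_mdl free_mdl_mdl T fst_copy_cmap f] this]
  obtain \<Phi> where "cmap A P T 0 \<Phi>" "\<And>q. \<Phi> (q, 0) = f (fst_copy q)" by blast
  then show ?thesis using that[of \<Phi>] by (simp add: incl_def fst_copy_lab)
qed

end

section \<open>Dg modules in ambient additive groups\<close>

text \<open>The product of all abelian groups on \<open>'m\<close>: every such group embeds into it, once for each degree.\<close>

typedef 'm ambient = "{f :: int \<Rightarrow> 'm monoid \<Rightarrow> 'm. \<forall>p G. if comm_group G then f p G \<in> carrier G else f p G = undefined}"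
proof
  show "(\<lambda>p G. if comm_group G then \<one>\<^bsub>G\<^esub> else undefined) \<in> {f. \<forall>p G. if comm_group G then f p G \<in> carrier G else f p G = undefined}"
    by (auto simp: comm_group_def group.is_monoid monoid.one_closed)
qed

lemma comm_group_simps:
  assumes "comm_group G"
  shows "\<one>\<^bsub>G\<^esub> \<in> carrier G"
    "x \<in> carrier G \<Longrightarrow> y \<in> carrier G \<Longrightarrow> x \<otimes>\<^bsub>G\<^esub> y \<in> carrier G"
    "x \<in> carrier G \<Longrightarrow> inv\<^bsub>G\<^esub> x \<in> carrier G"
    "x \<in> carrier G \<Longrightarrow> \<one>\<^bsub>G\<^esub> \<otimes>\<^bsub>G\<^esub> x = x"
    "x \<in> carrier G \<Longrightarrow> x \<otimes>\<^bsub>G\<^esub> \<one>\<^bsub>G\<^esub> = x"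
    "x \<in> carrier G \<Longrightarrow> inv\<^bsub>G\<^esub> x \<otimes>\<^bsub>G\<^esub> x = \<one>\<^bsub>G\<^esub>"
    "x \<in> carrier G \<Longrightarrow> x \<otimes>\<^bsub>G\<^esub> inv\<^bsub>G\<^esub> x = \<one>\<^bsub>G\<^esub>"
    "x \<in> carrier G \<Longrightarrow> y \<in> carrier G \<Longrightarrow> z \<in> carrier G \<Longrightarrow> x \<otimes>\<^bsub>G\<^esub> y \<otimes>\<^bsub>G\<^esub> z = x \<otimes>\<^bsub>G\<^esub> (y \<otimes>\<^bsub>G\<^esub> z)"
    "x \<in> carrier G \<Longrightarrow> y \<in> carrier G \<Longrightarrow> x \<otimes>\<^bsub>G\<^esub> y = y \<otimes>\<^bsub>G\<^esub> x"
proof -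
  interpret comm_group G by fact
  show "\<one>\<^bsub>G\<^esub> \<in> carrier G"
    "x \<in> carrier G \<Longrightarrow> y \<in> carrier G \<Longrightarrow> x \<otimes>\<^bsub>G\<^esub> y \<in> carrier G"
    "x \<in> carrier G \<Longrightarrow> inv\<^bsub>G\<^esub> x \<in> carrier G"
    "x \<in> carrier G \<Longrightarrow> \<one>\<^bsub>G\<^esub> \<otimes>\<^bsub>G\<^esub> x = x"
    "x \<in> carrier G \<Longrightarrow> x \<otimes>\<^bsub>G\<^esub> \<one>\<^bsub>G\<^esub> = x"
    "x \<in> carrier G \<Longrightarrow> inv\<^bsub>G\<^esub> x \<otimes>\<^bsub>G\<^esub> x = \<one>\<^bsub>G\<^esub>"
    "x \<in> carrier G \<Longrightarrow> x \<otimes>\<^bsub>G\<^esub> inv\<^bsub>G\<^esub> x = \<one>\<^bsub>G\<^esub>"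
    "x \<in> carrier G \<Longrightarrow> y \<in> carrier G \<Longrightarrow> z \<in> carrier G \<Longrightarrow> x \<otimes>\<^bsub>G\<^esub> y \<otimes>\<^bsub>G\<^esub> z = x \<otimes>\<^bsub>G\<^esub> (y \<otimes>\<^bsub>G\<^esub> z)"
    by (auto simp: m_assoc)
  show "x \<in> carrier G \<Longrightarrow> y \<in> carrier G \<Longrightarrow> x \<otimes>\<^bsub>G\<^esub> y = y \<otimes>\<^bsub>G\<^esub> x" by (rule m_comm)
qed

instantiation ambient :: (type) ab_group_add
begin

definition "0 = Abs_ambient (\<lambda>p G. if comm_group G then \<one>\<^bsub>G\<^esub> else undefined)"
definition "x + y = Abs_ambient (\<lambda>p G. if comm_group G then Rep_ambient x p G \<otimes>\<^bsub>G\<^esub> Rep_ambient y p G else undefined)"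
definition "- x = Abs_ambient (\<lambda>p G. if comm_group G then inv\<^bsub>G\<^esub> Rep_ambient x p G else undefined)"
definition "(x :: 'a ambient) - y = x + - y"

lemma Rep_ambient_carrier: "comm_group G \<Longrightarrow> Rep_ambient x p G \<in> carrier G"
  using Rep_ambient[of x] by (metis (mono_tags, lifting) mem_Collect_eq)

lemma Rep_ambient_undefined: "\<not> comm_group G \<Longrightarrow> Rep_ambient x p G = undefined"
  using Rep_ambient[of x] by (metis (mono_tags, lifting) mem_Collect_eq)

lemma Rep_ambient_simps:
  assumes G: "comm_group G"
  shows "Rep_ambient 0 p G = \<one>\<^bsub>G\<^esub>"
    "Rep_ambient (x + y) p G = Rep_ambient x p G \<otimes>\<^bsub>G\<^esub> Rep_ambient y p G"
    "Rep_ambient (- x) p G = inv\<^bsub>G\<^esub> Rep_ambient x p G"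
  using G unfolding zero_ambient_def plus_ambient_def uminus_ambient_def
  by (subst Abs_ambient_inverse; auto simp: comm_group_simps Rep_ambient_carrier)+

lemma ambient_eqI: "(\<And>p G. comm_group G \<Longrightarrow> Rep_ambient x p G = Rep_ambient y p G) \<Longrightarrow> x = y"
  by (rule Rep_ambient_inject[THEN iffD1], intro HOL.ext) (metis Rep_ambient_undefined)

instance
proof
  fix a b c :: "'a ambient"
  show "a + b + c = a + (b + c)"
    by (rule ambient_eqI) (simp add: Rep_ambient_simps comm_group_simps(8) Rep_ambient_carrier)
  show "a + b = b + a"
    by (rule ambient_eqI) (simp add: Rep_ambient_simps comm_group_simps(9) Rep_ambient_carrier)
  show "0 + a = a" "- a + a = 0"
    by (rule ambient_eqI, simp add: Rep_ambient_simps comm_group_simps Rep_ambient_carrier)+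
  show "a - b = a + - b" by (rule minus_ambient_def)
qed

end

section \<open>Embedding dg modules into ambient groups\<close>

definition emb :: "int \<Rightarrow> 'm monoid \<Rightarrow> 'm \<Rightarrow> 'm ambient"
  where "emb p G x = Abs_ambient (\<lambda>q H. if comm_group H then if q = p \<and> H = G then x else \<one>\<^bsub>H\<^esub> else undefined)"

context
  fixes G :: "'m monoid" assumes G: "comm_group G"
begin

lemma Rep_emb:
  assumes "x \<in> carrier G" "comm_group H"
  shows "Rep_ambient (emb p G x) q H = (if q = p \<and> H = G then x else \<one>\<^bsub>H\<^esub>)"
  unfolding emb_def using assms by (subst Abs_ambient_inverse) (auto simp: comm_group_simps(1))

lemma emb_add:
  assumes "x \<in> carrier G" "y \<in> carrier G" shows "emb p G (x \<otimes>\<^bsub>G\<^esub> y) = emb p G x + emb p G y"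
proof (rule ambient_eqI)
  fix q and H :: "'m monoid" assume H: "comm_group H"
  note dg_rep = Rep_emb[OF assms(1) H, of p q] Rep_emb[OF assms(2) H, of p q]
    Rep_emb[OF comm_group_simps(2)[OF G assms] H, of p q]
  show "Rep_ambient (emb p G (x \<otimes>\<^bsub>G\<^esub> y)) q H = Rep_ambient (emb p G x + emb p G y) q H"
  proof (cases "q = p \<and> H = G")
    case True
    then show ?thesis unfolding Rep_ambient_simps(2)[OF H] dg_rep if_P[OF True] by (elim conjE) (erule ssubst, rule HOL.refl)
  next
    case False
    then show ?thesis
      unfolding Rep_ambient_simps(2)[OF H] dg_rep if_not_P[OF False] by (simp only: comm_group_simps(4)[OF H comm_group_simps(1)[OF H]])
  qed
qed

lemma emb_one: "emb p G \<one>\<^bsub>G\<^esub> = 0"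
proof (rule ambient_eqI)
  fix q and H :: "'m monoid" assume H: "comm_group H"
  have "(if q = p \<and> H = G then \<one>\<^bsub>G\<^esub> else \<one>\<^bsub>H\<^esub>) = \<one>\<^bsub>H\<^esub>"
    by (rule if_split[where P = "\<lambda>z. z = \<one>\<^bsub>H\<^esub>", THEN iffD2]) blast
  then show "Rep_ambient (emb p G \<one>\<^bsub>G\<^esub>) q H = Rep_ambient 0 q H"
    unfolding Rep_ambient_simps(1)[OF H] Rep_emb[OF comm_group_simps(1)[OF G] H] .
qed

lemma Rep_emb_same: "x \<in> carrier G \<Longrightarrow> Rep_ambient (emb p G x) p G = x"
  using Rep_emb[OF _ G, of x p p] by simp

lemma Rep_emb_other: "x \<in> carrier G \<Longrightarrow> comm_group H \<Longrightarrow> \<not> (q = p \<and> H = G) \<Longrightarrow> Rep_ambient (emb p G x) q H = \<one>\<^bsub>H\<^esub>"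
  by (subst Rep_emb) (assumption | rule if_not_P)+

lemma emb_eq: "x \<in> carrier G \<Longrightarrow> y \<in> carrier G \<Longrightarrow> emb p G x = emb p G y \<longleftrightarrow> x = y"
  using Rep_emb_same by metis

end

text \<open>A common element of two different coordinate subgroups is neutral in every coordinate.
  This makes the choices in \<open>ambient_mdl\<close> independent of the chosen
  representation.\<close>

lemma emb_eq_cases:
  assumes "comm_group G" "x \<in> carrier G" "comm_group H" "y \<in> carrier H" "emb p G x = emb q H y"
  shows "(p = q \<and> G = H \<and> x = y) \<or> (x = \<one>\<^bsub>G\<^esub> \<and> y = \<one>\<^bsub>H\<^esub>)"
proof (cases "p = q \<and> G = H")
  case True
  then show ?thesis using assms emb_eq by metis
next
  case False
  have "x = \<one>\<^bsub>G\<^esub>"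
    using Rep_emb_same[OF assms(1,2), of p] Rep_emb_other[OF assms(3,4,1), of p q] assms(5) False by metis
  moreover have "y = \<one>\<^bsub>H\<^esub>"
    using Rep_emb_same[OF assms(3,4), of q] Rep_emb_other[OF assms(1,2,3), of q p] assms(5) False by metis
  ultimately show ?thesis by blast
qed

lemma emb_inv: "comm_group G \<Longrightarrow> x \<in> carrier G \<Longrightarrow> emb p G (inv\<^bsub>G\<^esub> x) = - emb p G x"
  using emb_add[of G x "inv\<^bsub>G\<^esub> x" p] emb_one[of G p] by (simp add: comm_group_simps eq_neg_iff_add_eq_0 add.commute)

lemma emb_signed: "comm_group G \<Longrightarrow> x \<in> carrier G \<Longrightarrow> emb p G (signed k G x) = sg k (emb p G x)"
  by (auto simp: signed_def sg_def emb_inv)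

text \<open>The choices are well defined, since parts of different degrees meet only in \<open>0\<close>.\<close>

definition ambient_mdl :: "('k, 'a) dg_algebra \<Rightarrow> ('a, 'm) dg_module \<Rightarrow> ('a ambient, 'm ambient) mdl"
  where "ambient_mdl A X =
    \<lparr>mc = (\<lambda>p. emb p (mgrp X p) ` carrier (mgrp X p)),
     ma = (\<lambda>\<xi> \<alpha>. SOME \<zeta>. \<exists>p q x a. x \<in> carrier (mgrp X p) \<and> a \<in> carrier (rgrp A q) \<and>
        \<xi> = emb p (mgrp X p) x \<and> \<alpha> = emb q (rgrp A q) a \<and> \<zeta> = emb (p + q) (mgrp X (p + q)) (mact X p q x a)),
     md = (\<lambda>\<xi>. SOME \<zeta>. \<exists>p x. x \<in> carrier (mgrp X p) \<and>
        \<xi> = emb p (mgrp X p) x \<and> \<zeta> = emb (p + 1) (mgrp X (p + 1)) (mdiff X p x))\<rparr>"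

definition regular :: "('k, 'a) dg_algebra \<Rightarrow> ('a, 'a) dg_module"
  where "regular A = \<lparr>mgrp = rgrp A, mact = rmul A, mdiff = rdiff A\<rparr>"

lemma regular_simps [simp]: "mgrp (regular A) = rgrp A" "mact (regular A) = rmul A" "mdiff (regular A) = rdiff A"
  by (simp_all add: regular_def)

text \<open>Reading the algebra off its regular module lets \<open>mdl_ambient\<close> supply all
  laws of \<open>dga\<close> except those on the unit.\<close>

definition AA :: "('k, 'a) dg_algebra \<Rightarrow> 'a ambient alg"
  where "AA A = \<lparr>ac = mc (ambient_mdl A (regular A)), am = ma (ambient_mdl A (regular A)), au = emb 0 (rgrp A 0) (rone A), ad = md (ambient_mdl A (regular A))\<rparr>"

lemma (in dg_algebra) regular_dg_module: "dg_module A (regular A)"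
  by (intro dg_module.intro graded_module.intro graded_module_axioms.intro dg_module_axioms.intro graded_ring_axioms)
    (simp_all add: rgrp rmul_left rmul_right rmul_assoc rone_right rdiff rdiff_rdiff rdiff_rmul)

lemma hom_one_comm: "comm_group G \<Longrightarrow> comm_group H \<Longrightarrow> h \<in> hom G H \<Longrightarrow> h \<one>\<^bsub>G\<^esub> = \<one>\<^bsub>H\<^esub>"
  by (rule hom_one) (auto simp: comm_group_def)

context dg_module
begin

lemma mact_closed: "x \<in> carrier (mgrp M p) \<Longrightarrow> a \<in> carrier (rgrp A q) \<Longrightarrow> mact M p q x a \<in> carrier (mgrp M (p + q))"
  using mact_right hom_in_carrier by metis

lemma mact_one_left: "a \<in> carrier (rgrp A q) \<Longrightarrow> mact M p q \<one>\<^bsub>mgrp M p\<^esub> a = \<one>\<^bsub>mgrp M (p + q)\<^esub>"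
  using hom_one_comm[OF mgrp mgrp mact_left] by blast

lemma mact_one_right: "x \<in> carrier (mgrp M p) \<Longrightarrow> mact M p q x \<one>\<^bsub>rgrp A q\<^esub> = \<one>\<^bsub>mgrp M (p + q)\<^esub>"
  using hom_one_comm[OF rgrp mgrp mact_right] by blast

lemma mdiff_closed: "x \<in> carrier (mgrp M p) \<Longrightarrow> mdiff M p x \<in> carrier (mgrp M (p + 1))"
  using mdiff hom_in_carrier by metis

lemma mdiff_one: "mdiff M p \<one>\<^bsub>mgrp M p\<^esub> = \<one>\<^bsub>mgrp M (p + 1)\<^esub>"
  using hom_one_comm[OF mgrp mgrp mdiff] by blast

abbreviation "j p \<equiv> emb p (mgrp M p)"
abbreviation "\<iota> p \<equiv> emb p (rgrp A p)"

lemma ambient_ma: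
  assumes x: "x \<in> carrier (mgrp M p)" and a: "a \<in> carrier (rgrp A q)"
  shows "ma (ambient_mdl A M) (j p x) (\<iota> q a) = j (p + q) (mact M p q x a)"
proof -
  have "\<zeta> = j (p + q) (mact M p q x a)"
    if "x' \<in> carrier (mgrp M p') \<and> a' \<in> carrier (rgrp A q') \<and> j p x = j p' x' \<and> \<iota> q a = \<iota> q' a' \<and>
      \<zeta> = j (p' + q') (mact M p' q' x' a')" for \<zeta> p' q' x' a'
  proof -
    have "(p = p' \<and> x = x') \<or> (x = \<one>\<^bsub>mgrp M p\<^esub> \<and> x' = \<one>\<^bsub>mgrp M p'\<^esub>)"
      using emb_eq_cases[OF mgrp x mgrp, of x' p' p p'] that by auto
    moreover have "(q = q' \<and> a = a') \<or> (a = \<one>\<^bsub>rgrp A q\<^esub> \<and> a' = \<one>\<^bsub>rgrp A q'\<^esub>)"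
      using emb_eq_cases[OF rgrp a rgrp, of a' q' q q'] that by auto
    ultimately show ?thesis
      using that x a by (auto simp: mact_one_left mact_one_right emb_one[OF mgrp])
  qed
  then have "(SOME \<zeta>. \<exists>p' q' x' a'. x' \<in> carrier (mgrp M p') \<and> a' \<in> carrier (rgrp A q') \<and>
        j p x = j p' x' \<and> \<iota> q a = \<iota> q' a' \<and> \<zeta> = j (p' + q') (mact M p' q' x' a')) = j (p + q) (mact M p q x a)"
    using x a by (intro some_equality) blast+
  then show ?thesis by (simp add: ambient_mdl_def)
qed

lemma ambient_md:
  assumes x: "x \<in> carrier (mgrp M p)"
  shows "md (ambient_mdl A M) (j p x) = j (p + 1) (mdiff M p x)"
proof -
  have "\<zeta> = j (p + 1) (mdiff M p x)"
    if "x' \<in> carrier (mgrp M p') \<and> j p x = j p' x' \<and> \<zeta> = j (p' + 1) (mdiff M p' x')" for \<zeta> p' x'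
  proof -
    have "(p = p' \<and> x = x') \<or> (x = \<one>\<^bsub>mgrp M p\<^esub> \<and> x' = \<one>\<^bsub>mgrp M p'\<^esub>)"
      using emb_eq_cases[OF mgrp x mgrp, of x' p' p p'] that by auto
    then show ?thesis using that x by (auto simp: mdiff_one emb_one[OF mgrp])
  qed
  then have "(SOME \<zeta>. \<exists>p' x'. x' \<in> carrier (mgrp M p') \<and> j p x = j p' x' \<and> \<zeta> = j (p' + 1) (mdiff M p' x')) = j (p + 1) (mdiff M p x)"
    using x by (intro some_equality) blast+
  then show ?thesis by (simp add: ambient_mdl_def)
qed

lemma ambient_mc: "mc (ambient_mdl A M) p = j p ` carrier (mgrp M p)"
  by (simp add: ambient_mdl_def)

lemma ambient_inj: "inj_on (j p) (carrier (mgrp M p))"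
  using emb_eq[OF mgrp] by (auto simp: inj_on_def)

end

lemma (in dg_algebra) AA_simps:
  "ac (AA A) p = emb p (rgrp A p) ` carrier (rgrp A p)" "au (AA A) = emb 0 (rgrp A 0) (rone A)"
  "a \<in> carrier (rgrp A p) \<Longrightarrow> b \<in> carrier (rgrp A q) \<Longrightarrow>
    am (AA A) (emb p (rgrp A p) a) (emb q (rgrp A q) b) = emb (p + q) (rgrp A (p + q)) (rmul A p q a b)"
  "a \<in> carrier (rgrp A p) \<Longrightarrow> ad (AA A) (emb p (rgrp A p) a) = emb (p + 1) (rgrp A (p + 1)) (rdiff A p a)"
  using dg_module.ambient_mc[OF regular_dg_module] dg_module.ambient_ma[OF regular_dg_module, of a p b q]
    dg_module.ambient_md[OF regular_dg_module, of a p]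
  by (simp_all add: AA_def)

lemma (in dg_algebra) rmul_closed:
  "a \<in> carrier (rgrp A p) \<Longrightarrow> b \<in> carrier (rgrp A q) \<Longrightarrow> rmul A p q a b \<in> carrier (rgrp A (p + q))"
  using rmul_right hom_in_carrier by metis

lemma (in dg_algebra) rdiff_closed: "a \<in> carrier (rgrp A p) \<Longrightarrow> rdiff A p a \<in> carrier (rgrp A (p + 1))"
  using rdiff hom_in_carrier by metis

lemma mdl_ambient:
  assumes "dg_algebra K A" "dg_module A M"
  shows "mdl (AA A) (ambient_mdl A M)"
proof -
  interpret dg_algebra K A by fact
  interpret dg_module A M by fact
  note cl = mact_closed mdiff_closed rmul_closed rdiff_closed comm_group_simps(1-3)[OF mgrp] comm_group_simps(1-3)[OF rgrp]
  note emb = emb_add[OF mgrp, symmetric] emb_add[OF rgrp, symmetric] emb_one[OF mgrp, symmetric]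
  note ambient_mdl = ambient_ma ambient_md AA_simps(3,4)
  have emb_minus: "j p x - j p y = j p (x \<otimes>\<^bsub>mgrp M p\<^esub> inv\<^bsub>mgrp M p\<^esub> y)"
    if "x \<in> carrier (mgrp M p)" "y \<in> carrier (mgrp M p)" for x y p
    using that by (simp add: emb_add[OF mgrp] emb_inv[OF mgrp] cl)
  show ?thesis
  proof
    fix p q r \<xi> \<eta> \<alpha> \<beta>
    show "0 \<in> mc (ambient_mdl A M) p"
      unfolding ambient_mc using emb_one[OF mgrp, of p p] cl(5) by (metis imageI)
    assume "\<xi> \<in> mc (ambient_mdl A M) p"
    then obtain x where x: "x \<in> carrier (mgrp M p)" and \<xi>: "\<xi> = j p x" by (auto simp: ambient_mc)
    show "md (ambient_mdl A M) \<xi> \<in> mc (ambient_mdl A M) (p + 1)"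
      using x by (simp add: \<xi> ambient_mdl cl ambient_mc)
    show "md (ambient_mdl A M) (md (ambient_mdl A M) \<xi>) = 0"
      using x mdiff_mdiff[OF x] emb_one[OF mgrp, of "p + 2" "p + 2"] by (simp add: \<xi> ambient_mdl cl add.assoc)
    show "ma (ambient_mdl A M) \<xi> (au (AA A)) = \<xi>"
      using x ambient_ma[OF x rone] mact_one[OF x] by (simp add: \<xi> AA_simps(2))
    {
      assume "\<eta> \<in> mc (ambient_mdl A M) p"
      then obtain y where y: "y \<in> carrier (mgrp M p)" and \<eta>: "\<eta> = j p y" by (auto simp: ambient_mc)
      show "\<xi> - \<eta> \<in> mc (ambient_mdl A M) p"
        using x y by (auto simp: \<xi> \<eta> emb_minus ambient_mc cl)
      show "md (ambient_mdl A M) (\<xi> + \<eta>) = md (ambient_mdl A M) \<xi> + md (ambient_mdl A M) \<eta>"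
        using x y hom_mult[OF mdiff x y] by (simp add: \<xi> \<eta> emb ambient_mdl cl)
      assume "\<alpha> \<in> ac (AA A) q"
      then obtain a where a: "a \<in> carrier (rgrp A q)" and \<alpha>: "\<alpha> = \<iota> q a" by (auto simp: AA_simps(1))
      show "ma (ambient_mdl A M) (\<xi> + \<eta>) \<alpha> = ma (ambient_mdl A M) \<xi> \<alpha> + ma (ambient_mdl A M) \<eta> \<alpha>"
        using x y a hom_mult[OF mact_left[OF a] x y] by (simp add: \<xi> \<eta> \<alpha> emb ambient_mdl cl)
    }
    assume "\<alpha> \<in> ac (AA A) q"
    then obtain a where a: "a \<in> carrier (rgrp A q)" and \<alpha>: "\<alpha> = \<iota> q a" by (auto simp: AA_simps(1))
    show "ma (ambient_mdl A M) \<xi> \<alpha> \<in> mc (ambient_mdl A M) (p + q)"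
      using x a by (simp add: \<xi> \<alpha> ambient_mdl cl ambient_mc)
    have "md (ambient_mdl A M) (ma (ambient_mdl A M) \<xi> \<alpha>) = j (p + q + 1) (mact M (p + 1) q (mdiff M p x) a \<otimes>\<^bsub>mgrp M (p + q + 1)\<^esub>
            signed p (mgrp M (p + q + 1)) (mact M p (q + 1) x (rdiff A q a)))"
      using x a mdiff_mact[OF x a] by (simp add: \<xi> \<alpha> ambient_mdl cl)
    also have "\<dots> = j (p + q + 1) (mact M (p + 1) q (mdiff M p x) a) + sg p (j (p + q + 1) (mact M p (q + 1) x (rdiff A q a)))"
    proof -
      have 1: "mact M (p + 1) q (mdiff M p x) a \<in> carrier (mgrp M (p + q + 1))"
        using mact_closed[OF mdiff_closed[OF x] a] by (simp add: ac_simps)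
      have 2: "mact M p (q + 1) x (rdiff A q a) \<in> carrier (mgrp M (p + q + 1))"
        using mact_closed[OF x rdiff_closed[OF a]] by (simp add: ac_simps)
      have 3: "signed p (mgrp M (p + q + 1)) (mact M p (q + 1) x (rdiff A q a)) \<in> carrier (mgrp M (p + q + 1))"
        using 2 cl by (simp add: signed_def)
      show ?thesis using emb_add[OF mgrp 1 3] emb_signed[OF mgrp 2] by simp
    qed
    also have "\<dots> = ma (ambient_mdl A M) (md (ambient_mdl A M) \<xi>) \<alpha> + sg p (ma (ambient_mdl A M) \<xi> (ad (AA A) \<alpha>))"
      using x a ambient_ma[OF mdiff_closed[OF x] a] ambient_ma[OF x rdiff_closed[OF a]]
      by (simp add: \<xi> \<alpha> ambient_mdl ac_simps)
    finally show "md (ambient_mdl A M) (ma (ambient_mdl A M) \<xi> \<alpha>) = ma (ambient_mdl A M) (md (ambient_mdl A M) \<xi>) \<alpha> + sg p (ma (ambient_mdl A M) \<xi> (ad (AA A) \<alpha>))" .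
    {
      assume "\<beta> \<in> ac (AA A) q"
      then obtain b where b: "b \<in> carrier (rgrp A q)" and \<beta>: "\<beta> = \<iota> q b" by (auto simp: AA_simps(1))
      show "ma (ambient_mdl A M) \<xi> (\<alpha> + \<beta>) = ma (ambient_mdl A M) \<xi> \<alpha> + ma (ambient_mdl A M) \<xi> \<beta>"
        using x b a hom_mult[OF mact_right[OF x] a b] by (simp add: \<xi> \<alpha> \<beta> emb ambient_mdl cl)
    }
    assume "\<beta> \<in> ac (AA A) r"
    then obtain b where b: "b \<in> carrier (rgrp A r)" and \<beta>: "\<beta> = \<iota> r b" by (auto simp: AA_simps(1))
    show "ma (ambient_mdl A M) (ma (ambient_mdl A M) \<xi> \<alpha>) \<beta> = ma (ambient_mdl A M) \<xi> (am (AA A) \<alpha> \<beta>)"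
      using x b a mact_assoc[OF x a b] by (simp add: \<xi> \<alpha> \<beta> ambient_mdl cl add.assoc)
  qed
qed

lemma self_ambient: "self (AA A) = ambient_mdl A (regular A)"
  by (simp add: self_def AA_def)

lemma dga_ambient: assumes "dg_algebra K A" shows "dga (AA A)"
proof -
  interpret dg_algebra K A by fact
  show ?thesis
  proof (rule dga.intro)
    show "mdl (AA A) (self (AA A))"
      unfolding self_ambient by (rule mdl_ambient[OF assms regular_dg_module])
    show "au (AA A) \<in> ac (AA A) 0" using rone by (simp add: AA_simps)
    fix a p assume "a \<in> ac (AA A) p"
    then show "am (AA A) (au (AA A)) a = a"
      using AA_simps(3)[OF rone] rone_left by (auto simp: AA_simps(1,2))
  qed
qed

section \<open>Cohomology classes and representations\<close>

text \<open>A dictionary between a dg module \<open>X\<close> and an additive model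
  \<open>M\<close>. Given modules acquire one through \<open>dg_rep_ambient\<close>, the constructed
  one through \<open>dg_rep_transport\<close>; cohomology groups are translated once for
  both.\<close>

locale dg_rep = dg_algebra K A + X: dg_module A X + M: mdl "AA A" M
  for K :: "'k ring" and A :: "('k, 'a) dg_algebra" and X :: "('a, 'x) dg_module"
    and M :: "('a ambient, 'm::ab_group_add) mdl" +
  fixes \<phi> :: "int \<Rightarrow> 'x \<Rightarrow> 'm"
  assumes bij: "bij_betw (\<phi> p) (carrier (mgrp X p)) (mc M p)"
    and \<phi>_add: "x \<in> carrier (mgrp X p) \<Longrightarrow> y \<in> carrier (mgrp X p) \<Longrightarrow> \<phi> p (x \<otimes>\<^bsub>mgrp X p\<^esub> y) = \<phi> p x + \<phi> p y"
    and \<phi>_act: "x \<in> carrier (mgrp X p) \<Longrightarrow> a \<in> carrier (rgrp A q) \<Longrightarrow>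
      \<phi> (p + q) (mact X p q x a) = ma M (\<phi> p x) (emb q (rgrp A q) a)"
    and \<phi>_d: "x \<in> carrier (mgrp X p) \<Longrightarrow> \<phi> (p + 1) (mdiff X p x) = md M (\<phi> p x)"

lemma dg_rep_ambient:
  assumes "dg_algebra K A" "dg_module A X"
  shows "dg_rep K A X (ambient_mdl A X) (\<lambda>p. emb p (mgrp X p))"
proof -
  interpret dg_algebra K A by fact
  interpret X: dg_module A X by fact
  show ?thesis
    by (intro dg_rep.intro dg_rep_axioms.intro mdl_ambient[OF assms] assms)
      (auto simp: bij_betw_def X.ambient_inj X.ambient_mc X.ambient_ma X.ambient_md emb_add[OF X.mgrp])
qed

lemma (in dg_algebra) dg_rep_self: "dg_rep K A (regular A) (self (AA A)) (\<lambda>p. emb p (rgrp A p))"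
  using dg_rep_ambient[OF dg_algebra_axioms regular_dg_module] by (simp add: self_ambient)

context dg_rep
begin

interpretation dga "AA A" by (rule dga_ambient[OF dg_algebra_axioms])

lemma X_closed: "\<one>\<^bsub>mgrp X p\<^esub> \<in> carrier (mgrp X p)"
    "x \<in> carrier (mgrp X p) \<Longrightarrow> y \<in> carrier (mgrp X p) \<Longrightarrow> x \<otimes>\<^bsub>mgrp X p\<^esub> y \<in> carrier (mgrp X p)"
    "x \<in> carrier (mgrp X p) \<Longrightarrow> inv\<^bsub>mgrp X p\<^esub> x \<in> carrier (mgrp X p)"
  by (rule comm_group_simps[OF X.mgrp]; assumption)+

lemma \<phi>_in: "x \<in> carrier (mgrp X p) \<Longrightarrow> \<phi> p x \<in> mc M p"
  using bij bij_betwE by blast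

lemma \<phi>_surj: assumes "m \<in> mc M p" obtains x where "x \<in> carrier (mgrp X p)" "m = \<phi> p x"
  using bij[of p] assms by (auto simp: bij_betw_def)

lemma \<phi>_eq: "x \<in> carrier (mgrp X p) \<Longrightarrow> y \<in> carrier (mgrp X p) \<Longrightarrow> \<phi> p x = \<phi> p y \<longleftrightarrow> x = y"
  using bij[of p] by (auto simp: bij_betw_def inj_on_def)

lemma \<phi>_one: "\<phi> p \<one>\<^bsub>mgrp X p\<^esub> = 0"
  using \<phi>_add[OF X_closed(1) X_closed(1), of p] comm_group_simps(4)[OF X.mgrp X_closed(1), of p] by simp

lemma \<phi>_inv: "x \<in> carrier (mgrp X p) \<Longrightarrow> \<phi> p (inv\<^bsub>mgrp X p\<^esub> x) = - \<phi> p x"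
  using \<phi>_add[of x p "inv\<^bsub>mgrp X p\<^esub> x"] \<phi>_one[of p] X_closed(3)[of x p] comm_group_simps(7)[OF X.mgrp, of x p]
  by (simp add: minus_unique)

lemma cancel:
  assumes "x \<in> carrier (mgrp X p)" "y \<in> carrier (mgrp X p)"
  shows "y \<otimes>\<^bsub>mgrp X p\<^esub> inv\<^bsub>mgrp X p\<^esub> x \<otimes>\<^bsub>mgrp X p\<^esub> x = y"
proof -
  have i: "inv\<^bsub>mgrp X p\<^esub> x \<in> carrier (mgrp X p)" by (rule X_closed(3)[OF assms(1)])
  have yi: "y \<otimes>\<^bsub>mgrp X p\<^esub> inv\<^bsub>mgrp X p\<^esub> x \<in> carrier (mgrp X p)" by (rule X_closed(2)[OF assms(2) i])
  show ?thesis
    using \<phi>_eq[OF X_closed(2)[OF yi assms(1)] assms(2)] \<phi>_add[OF yi assms(1)] \<phi>_add[OF assms(2) i] \<phi>_inv[OF assms(1)]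
    by simp
qed

abbreviation "coc \<equiv> cocycles (mgrp X) (mdiff X)"
abbreviation "cob \<equiv> coboundaries (mgrp X) (mdiff X)"
abbreviation "cl \<equiv> cohomology_class (mgrp X) (mdiff X)"
abbreviation "H \<equiv> cohomology_group (mgrp X) (mdiff X)"

lemma coc_iff: "x \<in> coc p \<longleftrightarrow> x \<in> carrier (mgrp X p) \<and> \<phi> p x \<in> cyc M p"
proof -
  have "mdiff X p x = \<one>\<^bsub>mgrp X (p + 1)\<^esub> \<longleftrightarrow> md M (\<phi> p x) = 0" if x: "x \<in> carrier (mgrp X p)"
    using \<phi>_eq[OF X.mdiff_closed[OF x] X_closed(1)] \<phi>_d[OF x] \<phi>_one[of "p + 1"] by simp
  then show ?thesis by (auto simp: cocycles_def kernel_def cyc_def \<phi>_in)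
qed

lemma coc_carrier: "x \<in> coc p \<Longrightarrow> x \<in> carrier (mgrp X p)"
  by (simp add: coc_iff)

lemma cob_iff: "x \<in> cob p \<longleftrightarrow> x \<in> carrier (mgrp X p) \<and> \<phi> p x \<in> bdy M p"
proof
  assume "x \<in> cob p"
  then obtain y where y: "y \<in> carrier (mgrp X (p - 1))" "x = mdiff X (p - 1) y" by (auto simp: coboundaries_def)
  then show "x \<in> carrier (mgrp X p) \<and> \<phi> p x \<in> bdy M p"
    using X.mdiff_closed[OF y(1)] \<phi>_d[OF y(1)] bdyI[OF \<phi>_in[OF y(1)]] by simp
next
  assume x: "x \<in> carrier (mgrp X p) \<and> \<phi> p x \<in> bdy M p"
  then obtain y where y: "y \<in> carrier (mgrp X (p - 1))" "\<phi> p x = md M (\<phi> (p - 1) y)"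
    by (metis bdyE \<phi>_surj)
  then have "x = mdiff X (p - 1) y"
    using x \<phi>_d[OF y(1)] X.mdiff_closed[OF y(1)] \<phi>_eq[of x p "mdiff X (p - 1) y"] by simp
  then show "x \<in> cob p" using y by (auto simp: coboundaries_def)
qed

lemma cl_iff:
  assumes x: "x \<in> carrier (mgrp X p)"
  shows "y \<in> cl p x \<longleftrightarrow> y \<in> carrier (mgrp X p) \<and> \<phi> p y - \<phi> p x \<in> bdy M p"
proof
  assume "y \<in> cl p x"
  then obtain b where "b \<in> cob p" "y = b \<otimes>\<^bsub>mgrp X p\<^esub> x"
    by (auto simp: cohomology_class_def r_coset_def)
  then show "y \<in> carrier (mgrp X p) \<and> \<phi> p y - \<phi> p x \<in> bdy M p"
    using x by (auto simp: cob_iff \<phi>_add X_closed)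
next
  assume y: "y \<in> carrier (mgrp X p) \<and> \<phi> p y - \<phi> p x \<in> bdy M p"
  let ?b = "y \<otimes>\<^bsub>mgrp X p\<^esub> inv\<^bsub>mgrp X p\<^esub> x"
  have "?b \<in> cob p" using x y by (simp add: cob_iff X_closed \<phi>_add \<phi>_inv)
  moreover have "y = ?b \<otimes>\<^bsub>mgrp X p\<^esub> x"
    using x y by (simp add: cancel)
  ultimately show "y \<in> cl p x" by (auto simp: cohomology_class_def r_coset_def)
qed

lemma cl_self: "x \<in> carrier (mgrp X p) \<Longrightarrow> x \<in> cl p x"
  by (simp add: cl_iff M.bdy_zero)

lemma cl_eq:
  assumes x: "x \<in> carrier (mgrp X p)" and y: "y \<in> carrier (mgrp X p)"
  shows "cl p x = cl p y \<longleftrightarrow> \<phi> p x - \<phi> p y \<in> bdy M p"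
proof
  assume "cl p x = cl p y"
  then show "\<phi> p x - \<phi> p y \<in> bdy M p" using cl_self[OF x] cl_iff[OF y] by blast
next
  assume *: "\<phi> p x - \<phi> p y \<in> bdy M p"
  have "\<phi> p z - \<phi> p x \<in> bdy M p \<longleftrightarrow> \<phi> p z - \<phi> p y \<in> bdy M p" for z
    using M.bdy_add[OF _ *, of "\<phi> p z - \<phi> p x"] M.bdy_diff[OF _ *, of "\<phi> p z - \<phi> p y"] by auto
  then show "cl p x = cl p y" using cl_iff[OF x] cl_iff[OF y] by blast
qed

lemma coc_of_cl: "x \<in> coc p \<Longrightarrow> y \<in> cl p x \<Longrightarrow> y \<in> coc p"
  using cl_iff[OF coc_carrier] M.cyc_add[OF M.bdy_cyc, of "\<phi> p y - \<phi> p x" p "\<phi> p x"] by (auto simp: coc_iff)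

lemma H_carrier: "carrier (H p) = cl p ` coc p"
  by (auto simp: cohomology_group_def FactGroup_def RCOSETS_def cohomology_class_def r_coset_def)

lemma H_one: "\<one>\<^bsub>H p\<^esub> = cl p \<one>\<^bsub>mgrp X p\<^esub>"
proof -
  have "cob p = cl p \<one>\<^bsub>mgrp X p\<^esub>" by (auto simp: cl_iff X_closed cob_iff \<phi>_one)
  then show ?thesis by (simp add: cohomology_group_def FactGroup_def)
qed

lemma coc_mult: "x \<in> coc p \<Longrightarrow> y \<in> coc p \<Longrightarrow> x \<otimes>\<^bsub>mgrp X p\<^esub> y \<in> coc p"
  and coc_inv: "x \<in> coc p \<Longrightarrow> inv\<^bsub>mgrp X p\<^esub> x \<in> coc p"
  and coc_one: "\<one>\<^bsub>mgrp X p\<^esub> \<in> coc p"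
  by (auto simp: coc_iff X_closed \<phi>_add \<phi>_inv \<phi>_one M.cyc_add M.cyc_neg M.cyc_zero)

lemma H_mult:
  assumes "x \<in> coc p" "y \<in> coc p" shows "cl p x \<otimes>\<^bsub>H p\<^esub> cl p y = cl p (x \<otimes>\<^bsub>mgrp X p\<^esub> y)"
proof -
  have x: "x \<in> carrier (mgrp X p)" and y: "y \<in> carrier (mgrp X p)" using assms coc_carrier by auto
  have "w \<in> cl p (x \<otimes>\<^bsub>mgrp X p\<^esub> y) \<longleftrightarrow> (\<exists>u\<in>cl p x. \<exists>v\<in>cl p y. w = u \<otimes>\<^bsub>mgrp X p\<^esub> v)" for w
  proof
    assume w: "w \<in> cl p (x \<otimes>\<^bsub>mgrp X p\<^esub> y)"
    then have w': "w \<in> carrier (mgrp X p)" "\<phi> p w - (\<phi> p x + \<phi> p y) \<in> bdy M p"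
      using x y by (simp_all add: cl_iff X_closed \<phi>_add)
    have "w \<otimes>\<^bsub>mgrp X p\<^esub> inv\<^bsub>mgrp X p\<^esub> y \<in> cl p x"
      using w' x y by (simp add: cl_iff X_closed \<phi>_add \<phi>_inv algebra_simps)
    moreover have "w = w \<otimes>\<^bsub>mgrp X p\<^esub> inv\<^bsub>mgrp X p\<^esub> y \<otimes>\<^bsub>mgrp X p\<^esub> y"
      using w'(1) y by (simp add: cancel)
    ultimately show "\<exists>u\<in>cl p x. \<exists>v\<in>cl p y. w = u \<otimes>\<^bsub>mgrp X p\<^esub> v" using cl_self[OF y] by blast
  next
    assume "\<exists>u\<in>cl p x. \<exists>v\<in>cl p y. w = u \<otimes>\<^bsub>mgrp X p\<^esub> v"
    then obtain u v where uv: "u \<in> carrier (mgrp X p)" "\<phi> p u - \<phi> p x \<in> bdy M p"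
      "v \<in> carrier (mgrp X p)" "\<phi> p v - \<phi> p y \<in> bdy M p" "w = u \<otimes>\<^bsub>mgrp X p\<^esub> v"
      using x y by (auto simp: cl_iff)
    have "\<phi> p w - (\<phi> p x + \<phi> p y) = (\<phi> p u - \<phi> p x) + (\<phi> p v - \<phi> p y)" using uv by (simp add: \<phi>_add)
    then have "\<phi> p w - (\<phi> p x + \<phi> p y) \<in> bdy M p" using M.bdy_add[OF uv(2,4)] by (simp only:)
    then show "w \<in> cl p (x \<otimes>\<^bsub>mgrp X p\<^esub> y)"
      using cl_iff[OF X_closed(2)[OF x y]] \<phi>_add[OF x y] X_closed(2)[OF uv(1,3)] uv(5) by simp
  qed
  then show ?thesis by (auto simp: cohomology_group_def FactGroup_def set_mult_def)
qed

lemma H_comm_group: "comm_group (H p)"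
proof (rule comm_groupI)
  show "\<one>\<^bsub>H p\<^esub> \<in> carrier (H p)" using coc_one by (auto simp: H_one H_carrier)
  fix u assume "u \<in> carrier (H p)"
  then obtain x where x: "x \<in> coc p" "u = cl p x" by (auto simp: H_carrier)
  have x': "x \<in> carrier (mgrp X p)" using x coc_carrier by blast
  show "\<one>\<^bsub>H p\<^esub> \<otimes>\<^bsub>H p\<^esub> u = u"
    using x by (simp add: H_one H_mult coc_one comm_group_simps(4)[OF X.mgrp x'])
  have "cl p (inv\<^bsub>mgrp X p\<^esub> x) \<otimes>\<^bsub>H p\<^esub> u = \<one>\<^bsub>H p\<^esub>"
    using x by (simp add: H_one H_mult coc_inv comm_group_simps(6)[OF X.mgrp x'])
  then show "\<exists>v\<in>carrier (H p). v \<otimes>\<^bsub>H p\<^esub> u = \<one>\<^bsub>H p\<^esub>" using coc_inv[OF x(1)] by (auto simp: H_carrier)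
  fix v assume "v \<in> carrier (H p)"
  then obtain y where y: "y \<in> coc p" "v = cl p y" by (auto simp: H_carrier)
  have y': "y \<in> carrier (mgrp X p)" using y coc_carrier by blast
  show "u \<otimes>\<^bsub>H p\<^esub> v \<in> carrier (H p)" using x y by (auto simp: H_mult H_carrier coc_mult)
  show "u \<otimes>\<^bsub>H p\<^esub> v = v \<otimes>\<^bsub>H p\<^esub> u"
    using x y by (simp add: H_mult comm_group_simps(9)[OF X.mgrp x' y'])
  fix w assume "w \<in> carrier (H p)"
  then obtain z where z: "z \<in> coc p" "w = cl p z" by (auto simp: H_carrier)
  have z': "z \<in> carrier (mgrp X p)" using z coc_carrier by blast
  show "u \<otimes>\<^bsub>H p\<^esub> v \<otimes>\<^bsub>H p\<^esub> w = u \<otimes>\<^bsub>H p\<^esub> (v \<otimes>\<^bsub>H p\<^esub> w)"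
    using x y z by (simp add: H_mult coc_mult comm_group_simps(8)[OF X.mgrp x' y' z'])
qed

lemma H_triv: "carrier (H p) = {\<one>\<^bsub>H p\<^esub>} \<longleftrightarrow> cyc M p \<subseteq> bdy M p"
proof
  assume *: "carrier (H p) = {\<one>\<^bsub>H p\<^esub>}"
  show "cyc M p \<subseteq> bdy M p"
  proof
    fix m assume m: "m \<in> cyc M p"
    then obtain x where x: "x \<in> carrier (mgrp X p)" "m = \<phi> p x" using cyc_mc \<phi>_surj by metis
    then have "cl p x \<in> carrier (H p)" using m by (simp add: H_carrier coc_iff)
    then have "cl p x = cl p \<one>\<^bsub>mgrp X p\<^esub>" using * H_one by auto
    then show "m \<in> bdy M p" using cl_eq[OF x(1) X_closed(1)] x by (simp add: \<phi>_one)
  qed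
next
  assume *: "cyc M p \<subseteq> bdy M p"
  have "cl p x = \<one>\<^bsub>H p\<^esub>" if "x \<in> coc p" for x
    using that * cl_eq[OF coc_carrier[OF that] X_closed(1)] by (auto simp: H_one coc_iff \<phi>_one)
  then show "carrier (H p) = {\<one>\<^bsub>H p\<^esub>}" using coc_one by (auto simp: H_carrier)
qed

end

context dg_algebra
begin

sublocale S: dg_rep K A "regular A" "self (AA A)" "\<lambda>p. emb p (rgrp A p)"
  by (rule dg_rep_self)

sublocale AA: dga "AA A" by (rule dga_ambient[OF dg_algebra_axioms])

abbreviation "\<epsilon> p \<equiv> emb p (rgrp A p)"
abbreviation "acoc \<equiv> cocycles (rgrp A) (rdiff A)"
abbreviation "acl \<equiv> cohomology_class (rgrp A) (rdiff A)"

lemmas acoc_iff = S.coc_iff[simplified]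
lemmas acl_eq = S.cl_eq[simplified]
lemmas acl_iff = S.cl_iff[simplified]

end

context dg_rep
begin

text \<open>For other representatives y and b, the difference y b - x a = y (b - a) + (y - x) a is a
  sum of boundaries because y and a are cocycles; so all classes in the union that defines the
  action coincide.\<close>

lemma H_act:
  assumes x: "x \<in> coc p" and a: "a \<in> acoc q"
  shows "mact X p q x a \<in> coc (p + q)"
    "mact (cohomology_module X) p q (cl p x) (acl q a) = cl (p + q) (mact X p q x a)"
proof -
  have x': "x \<in> carrier (mgrp X p)" and xc: "\<phi> p x \<in> cyc M p" using x by (auto simp: coc_iff)
  have a': "a \<in> carrier (rgrp A q)" and ac: "\<epsilon> q a \<in> cyc (self (AA A)) q" using a by (auto simp: acoc_iff)
  show 1: "mact X p q x a \<in> coc (p + q)"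
    using M.cyc_act[OF AA.dga_axioms xc ac] X.mact_closed[OF x' a'] by (simp add: coc_iff \<phi>_act[OF x' a'])
  have "cl (p + q) (mact X p q y b) = cl (p + q) (mact X p q x a)" if y: "y \<in> cl p x" and b: "b \<in> acl q a" for y b
  proof -
    have y': "y \<in> carrier (mgrp X p)" "\<phi> p y - \<phi> p x \<in> bdy M p" "\<phi> p y \<in> cyc M p"
      using y cl_iff[OF x'] coc_of_cl[OF x y] by (auto simp: coc_iff)
    have b': "b \<in> carrier (rgrp A q)" "\<epsilon> q b - \<epsilon> q a \<in> bdy (self (AA A)) q" "\<epsilon> q b \<in> cyc (self (AA A)) q"
      using b acl_iff[OF a'] S.coc_of_cl[of a q b] a by (auto simp: acoc_iff)
    have in': "\<epsilon> q a \<in> ac (AA A) q" "\<epsilon> q b \<in> ac (AA A) q" using ac b'(3) by (auto simp: cyc_def)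
    have "ma M (\<phi> p y) (\<epsilon> q b) - ma M (\<phi> p x) (\<epsilon> q a) =
      ma M (\<phi> p y) (\<epsilon> q b - \<epsilon> q a) + ma M (\<phi> p y - \<phi> p x) (\<epsilon> q a)"
      using M.act_diffr[OF AA.dga_axioms \<phi>_in[OF y'(1)] in'(2,1)] M.act_diffl[OF \<phi>_in[OF y'(1)] \<phi>_in[OF x'] in'(1)] by simp
    also have "\<dots> \<in> bdy M (p + q)"
      by (intro M.bdy_add M.act_bdy M.bdy_act AA.dga_axioms y'(3) b'(2) y'(2) ac)
    finally show ?thesis
      using cl_eq[OF X.mact_closed[OF y'(1) b'(1)] X.mact_closed[OF x' a']] by (simp add: \<phi>_act x' a' y'(1) b'(1))
  qed
  note const = this
  have self: "x \<in> cl p x" "a \<in> acl q a" using cl_self[OF x'] S.cl_self[of a q] a' by auto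
  have "(\<Union>y\<in>cl p x. \<Union>b\<in>acl q a. cl (p + q) (mact X p q y b)) = cl (p + q) (mact X p q x a)"
  proof (intro equalityI subsetI)
    fix z assume "z \<in> (\<Union>y\<in>cl p x. \<Union>b\<in>acl q a. cl (p + q) (mact X p q y b))"
    then obtain y b where "y \<in> cl p x" "b \<in> acl q a" "z \<in> cl (p + q) (mact X p q y b)" by blast
    then show "z \<in> cl (p + q) (mact X p q x a)" using const by metis
  next
    fix z assume "z \<in> cl (p + q) (mact X p q x a)"
    then show "z \<in> (\<Union>y\<in>cl p x. \<Union>b\<in>acl q a. cl (p + q) (mact X p q y b))" using self by blast
  qed
  then show "mact (cohomology_module X) p q (cl p x) (acl q a) = cl (p + q) (mact X p q x a)"
    by (simp only: cohomology_module_def graded_module.simps)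
qed

end

text \<open>The tower is built in a type of its own, while the result must have elements in
  \<open>'u\<close>; \<open>c\<close> renames the homogeneous elements. One injection serves all
  degrees.\<close>

definition transport_mdl :: "('k, 'a) dg_algebra \<Rightarrow> ('a ambient, 'm::ab_group_add) mdl \<Rightarrow> ('m \<Rightarrow> 'u) \<Rightarrow> ('a, 'u) dg_module"
  where "transport_mdl A M c = (let c' = inv_into (\<Union>p. mc M p) c in
    \<lparr>mgrp = (\<lambda>p. \<lparr>carrier = c ` mc M p, monoid.mult = (\<lambda>u v. c (c' u + c' v)), one = c 0\<rparr>),
     mact = (\<lambda>p q u a. c (ma M (c' u) (emb q (rgrp A q) a))),
     mdiff = (\<lambda>p u. c (md M (c' u)))\<rparr>)"

lemma dg_rep_transport:
  assumes A: "dg_algebra K A" and M: "mdl (AA A) M" and c: "inj_on c (\<Union>p. mc M p)"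
  shows "dg_rep K A (transport_mdl A M c) M (\<lambda>p. inv_into (\<Union>p. mc M p) c)"
proof -
  interpret dg_algebra K A by fact
  interpret M: mdl "AA A" M by fact
  define c' where "c' = inv_into (\<Union>p. mc M p) c"
  have c'c: "c' (c x) = x" if "x \<in> mc M p" for x p
    unfolding c'_def by (rule inv_into_f_f[OF c]) (use that in blast)
  have grp: "mgrp (transport_mdl A M c) p = \<lparr>carrier = c ` mc M p, monoid.mult = (\<lambda>u v. c (c' u + c' v)), one = c 0\<rparr>" for p
    by (simp add: transport_mdl_def Let_def c'_def)
  have act: "mact (transport_mdl A M c) p q u a = c (ma M (c' u) (\<epsilon> q a))" for p q u a by (simp add: transport_mdl_def Let_def c'_def)
  have d: "mdiff (transport_mdl A M c) p u = c (md M (c' u))" for p u by (simp add: transport_mdl_def Let_def c'_def)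
  have cm: "comm_group (mgrp (transport_mdl A M c) p)" for p
  proof (rule comm_groupI)
    fix u v w assume "u \<in> carrier (mgrp (transport_mdl A M c) p)"
    then obtain x where x: "x \<in> mc M p" "u = c x" by (auto simp: grp)
    show "\<one>\<^bsub>mgrp (transport_mdl A M c) p\<^esub> \<otimes>\<^bsub>mgrp (transport_mdl A M c) p\<^esub> u = u" using x by (simp add: grp c'c[OF x(1)] c'c[OF M.zero])
    show "\<exists>v\<in>carrier (mgrp (transport_mdl A M c) p). v \<otimes>\<^bsub>mgrp (transport_mdl A M c) p\<^esub> u = \<one>\<^bsub>mgrp (transport_mdl A M c) p\<^esub>"
      using x M.neg[OF x(1)] by (intro bexI[of _ "c (- x)"]) (simp_all add: grp c'c[where p = p])
    assume "v \<in> carrier (mgrp (transport_mdl A M c) p)"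
    then obtain y where y: "y \<in> mc M p" "v = c y" by (auto simp: grp)
    show "u \<otimes>\<^bsub>mgrp (transport_mdl A M c) p\<^esub> v \<in> carrier (mgrp (transport_mdl A M c) p)"
      using x y M.add by (simp add: grp c'c[where p = p])
    show "u \<otimes>\<^bsub>mgrp (transport_mdl A M c) p\<^esub> v = v \<otimes>\<^bsub>mgrp (transport_mdl A M c) p\<^esub> u" by (simp add: grp add.commute)
    assume "w \<in> carrier (mgrp (transport_mdl A M c) p)"
    then obtain z where z: "z \<in> mc M p" "w = c z" by (auto simp: grp)
    show "u \<otimes>\<^bsub>mgrp (transport_mdl A M c) p\<^esub> v \<otimes>\<^bsub>mgrp (transport_mdl A M c) p\<^esub> w = u \<otimes>\<^bsub>mgrp (transport_mdl A M c) p\<^esub> (v \<otimes>\<^bsub>mgrp (transport_mdl A M c) p\<^esub> w)"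
      using x y z M.add by (simp add: grp c'c[where p = p] add.assoc)
  qed (auto simp: grp M.zero)
  have inv: "inv\<^bsub>mgrp (transport_mdl A M c) p\<^esub> (c x) = c (- x)" if x: "x \<in> mc M p" for x p
  proof -
    interpret G: comm_group "mgrp (transport_mdl A M c) p" by (rule cm)
    show ?thesis using x M.neg[OF x] by (intro G.inv_equality) (simp_all add: grp c'c[where p = p])
  qed
  have signed: "signed k (mgrp (transport_mdl A M c) p) (c x) = c (sg k x)" if x: "x \<in> mc M p" for x p k
    using inv[OF x] by (simp add: signed_def sg_def)
  have ein: "\<epsilon> q a \<in> ac (AA A) q" if "a \<in> carrier (rgrp A q)" for a q using that by (simp add: AA_simps)
  have plus: "c x \<otimes>\<^bsub>mgrp (transport_mdl A M c) p\<^esub> c y = c (x + y)" if "x \<in> mc M p" "y \<in> mc M p" for x y p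
    using that by (simp add: grp c'c[where p = p])
  have "dg_module A (transport_mdl A M c)"
  proof (intro dg_module.intro graded_module.intro graded_module_axioms.intro dg_module_axioms.intro graded_ring_axioms cm)
    fix p q r u a b
    {
      fix a assume a: "a \<in> carrier (rgrp A q)"
      show "(\<lambda>u. mact (transport_mdl A M c) p q u a) \<in> hom (mgrp (transport_mdl A M c) p) (mgrp (transport_mdl A M c) (p + q))"
      proof (rule homI)
        fix u assume "u \<in> carrier (mgrp (transport_mdl A M c) p)"
        then obtain x where x: "x \<in> mc M p" "u = c x" by (auto simp: grp)
        note xa = M.act[OF x(1) ein[OF a]]
        show "mact (transport_mdl A M c) p q u a \<in> carrier (mgrp (transport_mdl A M c) (p + q))" using xa by (simp add: act grp x c'c[OF x(1)])
        fix v assume "v \<in> carrier (mgrp (transport_mdl A M c) p)"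
        then obtain y where y: "y \<in> mc M p" "v = c y" by (auto simp: grp)
        show "mact (transport_mdl A M c) p q (u \<otimes>\<^bsub>mgrp (transport_mdl A M c) p\<^esub> v) a =
            mact (transport_mdl A M c) p q u a \<otimes>\<^bsub>mgrp (transport_mdl A M c) (p + q)\<^esub> mact (transport_mdl A M c) p q v a"
          using plus[OF xa M.act[OF y(1) ein[OF a]]] M.act_addl[OF x(1) y(1) ein[OF a]]
          by (simp add: act x y c'c[OF x(1)] c'c[OF y(1)] plus c'c[OF M.add[OF x(1) y(1)]])
      qed
    }
    show "mdiff (transport_mdl A M c) p \<in> hom (mgrp (transport_mdl A M c) p) (mgrp (transport_mdl A M c) (p + 1))"
    proof (rule homI)
      fix u assume "u \<in> carrier (mgrp (transport_mdl A M c) p)"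
      then obtain x where x: "x \<in> mc M p" "u = c x" by (auto simp: grp)
      show "mdiff (transport_mdl A M c) p u \<in> carrier (mgrp (transport_mdl A M c) (p + 1))" using M.d[OF x(1)] by (simp add: d grp x c'c[OF x(1)])
      fix v assume "v \<in> carrier (mgrp (transport_mdl A M c) p)"
      then obtain y where y: "y \<in> mc M p" "v = c y" by (auto simp: grp)
      show "mdiff (transport_mdl A M c) p (u \<otimes>\<^bsub>mgrp (transport_mdl A M c) p\<^esub> v) =
          mdiff (transport_mdl A M c) p u \<otimes>\<^bsub>mgrp (transport_mdl A M c) (p + 1)\<^esub> mdiff (transport_mdl A M c) p v"
        using plus[OF M.d[OF x(1)] M.d[OF y(1)]] M.d_add[OF x(1) y(1)]
        by (simp add: d x y c'c[OF x(1)] c'c[OF y(1)] plus c'c[OF M.add[OF x(1) y(1)]])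
    qed
    assume "u \<in> carrier (mgrp (transport_mdl A M c) p)"
    then obtain x where x: "x \<in> mc M p" "u = c x" by (auto simp: grp)
    note xx = c'c[OF x(1)]
    show "mact (transport_mdl A M c) p q u \<in> hom (rgrp A q) (mgrp (transport_mdl A M c) (p + q))"
    proof (rule homI)
      fix a assume a: "a \<in> carrier (rgrp A q)"
      note xa = M.act[OF x(1) ein[OF a]]
      show "mact (transport_mdl A M c) p q u a \<in> carrier (mgrp (transport_mdl A M c) (p + q))" using xa by (simp add: act grp x xx)
      fix b assume b: "b \<in> carrier (rgrp A q)"
      show "mact (transport_mdl A M c) p q u (a \<otimes>\<^bsub>rgrp A q\<^esub> b) =
            mact (transport_mdl A M c) p q u a \<otimes>\<^bsub>mgrp (transport_mdl A M c) (p + q)\<^esub> mact (transport_mdl A M c) p q u b"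
        using plus[OF xa M.act[OF x(1) ein[OF b]]] M.act_addr[OF x(1) ein[OF a] ein[OF b]]
        by (simp add: act x xx emb_add[OF rgrp a b])
    qed
    show "mact (transport_mdl A M c) p 0 u (rone A) = u"
      using M.act_unit[OF x(1)] by (simp add: act x xx AA_simps(2))
    show "mdiff (transport_mdl A M c) (p + 1) (mdiff (transport_mdl A M c) p u) = \<one>\<^bsub>mgrp (transport_mdl A M c) (p + 2)\<^esub>"
      using M.d_d[OF x(1)] c'c[OF M.d[OF x(1)]] by (simp add: d x xx grp)
    assume a: "a \<in> carrier (rgrp A q)"
    note xa = M.act[OF x(1) ein[OF a]]
    have da: "rdiff A q a \<in> carrier (rgrp A (q + 1))" by (rule rdiff_closed[OF a])
    have "mdiff (transport_mdl A M c) (p + q) (mact (transport_mdl A M c) p q u a) = c (ma M (md M x) (\<epsilon> q a) + sg p (ma M x (\<epsilon> (q + 1) (rdiff A q a))))"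
      using M.d_act[OF x(1) ein[OF a]] c'c[OF xa] AA_simps(4)[OF a] by (simp add: d act x xx)
    moreover have "ma M (md M x) (\<epsilon> q a) \<in> mc M (p + q + 1)" "ma M x (\<epsilon> (q + 1) (rdiff A q a)) \<in> mc M (p + q + 1)"
      using M.act[OF M.d[OF x(1)] ein[OF a]] M.act[OF x(1) ein[OF da]] by (simp_all add: ac_simps)
    ultimately show "mdiff (transport_mdl A M c) (p + q) (mact (transport_mdl A M c) p q u a) =
        mact (transport_mdl A M c) (p + 1) q (mdiff (transport_mdl A M c) p u) a \<otimes>\<^bsub>mgrp (transport_mdl A M c) (p + q + 1)\<^esub>
        signed p (mgrp (transport_mdl A M c) (p + q + 1)) (mact (transport_mdl A M c) p (q + 1) u (rdiff A q a))"
      using c'c[OF M.d[OF x(1)]] by (simp add: d act x xx signed plus M.sg_in)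
    assume b: "b \<in> carrier (rgrp A r)"
    show "mact (transport_mdl A M c) (p + q) r (mact (transport_mdl A M c) p q u a) b = mact (transport_mdl A M c) p (q + r) u (rmul A q r a b)"
      using M.act_act[OF x(1) ein[OF a] ein[OF b]] c'c[OF xa] AA_simps(3)[OF a b] by (simp add: act x xx)
  qed
  moreover have "bij_betw c' (carrier (mgrp (transport_mdl A M c) p)) (mc M p)" for p
    by (rule bij_betwI[where g = c]) (auto simp: grp c'c)
  ultimately show ?thesis
    unfolding c'_def[symmetric]
    by (intro dg_rep.intro dg_rep_axioms.intro A M)
      (auto simp: grp act d c'c M.add[THEN c'c] M.act[OF _ ein, THEN c'c] M.d[THEN c'c])
qed

section \<open>Splitting surjections of subquotients\<close>

text \<open>Z / B is to be a right module over H^0(A), the quotient of degree zero cocycles by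
  boundaries; the last condition lets the action pass to that quotient. Besides cohomology itself,
  kernels and quotients by right ideals have to fit, hence the two parameters.\<close>

definition subquot :: "'b::ab_group_add alg \<Rightarrow> ('b, 'm::ab_group_add) mdl \<Rightarrow> int \<Rightarrow> 'm set \<Rightarrow> 'm set \<Rightarrow> bool"
  where "subquot A M p Z B \<longleftrightarrow> Z \<subseteq> mc M p \<and> B \<subseteq> Z \<and> 0 \<in> B \<and>
    (\<forall>x\<in>Z. \<forall>y\<in>Z. x - y \<in> Z) \<and> (\<forall>x\<in>B. \<forall>y\<in>B. x - y \<in> B) \<and>
    (\<forall>x\<in>Z. \<forall>a\<in>cyc (self A) 0. ma M x a \<in> Z) \<and> (\<forall>x\<in>B. \<forall>a\<in>cyc (self A) 0. ma M x a \<in> B) \<and>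
    (\<forall>x\<in>Z. \<forall>a\<in>bdy (self A) 0. ma M x a \<in> B)"

lemma (in mdl) subquot_cohomology: "dga A \<Longrightarrow> subquot A M p (cyc M p) (bdy M p)"
  using cyc_act[of _ p _ 0] bdy_act[of _ p _ 0] act_bdy[of _ p _ 0]
  by (auto simp: subquot_def cyc_mc bdy_cyc bdy_zero cyc_diff bdy_diff)

section \<open>The degree zero cohomology ring and its representatives\<close>

context dg_algebra
begin

abbreviation "R \<equiv> degree_zero_ring (cohomology_ring A)"
abbreviation "Z0 \<equiv> cyc (self (AA A)) 0"
abbreviation "B0 \<equiv> bdy (self (AA A)) 0"

lemma Z0_mult: "a \<in> Z0 \<Longrightarrow> b \<in> Z0 \<Longrightarrow> am (AA A) a b \<in> Z0"
  using S.M.cyc_act[OF AA.dga_axioms, of a 0 b 0] by simp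

lemma Z0_unit: "au (AA A) \<in> Z0"
  using AA.unit AA.d_unit by (simp add: cyc_def)

lemma rone_acoc: "rone A \<in> acoc 0"
  using Z0_unit rone by (simp add: acoc_iff AA_simps(2))

lemma R_simps:
  "carrier R = acl 0 ` acoc 0" "\<one>\<^bsub>R\<^esub> = acl 0 (rone A)" "\<zero>\<^bsub>R\<^esub> = acl 0 \<one>\<^bsub>rgrp A 0\<^esub>"
  using S.H_carrier[of 0] S.H_one[of 0] by (simp_all add: degree_zero_ring_def cohomology_ring_def)

lemma cohomology_ring_act: "rmul (cohomology_ring A) = mact (cohomology_module (regular A))"
  by (simp add: cohomology_ring_def cohomology_module_def)

lemma cohomology_ring_grp: "rgrp (cohomology_ring A) = cohomology_group (rgrp A) (rdiff A)"
  by (simp add: cohomology_ring_def)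

lemma R_add: "a \<in> acoc 0 \<Longrightarrow> b \<in> acoc 0 \<Longrightarrow> acl 0 a \<oplus>\<^bsub>R\<^esub> acl 0 b = acl 0 (a \<otimes>\<^bsub>rgrp A 0\<^esub> b)"
  using S.H_mult[of a 0 b] by (simp add: degree_zero_ring_def cohomology_ring_def)

lemma R_mult: "a \<in> acoc 0 \<Longrightarrow> b \<in> acoc 0 \<Longrightarrow> acl 0 a \<otimes>\<^bsub>R\<^esub> acl 0 b = acl 0 (rmul A 0 0 a b)"
  using S.H_act(2)[of a 0 b 0] by (simp add: degree_zero_ring_def cohomology_ring_act)

lemma acoc_closed:
  "a \<in> acoc 0 \<Longrightarrow> b \<in> acoc 0 \<Longrightarrow> a \<otimes>\<^bsub>rgrp A 0\<^esub> b \<in> acoc 0" "\<one>\<^bsub>rgrp A 0\<^esub> \<in> acoc 0"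
  "a \<in> acoc 0 \<Longrightarrow> inv\<^bsub>rgrp A 0\<^esub> a \<in> acoc 0" "a \<in> acoc 0 \<Longrightarrow> b \<in> acoc 0 \<Longrightarrow> rmul A 0 0 a b \<in> acoc 0"
  using S.coc_mult[of a 0 b] S.coc_one[of 0] S.coc_inv[of a 0] S.H_act(1)[of a 0 b 0] by simp_all

lemma ring_R: "ring R"
proof (rule ringI)
  have carr: "a \<in> carrier (rgrp A 0)" if "a \<in> acoc 0" for a using that S.coc_carrier by simp
  note g = comm_group_simps[OF rgrp[of 0]]
  show "abelian_group R"
  proof (rule abelian_groupI)
    show "\<zero>\<^bsub>R\<^esub> \<in> carrier R" using acoc_closed(2) by (simp add: R_simps)
    fix x y z assume "x \<in> carrier R"
    then obtain a where a: "a \<in> acoc 0" "x = acl 0 a" by (auto simp: R_simps)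
    show "\<zero>\<^bsub>R\<^esub> \<oplus>\<^bsub>R\<^esub> x = x"
      using a by (simp add: R_simps R_add acoc_closed g(4)[OF carr])
    show "\<exists>y\<in>carrier R. y \<oplus>\<^bsub>R\<^esub> x = \<zero>\<^bsub>R\<^esub>"
      using a by (intro bexI[of _ "acl 0 (inv\<^bsub>rgrp A 0\<^esub> a)"]) (simp_all add: R_simps R_add acoc_closed g(6)[OF carr])
    assume "y \<in> carrier R"
    then obtain b where b: "b \<in> acoc 0" "y = acl 0 b" by (auto simp: R_simps)
    show "x \<oplus>\<^bsub>R\<^esub> y \<in> carrier R" using a b by (simp add: R_simps(1) R_add acoc_closed)
    show "x \<oplus>\<^bsub>R\<^esub> y = y \<oplus>\<^bsub>R\<^esub> x" using a b g(9)[OF carr[OF a(1)] carr[OF b(1)]] by (simp add: R_add)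
    assume "z \<in> carrier R"
    then obtain c where c: "c \<in> acoc 0" "z = acl 0 c" by (auto simp: R_simps)
    show "x \<oplus>\<^bsub>R\<^esub> y \<oplus>\<^bsub>R\<^esub> z = x \<oplus>\<^bsub>R\<^esub> (y \<oplus>\<^bsub>R\<^esub> z)"
      using a b c g(8)[OF carr[OF a(1)] carr[OF b(1)] carr[OF c(1)]] by (simp add: R_add acoc_closed)
  qed
  show "monoid R"
  proof (rule monoidI)
    show "\<one>\<^bsub>R\<^esub> \<in> carrier R" using rone_acoc by (simp add: R_simps)
    fix x y z assume "x \<in> carrier R"
    then obtain a where a: "a \<in> acoc 0" "x = acl 0 a" by (auto simp: R_simps)
    show "\<one>\<^bsub>R\<^esub> \<otimes>\<^bsub>R\<^esub> x = x" "x \<otimes>\<^bsub>R\<^esub> \<one>\<^bsub>R\<^esub> = x"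
      using a rone_left[OF carr] rone_right[OF carr] by (simp_all add: R_simps R_mult rone_acoc)
    assume "y \<in> carrier R"
    then obtain b where b: "b \<in> acoc 0" "y = acl 0 b" by (auto simp: R_simps)
    show "x \<otimes>\<^bsub>R\<^esub> y \<in> carrier R" using a b by (simp add: R_simps(1) R_mult acoc_closed)
    assume "z \<in> carrier R"
    then obtain c where c: "c \<in> acoc 0" "z = acl 0 c" by (auto simp: R_simps)
    show "x \<otimes>\<^bsub>R\<^esub> y \<otimes>\<^bsub>R\<^esub> z = x \<otimes>\<^bsub>R\<^esub> (y \<otimes>\<^bsub>R\<^esub> z)"
      using a b c rmul_assoc[OF carr[OF a(1)] carr[OF b(1)] carr[OF c(1)]] by (simp add: R_mult acoc_closed)
  qed
  fix x y z assume "x \<in> carrier R" "y \<in> carrier R" "z \<in> carrier R"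
  then obtain a b c where abc: "a \<in> acoc 0" "x = acl 0 a" "b \<in> acoc 0" "y = acl 0 b" "c \<in> acoc 0" "z = acl 0 c"
    by (auto simp: R_simps)
  show "(x \<oplus>\<^bsub>R\<^esub> y) \<otimes>\<^bsub>R\<^esub> z = x \<otimes>\<^bsub>R\<^esub> z \<oplus>\<^bsub>R\<^esub> y \<otimes>\<^bsub>R\<^esub> z"
    using abc hom_mult[OF rmul_left[OF carr[OF abc(5)], of 0] carr[OF abc(1)] carr[OF abc(3)]]
    by (simp add: R_add R_mult acoc_closed)
  show "z \<otimes>\<^bsub>R\<^esub> (x \<oplus>\<^bsub>R\<^esub> y) = z \<otimes>\<^bsub>R\<^esub> x \<oplus>\<^bsub>R\<^esub> z \<otimes>\<^bsub>R\<^esub> y"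
    using abc hom_mult[OF rmul_right[OF carr[OF abc(5)], of 0] carr[OF abc(1)] carr[OF abc(3)]]
    by (simp add: R_add R_mult acoc_closed)
qed

text \<open>An arbitrary choice of cocycles; it respects sums, products and the unit only modulo
  \<open>B0\<close>.\<close>

definition "lift r = \<epsilon> 0 (SOME a. a \<in> acoc 0 \<and> r = acl 0 a)"

lemma lift_rep: assumes "r \<in> carrier R" obtains a where "a \<in> acoc 0" "r = acl 0 a" "lift r = \<epsilon> 0 a"
proof -
  have "\<exists>a. a \<in> acoc 0 \<and> r = acl 0 a" using assms by (auto simp: R_simps)
  from someI_ex[OF this] show ?thesis by (intro that) (auto simp only: lift_def)
qed

lemma acl_eq0: "a \<in> acoc 0 \<Longrightarrow> b \<in> acoc 0 \<Longrightarrow> acl 0 a = acl 0 b \<longleftrightarrow> \<epsilon> 0 a - \<epsilon> 0 b \<in> B0"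
  using acl_eq S.coc_carrier by simp

lemma lift_in: "r \<in> carrier R \<Longrightarrow> lift r \<in> Z0"
  by (elim lift_rep) (simp add: acoc_iff)

lemma lift_acl: "a \<in> acoc 0 \<Longrightarrow> lift (acl 0 a) - \<epsilon> 0 a \<in> B0"
  by (rule lift_rep[of "acl 0 a"]) (auto simp: R_simps acl_eq0[of _ a, symmetric])

lemma Z0_rep: assumes "\<alpha> \<in> Z0" obtains a where "a \<in> acoc 0" "\<alpha> = \<epsilon> 0 a"
proof -
  obtain a where "a \<in> carrier (rgrp A 0)" "\<alpha> = \<epsilon> 0 a" using S.\<phi>_surj[OF cyc_mc[OF assms]] by auto
  then show ?thesis using that[of a] assms by (simp add: acoc_iff)
qed

lemma lift_surj: assumes "\<alpha> \<in> Z0" obtains r where "r \<in> carrier R" "lift r - \<alpha> \<in> B0"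
proof -
  obtain a where a: "a \<in> acoc 0" "\<alpha> = \<epsilon> 0 a" using Z0_rep[OF assms] by blast
  then show ?thesis using that[of "acl 0 a"] lift_acl by (simp add: R_simps)
qed

lemma lift_add:
  assumes "r \<in> carrier R" "s \<in> carrier R" shows "lift (r \<oplus>\<^bsub>R\<^esub> s) - (lift r + lift s) \<in> B0"
proof -
  obtain a where a: "a \<in> acoc 0" "r = acl 0 a" "lift r = \<epsilon> 0 a" by (rule lift_rep[OF assms(1)])
  obtain b where b: "b \<in> acoc 0" "s = acl 0 b" "lift s = \<epsilon> 0 b" by (rule lift_rep[OF assms(2)])
  have "a \<in> carrier (rgrp A 0)" "b \<in> carrier (rgrp A 0)" using a b S.coc_carrier by simp_all
  then show ?thesis using lift_acl[OF acoc_closed(1)[OF a(1) b(1)]] unfolding a(3) b(3) unfolding a(2) b(2) by (simp add: R_add[OF a(1) b(1)] emb_add[OF rgrp])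
qed

lemma lift_mult:
  assumes "r \<in> carrier R" "s \<in> carrier R" shows "lift (r \<otimes>\<^bsub>R\<^esub> s) - am (AA A) (lift r) (lift s) \<in> B0"
proof -
  obtain a where a: "a \<in> acoc 0" "r = acl 0 a" "lift r = \<epsilon> 0 a" by (rule lift_rep[OF assms(1)])
  obtain b where b: "b \<in> acoc 0" "s = acl 0 b" "lift s = \<epsilon> 0 b" by (rule lift_rep[OF assms(2)])
  have "a \<in> carrier (rgrp A 0)" "b \<in> carrier (rgrp A 0)" using a b S.coc_carrier by simp_all
  then show ?thesis unfolding a(3) b(3) unfolding a(2) b(2)
    using lift_acl[OF acoc_closed(4)[OF a(1) b(1)]] AA_simps(3)[of a 0 b 0] by (simp add: R_mult[OF a(1) b(1)])
qed

lemma lift_one: "lift \<one>\<^bsub>R\<^esub> - au (AA A) \<in> B0"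
  using lift_acl[OF rone_acoc] by (simp add: R_simps AA_simps(2))

end

section \<open>Subquotients as right modules with elements in \<open>'u\<close>\<close>

locale subquotient = dg_algebra K A + M: mdl "AA A" M
  for K :: "'k ring" and A :: "('k, 'a) dg_algebra" and M :: "('a ambient, 'm::ab_group_add) mdl" +
  fixes p :: int and Z B :: "'m set" and c :: "'m \<Rightarrow> 'u"
  assumes subquotient: "subquot (AA A) M p Z B" and c: "inj_on c Z"
begin

lemma Z_in: "x \<in> Z \<Longrightarrow> x \<in> mc M p" and B_Z: "x \<in> B \<Longrightarrow> x \<in> Z" and B_zero: "0 \<in> B"
  and Z_diff: "x \<in> Z \<Longrightarrow> y \<in> Z \<Longrightarrow> x - y \<in> Z" and B_diff: "x \<in> B \<Longrightarrow> y \<in> B \<Longrightarrow> x - y \<in> B"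
  and Z_act: "x \<in> Z \<Longrightarrow> a \<in> Z0 \<Longrightarrow> ma M x a \<in> Z" and B_act: "x \<in> B \<Longrightarrow> a \<in> Z0 \<Longrightarrow> ma M x a \<in> B"
  and Z_act_B: "x \<in> Z \<Longrightarrow> a \<in> B0 \<Longrightarrow> ma M x a \<in> B"
  using subquotient by (auto simp: subquot_def)

lemma Z_zero: "0 \<in> Z" using B_zero B_Z by blast
lemma Z_neg: "x \<in> Z \<Longrightarrow> - x \<in> Z" and B_neg: "x \<in> B \<Longrightarrow> - x \<in> B"
  using Z_diff[OF Z_zero, of x] B_diff[OF B_zero, of x] by simp_all
lemma Z_add: "x \<in> Z \<Longrightarrow> y \<in> Z \<Longrightarrow> x + y \<in> Z" and B_add: "x \<in> B \<Longrightarrow> y \<in> B \<Longrightarrow> x + y \<in> B"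
  using Z_diff[OF _ Z_neg, of x y] B_diff[OF _ B_neg, of x y] by simp_all

text \<open>\<open>Mod_semisimple\<close> speaks of modules with elements in \<open>'u\<close>,
  where cosets do not live. A coset is therefore represented by the code of one of its members; the
  choice depends on the coset alone because \<open>z\<close> enters only through it.\<close>

definition "rp z = (SOME z'. z' \<in> Z \<and> z' - z \<in> B)"

lemma rp: assumes "z \<in> Z" shows "rp z \<in> Z" "rp z - z \<in> B"
proof -
  have "\<exists>z'. z' \<in> Z \<and> z' - z \<in> B" using assms B_zero by (intro exI[of _ z]) simp
  from someI_ex[OF this] show "rp z \<in> Z" "rp z - z \<in> B" by (simp_all add: rp_def)
qed

lemma rp_eq: assumes "z \<in> Z" "z' \<in> Z" shows "rp z = rp z' \<longleftrightarrow> z - z' \<in> B"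
proof
  assume "rp z = rp z'"
  then show "z - z' \<in> B" using B_diff[OF rp(2)[OF assms(2)] rp(2)[OF assms(1)]] by simp
next
  assume *: "z - z' \<in> B"
  have "y - z \<in> B \<longleftrightarrow> y - z' \<in> B" for y
    using B_add[OF _ *, of "y - z"] B_diff[OF _ *, of "y - z'"] by auto
  then show "rp z = rp z'" by (simp add: rp_def)
qed

definition "\<kappa> z = c (rp z)"
definition "\<kappa>' u = inv_into Z c u"
definition "Q = \<lparr>carrier = \<kappa> ` Z, monoid.mult = (\<lambda>u v. \<kappa> (\<kappa>' u + \<kappa>' v)), one = \<kappa> 0\<rparr>"
definition "actQ u r = \<kappa> (ma M (\<kappa>' u) (lift r))"

lemma \<kappa>'\<kappa>: "z \<in> Z \<Longrightarrow> \<kappa>' (\<kappa> z) \<in> Z" "z \<in> Z \<Longrightarrow> \<kappa>' (\<kappa> z) - z \<in> B"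
  unfolding \<kappa>_def \<kappa>'_def using rp[of z] c by simp_all

lemma \<kappa>_eq: "z \<in> Z \<Longrightarrow> z' \<in> Z \<Longrightarrow> \<kappa> z = \<kappa> z' \<longleftrightarrow> z - z' \<in> B"
  unfolding \<kappa>_def using rp rp_eq inj_on_eq_iff[OF c] by simp

lemma Q_simps: "carrier Q = \<kappa> ` Z" "\<one>\<^bsub>Q\<^esub> = \<kappa> 0"
  by (simp_all add: Q_def)

lemma Q_mult: assumes "x \<in> Z" "y \<in> Z" shows "\<kappa> x \<otimes>\<^bsub>Q\<^esub> \<kappa> y = \<kappa> (x + y)"
proof -
  have "\<kappa>' (\<kappa> x) + \<kappa>' (\<kappa> y) - (x + y) = (\<kappa>' (\<kappa> x) - x) + (\<kappa>' (\<kappa> y) - y)" by simp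
  also have "\<dots> \<in> B" using assms by (intro B_add \<kappa>'\<kappa>)
  finally show ?thesis using assms \<kappa>'\<kappa>(1) by (simp add: Q_def \<kappa>_eq Z_add)
qed

lemma Z0_ac: "a \<in> Z0 \<Longrightarrow> a \<in> ac (AA A) 0"
  by (auto simp: cyc_def)

lemma act_cong:
  assumes "x \<in> Z" "y \<in> Z" "x - y \<in> B" "a \<in> Z0" "b \<in> Z0" "a - b \<in> B0"
  shows "ma M x a - ma M y b \<in> B"
proof -
  have "ma M x a - ma M y b = ma M x (a - b) + ma M (x - y) b"
    using M.act_diffr[OF AA.dga_axioms Z_in Z0_ac Z0_ac] M.act_diffl[OF Z_in Z_in Z0_ac] assms by simp
  also have "\<dots> \<in> B" using assms by (intro B_add Z_act_B B_act)
  finally show ?thesis .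
qed

lemma Q_act: assumes "x \<in> Z" "r \<in> carrier R" "a \<in> Z0" "lift r - a \<in> B0" shows "actQ (\<kappa> x) r = \<kappa> (ma M x a)"
  using assms act_cong[OF \<kappa>'\<kappa>(1)[OF assms(1)] assms(1) \<kappa>'\<kappa>(2)[OF assms(1)] lift_in[OF assms(2)] assms(3,4)]
    \<kappa>'\<kappa>(1)
  by (simp add: actQ_def \<kappa>_eq Z_act lift_in)

lemma Q_act_lift: "x \<in> Z \<Longrightarrow> r \<in> carrier R \<Longrightarrow> actQ (\<kappa> x) r = \<kappa> (ma M x (lift r))"
  by (rule Q_act) (simp_all add: lift_in S.M.bdy_zero)

lemma Q_comm_group: "comm_group Q"
proof (rule comm_groupI)
  show "\<one>\<^bsub>Q\<^esub> \<in> carrier Q" using Z_zero by (simp add: Q_simps)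
  fix u v w assume "u \<in> carrier Q"
  then obtain x where x: "x \<in> Z" "u = \<kappa> x" by (auto simp: Q_simps)
  show "\<one>\<^bsub>Q\<^esub> \<otimes>\<^bsub>Q\<^esub> u = u" using x by (simp add: Q_simps Q_mult Z_zero)
  show "\<exists>v\<in>carrier Q. v \<otimes>\<^bsub>Q\<^esub> u = \<one>\<^bsub>Q\<^esub>"
    using x by (intro bexI[of _ "\<kappa> (- x)"]) (simp_all add: Q_simps Q_mult Z_neg)
  assume "v \<in> carrier Q"
  then obtain y where y: "y \<in> Z" "v = \<kappa> y" by (auto simp: Q_simps)
  show "u \<otimes>\<^bsub>Q\<^esub> v \<in> carrier Q" using x y by (simp add: Q_simps(1) Q_mult Z_add)
  show "u \<otimes>\<^bsub>Q\<^esub> v = v \<otimes>\<^bsub>Q\<^esub> u" using x y by (simp add: Q_mult add.commute)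
  assume "w \<in> carrier Q"
  then obtain z where z: "z \<in> Z" "w = \<kappa> z" by (auto simp: Q_simps)
  show "u \<otimes>\<^bsub>Q\<^esub> v \<otimes>\<^bsub>Q\<^esub> w = u \<otimes>\<^bsub>Q\<^esub> (v \<otimes>\<^bsub>Q\<^esub> w)" using x y z by (simp add: Q_mult Z_add add.assoc)
qed

lemma Q_right_module: "right_module R Q actQ"
proof (intro right_module.intro right_module_axioms.intro ring_R Q_comm_group)
  fix u v r s assume "u \<in> carrier Q"
  then obtain x where x: "x \<in> Z" "u = \<kappa> x" by (auto simp: Q_simps)
  note rR = ring.ring_simprules[OF ring_R]
  show "actQ u \<one>\<^bsub>R\<^esub> = u"
    using x Q_act[OF x(1) _ Z0_unit lift_one] M.act_unit[OF Z_in[OF x(1)]] rR by simp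
  {
    assume r: "r \<in> carrier R" and s: "s \<in> carrier R"
    note l = lift_in[OF r] lift_in[OF s]
    have "actQ u (r \<oplus>\<^bsub>R\<^esub> s) = \<kappa> (ma M x (lift r + lift s))"
      unfolding x(2) using x r s S.M.cyc_add[OF l] rR by (intro Q_act lift_add) auto
    then show "actQ u (r \<oplus>\<^bsub>R\<^esub> s) = actQ u r \<otimes>\<^bsub>Q\<^esub> actQ u s"
      using x r s l M.act_addr[OF Z_in[OF x(1)] Z0_ac Z0_ac] by (simp add: Q_act_lift Q_mult Z_act)
    have "actQ u (r \<otimes>\<^bsub>R\<^esub> s) = \<kappa> (ma M x (am (AA A) (lift r) (lift s)))"
      unfolding x(2) using x r s Z0_mult[OF l] rR by (intro Q_act lift_mult) auto
    then show "actQ (actQ u r) s = actQ u (r \<otimes>\<^bsub>R\<^esub> s)"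
      using x r s l M.act_act[OF Z_in[OF x(1)] Z0_ac Z0_ac] by (simp add: Q_act_lift Z_act)
  }
  assume "v \<in> carrier Q" and r: "r \<in> carrier R"
  then obtain y where y: "y \<in> Z" "v = \<kappa> y" by (auto simp: Q_simps)
  show "actQ (u \<otimes>\<^bsub>Q\<^esub> v) r = actQ u r \<otimes>\<^bsub>Q\<^esub> actQ v r"
    using x y r M.act_addl[OF Z_in[OF x(1)] Z_in[OF y(1)] Z0_ac[OF lift_in[OF r]]] lift_in[OF r]
    by (simp add: Q_mult Q_act_lift Z_add Z_act)
next
  fix u r assume "u \<in> carrier Q" and r: "r \<in> carrier R"
  then obtain x where x: "x \<in> Z" "u = \<kappa> x" by (auto simp: Q_simps)
  then show "actQ u r \<in> carrier Q" using r lift_in by (simp add: Q_act_lift Q_simps Z_act)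
qed

end

lemma subquotient_hom:
  assumes "subquotient K A M p Z B c" "subquotient K A N q Z' B' c'"
    and f: "\<And>x. x \<in> Z \<Longrightarrow> f x \<in> Z'" "\<And>x. x \<in> B \<Longrightarrow> f x \<in> B'"
      "\<And>x y. x \<in> Z \<Longrightarrow> y \<in> Z \<Longrightarrow> f (x - y) = f x - f y"
      "\<And>x a. x \<in> Z \<Longrightarrow> a \<in> cyc (self (AA A)) 0 \<Longrightarrow> f (ma M x a) = ma N (f x) a"
  defines "g \<equiv> \<lambda>u. subquotient.\<kappa> Z' B' c' (f (subquotient.\<kappa>' Z c u))"
  shows "\<And>x. x \<in> Z \<Longrightarrow> g (subquotient.\<kappa> Z B c x) = subquotient.\<kappa> Z' B' c' (f x)"
    "right_module_hom (degree_zero_ring (cohomology_ring A)) (subquotient.Q Z B c) (subquotient.actQ A M Z B c) (subquotient.Q Z' B' c') (subquotient.actQ A N Z' B' c') g"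
proof -
  interpret S: subquotient K A M p Z B c by fact
  interpret T: subquotient K A N q Z' B' c' by fact
  show g: "g (S.\<kappa> x) = T.\<kappa> (f x)" if x: "x \<in> Z" for x
    using S.\<kappa>'\<kappa>[OF x] f(1-3) x by (simp add: g_def T.\<kappa>_eq) (metis f(2,3))
  have add: "f (x + y) = f x + f y" if "x \<in> Z" "y \<in> Z" for x y
    using f(3)[OF S.Z_add[OF that] that(2)] by simp
  show "right_module_hom S.R S.Q S.actQ T.Q T.actQ g"
    unfolding right_module_hom_def
  proof (intro conjI homI ballI)
    fix u assume "u \<in> carrier S.Q"
    then obtain x where x: "x \<in> Z" "u = S.\<kappa> x" by (auto simp: S.Q_simps)
    show "g u \<in> carrier T.Q" using x f(1) by (simp add: g T.Q_simps)
    show "g (S.actQ u r) = T.actQ (g u) r" if r: "r \<in> carrier S.R" for r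
      using x r f(1,4) S.lift_in[OF r] by (simp add: g S.Q_act_lift T.Q_act_lift S.Z_act)
    fix v assume "v \<in> carrier S.Q"
    then obtain y where y: "y \<in> Z" "v = S.\<kappa> y" by (auto simp: S.Q_simps)
    show "g (u \<otimes>\<^bsub>S.Q\<^esub> v) = g u \<otimes>\<^bsub>T.Q\<^esub> g v"
      using x y f(1) by (simp add: g S.Q_mult T.Q_mult S.Z_add add)
  qed
qed

text \<open>The short exact sequence 0 -> kernel -> Z/B -> Z'/B' -> 0 splits. The section is
  returned as a function on representatives, so additivity and linearity hold only modulo
  \<open>B\<close>.\<close>

lemma semisimple_section:
  fixes M :: "('a ambient, 'm::ab_group_add) mdl" and N :: "('a ambient, 'n::ab_group_add) mdl"
    and c :: "'m \<Rightarrow> 'u" and c' :: "'n \<Rightarrow> 'u"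
  assumes ss: "Mod_semisimple TYPE('u) (degree_zero_ring (cohomology_ring A))"
    and M: "subquotient K A M p Z B c" and N: "subquotient K A N q Z' B' c'"
    and f: "\<And>x. x \<in> Z \<Longrightarrow> f x \<in> Z'" "\<And>x. x \<in> B \<Longrightarrow> f x \<in> B'"
      "\<And>x y. x \<in> Z \<Longrightarrow> y \<in> Z \<Longrightarrow> f (x - y) = f x - f y"
      "\<And>x a. x \<in> Z \<Longrightarrow> a \<in> cyc (self (AA A)) 0 \<Longrightarrow> f (ma M x a) = ma N (f x) a"
      "\<And>y. y \<in> Z' \<Longrightarrow> \<exists>x\<in>Z. f x - y \<in> B'"
  obtains s where "\<And>y. y \<in> Z' \<Longrightarrow> s y \<in> Z" "\<And>y. y \<in> Z' \<Longrightarrow> f (s y) - y \<in> B'" "\<And>y. y \<in> B' \<Longrightarrow> s y \<in> B"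
    "\<And>y z. y \<in> Z' \<Longrightarrow> z \<in> Z' \<Longrightarrow> s (y + z) - (s y + s z) \<in> B"
    "\<And>y a. y \<in> Z' \<Longrightarrow> a \<in> cyc (self (AA A)) 0 \<Longrightarrow> s (ma N y a) - ma M (s y) a \<in> B"
proof -
  interpret S: subquotient K A M p Z B c by fact
  interpret T: subquotient K A N q Z' B' c' by fact
  \<comment> \<open>Representatives of the kernel of Z/B -> Z'/B'; this is again a subquotient, with
    the same \<open>B\<close>.\<close>
  let ?L = "{x \<in> Z. f x \<in> B'}"
  have fB: "f x \<in> B'" if "x \<in> B" for x using f(2) that .
  have "subquot (AA A) M p ?L B"
    unfolding subquot_def
    using S.Z_in S.B_Z S.B_zero S.Z_diff S.B_diff S.Z_act S.B_act S.Z_act_B fB f(3,4) T.B_diff T.B_act by auto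
  moreover have "inj_on c ?L" using S.c by (rule inj_on_subset) auto
  ultimately have L: "subquotient K A M p ?L B c"
    by (intro subquotient.intro subquotient_axioms.intro S.dg_algebra_axioms S.M.mdl_axioms)
  interpret L: subquotient K A M p ?L B c by (rule L)
  define i where "i = (\<lambda>u. S.\<kappa> (L.\<kappa>' u))"
  define g where "g = (\<lambda>u. T.\<kappa> (f (S.\<kappa>' u)))"
  have i: "i (L.\<kappa> x) = S.\<kappa> x" if "x \<in> ?L" for x
    unfolding i_def by (rule subquotient_hom(1)[OF L M, of "\<lambda>x. x"]) (use that in auto)
  have i_hom: "right_module_hom S.R L.Q L.actQ S.Q S.actQ i"
    unfolding i_def by (rule subquotient_hom(2)[OF L M, of "\<lambda>x. x"]) auto
  have g: "g (S.\<kappa> x) = T.\<kappa> (f x)" if "x \<in> Z" for x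
    unfolding g_def by (rule subquotient_hom(1)[OF M N]) (use that f in auto)
  have g_hom: "right_module_hom S.R S.Q S.actQ T.Q T.actQ g"
    unfolding g_def by (rule subquotient_hom(2)[OF M N]) (use f in auto)
  have exact1: "inj_on i (carrier L.Q)"
    by (auto simp: inj_on_def L.Q_simps i L.\<kappa>_eq S.\<kappa>_eq)
  have exact2: "i ` carrier L.Q = kernel S.Q T.Q g"
  proof -
    have "g (S.\<kappa> x) = \<one>\<^bsub>T.Q\<^esub> \<longleftrightarrow> f x \<in> B'" if "x \<in> Z" for x
      using that f(1) by (simp add: g T.Q_simps T.\<kappa>_eq T.Z_zero)
    then show ?thesis unfolding kernel_def L.Q_simps S.Q_simps image_image by (force simp: i image_iff)
  qed
  have exact3: "g ` carrier S.Q = carrier T.Q"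
  proof -
    have "T.\<kappa> y \<in> g ` carrier S.Q" if y: "y \<in> Z'" for y
    proof -
      obtain x where x: "x \<in> Z" "f x - y \<in> B'" using f(5)[OF y] by blast
      then have "T.\<kappa> y = g (S.\<kappa> x)" using g[OF x(1)] T.\<kappa>_eq[OF f(1)[OF x(1)] y] by simp
      then show ?thesis using x(1) by (auto simp: S.Q_simps)
    qed
    moreover have "g (S.\<kappa> x) \<in> carrier T.Q" if "x \<in> Z" for x using that f(1) by (simp add: g T.Q_simps)
    ultimately show ?thesis by (auto simp: S.Q_simps T.Q_simps)
  qed
  have "\<exists>t. right_module_hom S.R T.Q T.actQ S.Q S.actQ t \<and> (\<forall>u\<in>carrier T.Q. g (t u) = u)"
    using ss[unfolded Mod_semisimple_def, THEN spec, THEN spec, THEN spec, THEN spec, THEN spec, THEN spec, THEN spec, THEN spec,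
        of L.Q L.actQ S.Q S.actQ T.Q T.actQ i g]
      L.Q_right_module S.Q_right_module T.Q_right_module i_hom g_hom exact1 exact2 exact3 by (simp only: simp_thms)
  then obtain t where t: "right_module_hom S.R T.Q T.actQ S.Q S.actQ t" "\<And>u. u \<in> carrier T.Q \<Longrightarrow> g (t u) = u"
    by (elim exE conjE) (simp only:)
  define s where "s = (\<lambda>y. S.\<kappa>' (t (T.\<kappa> y)))"
  have tc: "t (T.\<kappa> y) \<in> carrier S.Q" if "y \<in> Z'" for y
    using t(1) that by (auto simp: right_module_hom_def hom_def T.Q_simps)
  have s: "s y \<in> Z" "S.\<kappa> (s y) = t (T.\<kappa> y)" if y: "y \<in> Z'" for y
  proof -
    obtain x where "x \<in> Z" "t (T.\<kappa> y) = S.\<kappa> x" using tc[OF y] by (auto simp: S.Q_simps)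
    then show "s y \<in> Z" "S.\<kappa> (s y) = t (T.\<kappa> y)" using S.\<kappa>'\<kappa>[of x] by (simp_all add: s_def S.\<kappa>_eq)
  qed
  show ?thesis
  proof
    fix y assume y: "y \<in> Z'"
    show "s y \<in> Z" by (rule s(1)[OF y])
    show "f (s y) - y \<in> B'"
    proof -
      have "T.\<kappa> (f (s y)) = T.\<kappa> y" using g[OF s(1)[OF y]] s(2)[OF y] t(2)[of "T.\<kappa> y"] y by (simp add: T.Q_simps)
      then show ?thesis using T.\<kappa>_eq[OF f(1)[OF s(1)[OF y]] y] by simp
    qed
    show "s (y + z) - (s y + s z) \<in> B" if z: "z \<in> Z'" for z
    proof -
      have "t (T.\<kappa> y \<otimes>\<^bsub>T.Q\<^esub> T.\<kappa> z) = t (T.\<kappa> y) \<otimes>\<^bsub>S.Q\<^esub> t (T.\<kappa> z)"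
        using t(1) y z by (auto simp: right_module_hom_def hom_def T.Q_simps)
      then have "S.\<kappa> (s (y + z)) = S.\<kappa> (s y + s z)"
        unfolding T.Q_mult[OF y z] s(2)[OF y, symmetric] s(2)[OF z, symmetric] s(2)[OF T.Z_add[OF y z], symmetric]
          S.Q_mult[OF s(1)[OF y] s(1)[OF z]] .
      then show ?thesis using S.\<kappa>_eq[OF s(1)[OF T.Z_add[OF y z]] S.Z_add[OF s(1)[OF y] s(1)[OF z]]] by blast
    qed
    show "s (ma N y a) - ma M (s y) a \<in> B" if a: "a \<in> S.Z0" for a
    proof -
      obtain r where r: "r \<in> carrier S.R" "S.lift r - a \<in> S.B0" using S.lift_surj[OF a] by blast
      have "t (T.actQ (T.\<kappa> y) r) = S.actQ (t (T.\<kappa> y)) r"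
        using t(1) y r by (auto simp: right_module_hom_def T.Q_simps)
      then have "S.\<kappa> (s (ma N y a)) = S.\<kappa> (ma M (s y) a)"
        unfolding T.Q_act[OF y r(1) a r(2)] s(2)[OF y, symmetric] S.Q_act[OF s(1)[OF y] r(1) a r(2)]
          s(2)[OF T.Z_act[OF y a], symmetric] .
      then show ?thesis using S.\<kappa>_eq[OF s(1)[OF T.Z_act[OF y a]] S.Z_act[OF s(1)[OF y] a]] by blast
    qed
  next
    fix y assume y: "y \<in> B'"
    have "T.\<kappa> y = T.\<kappa> 0" using y by (simp add: T.\<kappa>_eq T.B_Z T.Z_zero)
    moreover have "t (T.\<kappa> 0 \<otimes>\<^bsub>T.Q\<^esub> T.\<kappa> 0) = t (T.\<kappa> 0) \<otimes>\<^bsub>S.Q\<^esub> t (T.\<kappa> 0)"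
      using t(1) T.Z_zero by (auto simp: right_module_hom_def hom_def T.Q_simps)
    then have "S.\<kappa> (s 0) = S.\<kappa> (s 0 + s 0)"
      unfolding T.Q_mult[OF T.Z_zero T.Z_zero] s(2)[OF T.Z_zero, symmetric]
        S.Q_mult[OF s(1)[OF T.Z_zero] s(1)[OF T.Z_zero]] by (simp add: s(2)[OF T.Z_zero])
    \<comment> \<open>The class of \<open>s 0\<close> equals twice itself, hence is zero; and
      \<open>s y\<close> depends only on the class of \<open>y\<close>, which is that of 0.\<close>
    then have "s 0 \<in> B" using s(1)[OF T.Z_zero] S.B_neg[of "s 0 - (s 0 + s 0)"] by (simp add: S.\<kappa>_eq S.Z_add)
    ultimately show "s y \<in> B" by (simp add: s_def)
  qed
qed

section \<open>Killing cohomology in high degrees\<close>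

locale positive_dg_algebra = dg_algebra K A for K :: "'k ring" and A :: "('k, 'a) dg_algebra" +
  fixes U :: "'u itself"
  assumes universe: "infinite (UNIV :: 'u set)" "\<exists>i :: 'a \<Rightarrow> 'u. inj i"
    and vanishing: "p < 0 \<Longrightarrow> carrier (rgrp (cohomology_ring A) p) = {\<one>\<^bsub>rgrp (cohomology_ring A) p\<^esub>}"
    and semisimple: "Mod_semisimple TYPE('u) (degree_zero_ring (cohomology_ring A))"
begin

lemma van: "p < 0 \<Longrightarrow> cyc (self (AA A)) p \<subseteq> bdy (self (AA A)) p"
  using vanishing S.H_triv by (simp add: cohomology_ring_grp)

section \<open>Sizes of the modules involved\<close>

lemma small_times: assumes "S \<lesssim> (UNIV :: 'u set)" "T \<lesssim> (UNIV :: 'u set)" shows "(S \<times> T) \<lesssim> (UNIV :: 'u set)"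
proof -
  have "(UNIV :: 'u set) \<times> (UNIV :: 'u set) \<approx> (UNIV :: 'u set)"
    unfolding eqpoll_iff_card_of_ordIso by (rule card_of_Times_same_infinite[OF universe(1)])
  then show ?thesis using times_lepoll_mono[OF assms] lepoll_trans2 by blast
qed

lemma small_nat: "(S :: 'x::countable set) \<lesssim> (UNIV :: 'u set)"
proof -
  have "S \<lesssim> (UNIV :: nat set)" using inj_to_nat unfolding lepoll_def by (metis inj_on_subset subset_UNIV)
  then show ?thesis using universe(1) infinite_le_lepoll lepoll_trans by blast
qed

lemma small_subset_image: "S \<subseteq> f ` T \<Longrightarrow> T \<lesssim> (UNIV :: 'u set) \<Longrightarrow> S \<lesssim> (UNIV :: 'u set)"
  using subset_image_lepoll lepoll_trans by blast

lemma small_UNIV: "(UNIV :: 'u set) \<lesssim> (UNIV :: 'u set)"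
  by simp

lemma small_UN: assumes "\<And>i :: 'i::countable. (S i) \<lesssim> (UNIV :: 'u set)" shows "(\<Union>i. S i) \<lesssim> (UNIV :: 'u set)"
proof -
  obtain f where f: "\<And>i. S i \<subseteq> f i ` (UNIV :: 'u set)" using assms unfolding lepoll_iff by metis
  have "(\<Union>i. S i) \<subseteq> (\<lambda>(i, u). f i u) ` (UNIV \<times> UNIV)"
    using f by (auto simp: image_iff) blast
  then show ?thesis by (rule small_subset_image[OF _ small_times[OF small_nat small_UNIV]])
qed

lemma small_AA: "(\<Union>p. ac (AA A) p) \<lesssim> (UNIV :: 'u set)"
proof -
  have a: "(UNIV :: 'a set) \<lesssim> (UNIV :: 'u set)" using universe(2) unfolding lepoll_def by blast
  have "(\<Union>p. ac (AA A) p) \<subseteq> (\<lambda>(p, a). \<epsilon> p a) ` (UNIV \<times> UNIV)" by (auto simp: AA_simps(1))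
  then show ?thesis by (rule small_subset_image[OF _ small_times[OF small_nat a]])
qed

text \<open>A finitely supported function is encoded by its graph over the support, a finite set of
  pairs; an infinite set has as many finite subsets as elements.\<close>

lemma small_free_mdl: assumes "G \<lesssim> (UNIV :: 'u set)" shows "(\<Union>p. mc (free_mdl (AA A) G deg) p) \<lesssim> (UNIV :: 'u set)"
proof -
  let ?V = "\<Union>p. ac (AA A) p"
  have "(\<Union>p. mc (free_mdl (AA A) G deg) p) \<lesssim> {f. f ` G \<subseteq> ?V \<and> {x. f x \<noteq> 0} \<subseteq> G \<and> finite {x. f x \<noteq> 0}}"
  proof (rule subset_imp_lepoll, rule subsetI)
    fix q assume "q \<in> (\<Union>p. mc (free_mdl (AA A) G deg) p)"
    then obtain p where q: "q \<in> mc (free_mdl (AA A) G deg) p" by blast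
    have "q ` G \<subseteq> ?V" using AA.free_mdl_in[OF q] by blast
    then show "q \<in> {f. f ` G \<subseteq> ?V \<and> {x. f x \<noteq> 0} \<subseteq> G \<and> finite {x. f x \<noteq> 0}}"
      using AA.free_mdl_finite[OF q] AA.free_mdl_supp[OF q] by blast
  qed
  also have "\<dots> \<lesssim> Fpow (G \<times> ?V)" using lepoll_restricted_funspace[of G ?V "\<lambda>_. 0"] by simp
  also have "\<dots> \<lesssim> Fpow (UNIV :: 'u set)"
  proof -
    obtain f :: "'b \<times> 'a ambient \<Rightarrow> 'u" where "inj_on f (G \<times> ?V)" using small_times[OF assms small_AA] unfolding lepoll_def by blast
    then show ?thesis unfolding lepoll_def using inj_on_image_Fpow[of f] image_Fpow_mono[of f _ UNIV] by blast
  qed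
  also have "\<dots> \<approx> (UNIV :: 'u set)" by (rule eqpoll_Fpow[OF universe(1)])
  finally show ?thesis by (simp add: subset_imp_lepoll)
qed

end

text \<open>Generators are indexed by the copy in the swindle, the degree, and the code of a
  cocycle; a block is the type of a cone between two free modules on them. Reserving one slot per
  stage lets all stages of the tower share one type.\<close>

type_synonym ('a, 'u) block = "(nat \<times> int \<times> 'u \<Rightarrow> 'a ambient) \<times> (nat \<times> int \<times> 'u \<Rightarrow> 'a ambient)"

type_synonym ('a, 'u) tower_mdl = "('a ambient, nat \<Rightarrow> ('a, 'u) block) mdl"

section \<open>Attaching one block of cells\<close>

definition sub_mdl :: "'b::ab_group_add alg \<Rightarrow> ('b, 'm::ab_group_add) mdl \<Rightarrow> ('b, 'm) mdl \<Rightarrow> bool"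
  where "sub_mdl A N N' \<longleftrightarrow> (\<forall>p. \<forall>x\<in>mc N p. x \<in> mc N' p \<and> md N' x = md N x \<and> (\<forall>q. \<forall>a\<in>ac A q. ma N' x a = ma N x a))"

text \<open>The second and third clauses make H^p(N) -> H^p(N') bijective for p <= n. New classes
  may appear above \<open>n\<close>, which is why the step is iterated. The last clause is the
  extension property of obstruction theory; its test modules have one fixed type, since a definition
  cannot quantify over types.\<close>

definition killing :: "'t::ab_group_add itself \<Rightarrow> 'b::ab_group_add alg \<Rightarrow> int \<Rightarrow> ('b, 'm::ab_group_add) mdl \<Rightarrow> ('b, 'm) mdl \<Rightarrow> bool"
  where "killing _ A n N N' \<longleftrightarrow> sub_mdl A N N' \<and>
    (\<forall>m>n. cyc N m \<subseteq> bdy N' m) \<and>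
    (\<forall>p\<le>n. \<forall>c\<in>cyc N' p. \<exists>x\<in>cyc N p. c - x \<in> bdy N' p) \<and>
    (\<forall>p\<le>n. \<forall>x\<in>mc N p. x \<in> bdy N' p \<longrightarrow> x \<in> bdy N p) \<and>
    (\<forall>(T :: ('b, 't::ab_group_add) mdl) f. mdl A T \<and> (\<forall>p>n. cyc T p \<subseteq> bdy T p) \<and> cmap A N T 0 f \<longrightarrow>
      (\<exists>f'. cmap A N' T 0 f' \<and> (\<forall>p. \<forall>x\<in>mc N p. f' x = f x)))"

text \<open>\<open>N\<close> uses only slots below \<open>i\<close>, so slot \<open>i\<close> is
  free for the new cells and the cone contains \<open>N\<close> as a subset.\<close>

locale slot_cone = dga A + P: mdl A P + N: mdl A N
  for A :: "'b::ab_group_add alg" and P :: "('b, 'p::ab_group_add) mdl" and N :: "('b, nat \<Rightarrow> 'p) mdl" +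
  fixes i :: nat and f :: "'p \<Rightarrow> nat \<Rightarrow> 'p"
  assumes f: "cmap A P N 0 f" and supp: "x \<in> mc N p \<Longrightarrow> i \<le> j \<Longrightarrow> x j = 0"
begin

sublocale cone: mapping_cone A P N "\<lambda>x w. x(i := w)" "\<lambda>y. y(i := 0)" "\<lambda>y. y i" f
proof unfold_locales
  show "cmap A P N 0 f" by (rule f)
  fix c c' :: "nat \<Rightarrow> 'p"
  show "(c + c')(i := 0) = c(i := 0) + c'(i := 0)" by auto
  show "c(i := 0) = c'(i := 0) \<Longrightarrow> c i = c' i \<Longrightarrow> c = c'"
    by (metis fun_upd_triv fun_upd_upd)
  fix x p and w :: 'p assume x: "x \<in> mc N p"
  show "(x(i := w))(i := 0) = x" using supp[OF x, of i] by (simp add: fun_upd_idem)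
qed auto

abbreviation "N' \<equiv> cone.C"

sublocale N': mdl A N' by (rule cone.mdl_C)

lemma upd_same: "x \<in> mc N p \<Longrightarrow> x(i := 0) = x"
  using supp by (simp add: fun_upd_idem)

lemma N'_md: "md N' y = (md N (y(i := 0)) + f (y i))(i := - md P (y i))"
  by (simp add: cone_def)

lemma in_N': "x \<in> mc N p \<Longrightarrow> x \<in> mc N' p"
  using supp[of x p i] by (simp add: cone.C_mc upd_same P.zero)

lemma sub_N': "sub_mdl A N N'"
  unfolding sub_mdl_def
proof (intro allI ballI conjI)
  fix p x assume x: "x \<in> mc N p"
  show "x \<in> mc N' p" by (rule in_N'[OF x])
  have "f 0 = 0" by (rule lmap_zero[OF P.mdl_axioms N.mdl_axioms cmap_lmap[OF f]])
  then show "md N' x = md N x"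
    using supp[OF x] upd_same[OF x] upd_same[OF N.d[OF x]] by (simp add: N'_md P.d_zero)
  show "ma N' x a = ma N x a" if "a \<in> ac A q" for a q
    using supp[OF x] upd_same[OF x] upd_same[OF N.act[OF x that]] P.act_zerol[OF that] by (simp add: cone_def)
qed

lemma N'_supp: "y \<in> mc N' p \<Longrightarrow> Suc i \<le> j \<Longrightarrow> y j = 0"
  using supp[of "y(i := 0)" p j] by (simp add: cone.C_mc)

lemma fill: assumes v: "v \<in> mc P p"
  shows "0(i := v) \<in> mc N' (p - 1)" "md N' (0(i := v)) = (f v)(i := - md P v)"
  using v N.zero by (auto simp: cone.C_mc N'_md N.d_zero fun_upd_idem)

text \<open>The long exact sequence H^p(P) -> H^p(N) -> H^p(N') -> H^{p+1}(P) -> H^{p+1}(N), worked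
  out on elements. For p <= n the first term vanishes by \<open>low\<close>; the fourth vanishes too
  unless p = n, where \<open>inj\<close> makes the last map injective. Maps extend by
  \<open>null\<close> and the universal property of the cone.\<close>

lemma killing_N':
  assumes gen: "\<And>m z. m > n \<Longrightarrow> z \<in> cyc N m \<Longrightarrow> \<exists>w\<in>cyc P m. f w = z"
    and low: "\<And>p. p \<le> n \<Longrightarrow> cyc P p \<subseteq> bdy P p"
    and inj: "\<And>w. w \<in> cyc P (n + 1) \<Longrightarrow> f w \<in> bdy N (n + 1) \<Longrightarrow> w \<in> bdy P (n + 1)"
    and null: "\<And>(T :: ('b, 't::ab_group_add) mdl) g. mdl A T \<Longrightarrow> (\<And>p. p > n \<Longrightarrow> cyc T p \<subseteq> bdy T p) \<Longrightarrow> cmap A P T 0 g \<Longrightarrow>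
      \<exists>h. lmap A P T (- 1) h \<and> (\<forall>p. \<forall>w\<in>mc P p. g w = md T (h w) + h (md P w))"
  shows "killing TYPE('t) A n N N'"
  unfolding killing_def
proof (intro conjI allI ballI impI subsetI)
  note fin = lmap_in0[OF cmap_lmap[OF f]]
  show "sub_mdl A N N'" by (rule sub_N')
  show "z \<in> bdy N' m" if m: "n < m" and z: "z \<in> cyc N m" for m z
  proof -
    obtain w where w: "w \<in> cyc P m" "f w = z" using gen[OF m z] by blast
    then show ?thesis
      using fill[OF cyc_mc[OF w(1)]] cyc_d[OF w(1)] upd_same[OF cyc_mc[OF z]] by (intro bdyI[of "0(i := w)"]) simp_all
  qed
  show "\<exists>x\<in>cyc N p. c - x \<in> bdy N' p" if p: "p \<le> n" and c: "c \<in> cyc N' p" for p c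
  proof -
    let ?x = "c(i := 0)" and ?w = "c i"
    have x: "?x \<in> mc N p" and w: "?w \<in> mc P (p + 1)" using c by (simp_all add: cyc_def cone.C_mc)
    have d: "md N ?x + f ?w = 0" "md P ?w = 0"
      using cone.C_fs(3,4)[OF cyc_mc[OF c]] cyc_d[OF c] by (simp_all add: fun_upd_idem)
    have wc: "?w \<in> cyc P (p + 1)" using w d by (simp add: cyc_def)
    have "?w \<in> bdy P (p + 1)"
    proof (cases "p = n")
      case True
      have "f ?w = md N (- ?x)" using d(1) N.d_neg[OF x] by (simp add: minus_unique)
      then have "f ?w \<in> bdy N (p + 1)" using N.neg[OF x] by (intro bdyI[of "- ?x"]) simp_all
      then show ?thesis using inj wc True by blast
    next
      case False
      then show ?thesis using low[of "p + 1"] wc p by auto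
    qed
    then obtain v where v: "v \<in> mc P p" "?w = md P v" by (auto elim: bdyE)
    have x': "?x + f v \<in> mc N p" using N.add[OF x fin[OF v(1)]] .
    have "md N (?x + f v) = 0"
      using N.d_add[OF x fin[OF v(1)]] cmap_d0[OF f v(1)] v(2) d(1) by simp
    \<comment> \<open>Adding the boundary of \<open>0(i := v)\<close> to \<open>c\<close> clears
      slot \<open>i\<close> and leaves ?x + f v.\<close>
    moreover have "c - (?x + f v) = md N' (- (0(i := v)))"
      unfolding N'.d_neg[OF fill(1)[OF v(1)]] fill(2)[OF v(1)]
      using v(2) supp[OF fin[OF v(1)], of i] by (auto simp: fun_eq_iff)
    then have "c - (?x + f v) \<in> bdy N' p" using N'.neg[OF fill(1)[OF v(1)]] by (intro bdyI)
    ultimately show ?thesis using x' by (auto simp: cyc_def)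
  qed
  show "x \<in> bdy N p" if p: "p \<le> n" and x: "x \<in> mc N p" and b: "x \<in> bdy N' p" for p x
  proof -
    obtain y where y: "y \<in> mc N' (p - 1)" "x = md N' y" using b by (rule bdyE)
    let ?y = "y(i := 0)" and ?w = "y i"
    have y': "?y \<in> mc N (p - 1)" "?w \<in> mc P p" using y(1) by (simp_all add: cone.C_mc)
    have "md N ?y + f ?w = x" "md P ?w = 0"
      using cone.C_fs(3,4)[OF y(1)] y(2) upd_same[OF x] supp[OF x, of i] by (simp_all add: fun_upd_idem)
    \<comment> \<open>The slot component of the primitive is a cocycle of \<open>P\<close> in degree
      p <= n, so it bounds and can be traded for f v in \<open>N\<close>.\<close>
    moreover have "?w \<in> bdy P p" using low[OF p] y'(2) calculation(2) by (auto simp: cyc_def)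
    then obtain v where v: "v \<in> mc P (p - 1)" "?w = md P v" by (rule bdyE)
    ultimately have "md N (?y + f v) = x"
      using N.d_add[OF y'(1) fin[OF v(1)]] cmap_d0[OF f v(1)] by simp
    then show ?thesis using N.add[OF y'(1) fin[OF v(1)]] by (metis bdyI)
  qed
  fix T :: "('b, 't) mdl" and g assume *: "mdl A T \<and> (\<forall>p>n. cyc T p \<subseteq> bdy T p) \<and> cmap A N T 0 g"
  then have T: "mdl A T" and g: "cmap A N T 0 g" by auto
  obtain h where h: "lmap A P T (- 1) h" "\<forall>p. \<forall>w\<in>mc P p. g (f w) = md T (h w) + h (md P w)"
    using null[OF T _ cmap_comp0[OF P.mdl_axioms N.mdl_axioms T f g]] * by blast
  have "cmap A N' T 0 (\<lambda>c. g (c(i := 0)) + h (c i))"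
    by (rule cone.cmap_from_cone[OF T g h(1)]) (use h(2) in blast)
  moreover have "g (x(i := 0)) + h (x i) = g x" if "x \<in> mc N p" for x p
    using upd_same[OF that] supp[OF that] lmap_zero[OF P.mdl_axioms T h(1)] by simp
  ultimately show "\<exists>f'. cmap A N' T 0 f' \<and> (\<forall>p. \<forall>x\<in>mc N p. f' x = g x)" by blast
qed

end

context positive_dg_algebra
begin

lemma small_P: assumes "G \<lesssim> (UNIV :: 'u set)" shows "(\<Union>p. mc (cone Pair fst snd (free_mdl (AA A) ((UNIV :: nat set) \<times> G) deg) (free_mdl (AA A) ((UNIV :: nat set) \<times> G) deg) D) p) \<lesssim> (UNIV :: 'u set)"
proof -
  let ?F = "free_mdl (AA A) ((UNIV :: nat set) \<times> G) deg"
  have F: "(\<Union>p. mc ?F p) \<lesssim> (UNIV :: 'u set)" by (intro small_free_mdl small_times small_nat assms)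
  have "(\<Union>p. mc (cone Pair fst snd ?F ?F D) p) \<subseteq> (\<lambda>x. x) ` ((\<Union>p. mc ?F p) \<times> (\<Union>p. mc ?F p))"
    by (auto simp: cone_def)
  then show ?thesis by (rule small_subset_image[OF _ small_times[OF F F]])
qed

text \<open>Free cells on all cocycles above degree \<open>n\<close> kill their classes, but the
  kernel of H^{n+1}(Q) -> H^{n+1}(N) would reappear in degree \<open>n\<close> of the cone. The
  idempotent \<open>E\<close> cuts H^{n+1}(Q) down to a copy of H^{n+1}(N) and is the identity on
  the generators of higher degree.\<close>

lemma killing_step:
  fixes N :: "('a, 'u) tower_mdl"
  assumes N: "mdl (AA A) N" and supp: "\<And>p x j. x \<in> mc N p \<Longrightarrow> i \<le> j \<Longrightarrow> x j = 0" and small: "(\<Union>p. mc N p) \<lesssim> (UNIV :: 'u set)"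
  obtains N' :: "('a, 'u) tower_mdl" where "mdl (AA A) N'"
    "\<And>p x j. x \<in> mc N' p \<Longrightarrow> Suc i \<le> j \<Longrightarrow> x j = 0" "(\<Union>p. mc N' p) \<lesssim> (UNIV :: 'u set)" "killing TYPE('t::ab_group_add) (AA A) n N N'"
proof -
  interpret N: mdl "AA A" N by (rule N)
  obtain c :: "(nat \<Rightarrow> ('a, 'u) block) \<Rightarrow> 'u" where c: "inj_on c (\<Union>p. mc N p)" using small unfolding lepoll_def by blast
  define z where "z = (\<lambda>g :: int \<times> 'u. inv_into (\<Union>p. mc N p) c (snd g))"
  have zc: "z (m, c x) = x" if "x \<in> mc N p" for m x p
    unfolding z_def snd_conv by (rule inv_into_f_f[OF c]) (use that in blast)
  \<comment> \<open>One generator for every cocycle above degree \<open>n\<close>. The degree is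
    part of its name because an element such as 0 is a cocycle in every degree.\<close>
  define G where "G = {(m, c x) | m x. n < m \<and> x \<in> cyc N m}"
  have z_cyc: "z g \<in> cyc N (fst g)" and G_deg: "n < fst g" if gG: "g \<in> G" for g
  proof -
    obtain m x where g: "g = (m, c x)" "n < m" and x: "x \<in> cyc N m" using gG by (auto simp: G_def)
    show "z g \<in> cyc N (fst g)" "n < fst g" using g x zc[OF cyc_mc[OF x], of m] by simp_all
  qed
  have GI: "(m, c x) \<in> G" if "n < m" "x \<in> cyc N m" for m x using that by (auto simp: G_def)
  have G_small: "G \<lesssim> (UNIV :: 'u set)"
    by (rule small_subset_image[OF _ small_times[OF small_nat small_UNIV], of _ "\<lambda>x. x" UNIV]) simp
  define Q where "Q = free_mdl (AA A) G fst"
  interpret Q: mdl "AA A" Q unfolding Q_def by (rule AA.free_mdl_mdl)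
  let ?x = "\<lambda>g. sngl g (au (AA A))"
  have x_cyc: "?x g \<in> cyc Q (fst g)" if "g \<in> G" for g unfolding Q_def by (rule AA.sngl_unit[OF that])
  define \<zeta> where "\<zeta> = lin N z"
  have \<zeta>: "cmap (AA A) Q N 0 \<zeta>" unfolding Q_def \<zeta>_def by (rule AA.lin_cmap[OF N]) (use z_cyc in auto)
  have \<zeta>_x: "\<zeta> (?x g) = z g" if "g \<in> G" for g
    unfolding \<zeta>_def
  proof (rule AA.lin_unit[OF N, of G z fst 0])
    show "z g \<in> mc N (fst g + 0)" if "g \<in> G" for g using cyc_mc[OF z_cyc[OF that]] by simp
  qed (rule that)
  note \<zeta>_cyc = cmap_cyc0[OF Q.mdl_axioms N \<zeta>] and \<zeta>_bdy = cmap_bdy0[OF Q.mdl_axioms N \<zeta>]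
  let ?n = "n + 1"
  have "(\<Union>p. mc Q p) \<lesssim> (UNIV :: 'u set)" unfolding Q_def by (rule small_free_mdl[OF G_small])
  then obtain cQ :: "(int \<times> 'u \<Rightarrow> 'a ambient) \<Rightarrow> 'u" where cQ: "inj_on cQ (\<Union>p. mc Q p)" unfolding lepoll_def by blast
  have "subquotient K A Q ?n (cyc Q ?n) (bdy Q ?n) cQ"
    by (intro subquotient.intro subquotient_axioms.intro dg_algebra_axioms Q.mdl_axioms Q.subquot_cohomology AA.dga_axioms inj_on_subset[OF cQ])
      (auto simp: cyc_def)
  moreover have "subquotient K A N ?n (cyc N ?n) (bdy N ?n) c"
    by (intro subquotient.intro subquotient_axioms.intro dg_algebra_axioms N.mdl_axioms N.subquot_cohomology AA.dga_axioms inj_on_subset[OF c])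
      (auto simp: cyc_def)
  \<comment> \<open>The map on H^{n+1} induced by \<open>\<zeta>\<close> is onto, each cocycle being
    the image of its own generator, so semisimplicity splits it.\<close>
  ultimately obtain s where s: "\<And>y. y \<in> cyc N ?n \<Longrightarrow> s y \<in> cyc Q ?n" "\<And>y. y \<in> cyc N ?n \<Longrightarrow> \<zeta> (s y) - y \<in> bdy N ?n"
      "\<And>y. y \<in> bdy N ?n \<Longrightarrow> s y \<in> bdy Q ?n"
    and s_add: "\<And>y y'. y \<in> cyc N ?n \<Longrightarrow> y' \<in> cyc N ?n \<Longrightarrow> s (y + y') - (s y + s y') \<in> bdy Q ?n"
    and s_act: "\<And>y a. y \<in> cyc N ?n \<Longrightarrow> a \<in> Z0 \<Longrightarrow> s (ma N y a) - ma Q (s y) a \<in> bdy Q ?n"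
  proof (rule semisimple_section[OF semisimple, where f = \<zeta>])
    show "\<zeta> (x - y) = \<zeta> x - \<zeta> y" if "x \<in> cyc Q ?n" "y \<in> cyc Q ?n" for x y
      by (rule lmap_diff[OF Q.mdl_axioms N cmap_lmap[OF \<zeta>]]) (use that cyc_mc in auto)
    show "\<zeta> (ma Q x a) = ma N (\<zeta> x) a" if "x \<in> cyc Q ?n" "a \<in> Z0" for x a
      using lmap_act[OF cmap_lmap[OF \<zeta>] cyc_mc[OF that(1)]] that(2) by (auto simp: cyc_def)
    show "\<exists>x\<in>cyc Q ?n. \<zeta> x - y \<in> bdy N ?n" if "y \<in> cyc N ?n" for y
    proof -
      have g: "(?n, c y) \<in> G" by (rule GI[OF _ that]) simp
      show ?thesis using x_cyc[OF g] \<zeta>_x[OF g] zc[OF cyc_mc[OF that]] N.bdy_zero by (intro bexI[of _ "?x (?n, c y)"]) simp_all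
    qed
  qed (use \<zeta>_cyc \<zeta>_bdy in auto)
  \<comment> \<open>On \<open>H\<^bsup>n+1\<^esup>\<close>, the map \<open>E\<close> is the idempotent \<open>s \<circ> \<zeta>\<close>, whose image is isomorphic to \<open>H\<^bsup>n+1\<^esup>(N)\<close>.\<close>
  define E where "E = lin Q (\<lambda>g. if fst g = ?n then s (z g) else ?x g)"
  have E_val: "(if fst g = ?n then s (z g) else ?x g) \<in> cyc Q (fst g)" if "g \<in> G" for g
    using x_cyc[OF that] s(1)[of "z g"] z_cyc[OF that] by auto
  have E: "cmap (AA A) Q Q 0 E" unfolding E_def by (subst (1) Q_def, rule AA.lin_cmap[OF Q.mdl_axioms]) (use E_val in auto)
  have E_x: "E (?x g) = (if fst g = ?n then s (z g) else ?x g)" if "g \<in> G" for g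
    unfolding E_def
  proof (rule AA.lin_unit[OF Q.mdl_axioms, of G _ fst 0])
    show "(if fst g = ?n then s (z g) else ?x g) \<in> mc Q (fst g + 0)" if "g \<in> G" for g
      using cyc_mc[OF E_val[OF that]] by simp
  qed (rule that)
  note E_cyc = cmap_cyc0[OF Q.mdl_axioms Q.mdl_axioms E] and E_bdy = cmap_bdy0[OF Q.mdl_axioms Q.mdl_axioms E]
  \<comment> \<open>Elements of degree n + 1 have coefficients of degree n + 1 - fst g <= 0. For
    degree 0 the linearity of \<open>s\<close> up to boundaries applies; a cocycle of negative
    degree bounds, and then both terms of the difference bound.\<close>
  have E_gen: "E (ma Q (?x g) a) - s (\<zeta> (ma Q (?x g) a)) \<in> bdy Q ?n \<and> ma Q (?x g) a \<in> cyc Q ?n"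
    if g: "g \<in> G" and a: "a \<in> cyc (self (AA A)) (?n - fst g)" for g a
  proof (cases "fst g = ?n")
    case True
    have xg: "?x g \<in> mc Q ?n" and zg: "z g \<in> cyc N ?n" using x_cyc[OF g] z_cyc[OF g] True by (auto simp: cyc_def)
    have a0: "a \<in> Z0" "a \<in> ac (AA A) 0" using a True by (auto simp: cyc_def)
    have "E (ma Q (?x g) a) = ma Q (s (z g)) a"
      using lmap_act[OF cmap_lmap[OF E] xg a0(2)] E_x[OF g] True by simp
    moreover have "\<zeta> (ma Q (?x g) a) = ma N (z g) a"
      using lmap_act[OF cmap_lmap[OF \<zeta>] xg a0(2)] \<zeta>_x[OF g] by simp
    ultimately have "E (ma Q (?x g) a) - s (\<zeta> (ma Q (?x g) a)) = - (s (ma N (z g) a) - ma Q (s (z g)) a)" by simp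
    then show ?thesis
      using Q.bdy_neg[OF s_act[OF zg a0(1)]] Q.cyc_act[OF AA.dga_axioms _ a0(1), of "?x g" ?n] x_cyc[OF g] True by simp
  next
    case False
    then have "?n - fst g < 0" using G_deg[OF g] by simp
    then have "a \<in> bdy (self (AA A)) (?n - fst g)" using van a by blast
    then have "ma Q (?x g) a \<in> bdy Q ?n" using Q.act_bdy[OF AA.dga_axioms x_cyc[OF g]] by fastforce
    then show ?thesis using E_bdy s(3) \<zeta>_bdy Q.bdy_diff Q.bdy_cyc by blast
  qed
  \<comment> \<open>Induction over the support replaces linearity, as \<open>s\<close> is additive
    only up to boundaries.\<close>
  have E_s: "E q - s (\<zeta> q) \<in> bdy Q ?n" if q: "q \<in> cyc Q ?n" for q
  proof -
    have q': "q \<in> mc (free_mdl (AA A) G fst) ?n" using cyc_mc[OF q] by (simp add: Q_def)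
    have coeff: "q g \<in> cyc (self (AA A)) (?n - fst g)" for g
      using AA.free_mdl_in[OF q', of g] cyc_d[OF q] by (auto simp: cyc_def AA.free_mdl_md Q_def dest: fun_cong[of _ _ g])
    have "E (\<Sum>g\<in>T. sngl g (q g)) - s (\<zeta> (\<Sum>g\<in>T. sngl g (q g))) \<in> bdy Q ?n \<and> (\<Sum>g\<in>T. sngl g (q g)) \<in> cyc Q ?n"
      if "finite T" "T \<subseteq> G" for T
      using that
    proof (induction T rule: finite_induct)
      case empty
      have "E 0 = 0" "\<zeta> 0 = 0"
        using lmap_zero[OF Q.mdl_axioms Q.mdl_axioms cmap_lmap[OF E]] lmap_zero[OF Q.mdl_axioms N cmap_lmap[OF \<zeta>]] by auto
      then show ?case unfolding sum.empty using Q.bdy_neg[OF s(3)[OF N.bdy_zero]] Q.cyc_zero by (simp only: diff_0 simp_thms)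
    next
      case (insert g T)
      let ?r = "\<Sum>g\<in>T. sngl g (q g)"
      have g: "g \<in> G" using insert.prems by simp
      have xg: "sngl g (q g) = ma Q (?x g) (q g)" unfolding Q_def using AA.sngl_unit_act[OF AA.free_mdl_in[OF q']] by metis
      note 1 = E_gen[OF g coeff, folded xg]
      have 2: "E ?r - s (\<zeta> ?r) \<in> bdy Q ?n" "?r \<in> cyc Q ?n" using insert.IH insert.prems by blast+
      note m = cyc_mc[OF 1[THEN conjunct2]] cyc_mc[OF 2(2)]
      have "E (sngl g (q g) + ?r) - s (\<zeta> (sngl g (q g) + ?r)) =
        (E (sngl g (q g)) - s (\<zeta> (sngl g (q g)))) + (E ?r - s (\<zeta> ?r))
        - (s (\<zeta> (sngl g (q g)) + \<zeta> ?r) - (s (\<zeta> (sngl g (q g))) + s (\<zeta> ?r)))"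
        unfolding lmap_add[OF cmap_lmap[OF E] m] lmap_add[OF cmap_lmap[OF \<zeta>] m] by simp
      also have "\<dots> \<in> bdy Q ?n"
        by (rule Q.bdy_diff[OF Q.bdy_add[OF 1[THEN conjunct1] 2(1)] s_add[OF \<zeta>_cyc[OF 1[THEN conjunct2]] \<zeta>_cyc[OF 2(2)]]])
      finally show ?case
        unfolding sum.insert[OF insert.hyps] using Q.cyc_add[OF 1[THEN conjunct2] 2(2)] by (rule conjI)
    qed
    moreover have "{g. q g \<noteq> 0} \<subseteq> G" using AA.free_mdl_supp[OF q'] by blast
    ultimately have "E (\<Sum>g | q g \<noteq> 0. sngl g (q g)) - s (\<zeta> (\<Sum>g | q g \<noteq> 0. sngl g (q g))) \<in> bdy Q ?n"
      using AA.free_mdl_finite[OF q'] by blast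
    then show ?thesis unfolding AA.sum_sngl[OF AA.free_mdl_finite[OF q'] subset_refl, symmetric] .
  qed
  \<comment> \<open>On a generator of degree n + 1 with cocycle z, the values of \<open>E\<close>
    and E o E are s z and, up to boundaries, s (\<zeta> (s z)); since \<zeta> (s z) - z bounds,
    additivity of \<open>s\<close> identifies the two.\<close>
  have EE: "E (?x g) - E (E (?x g)) \<in> bdy Q (fst g)" if g: "g \<in> G" for g
  proof (cases "fst g = ?n")
    case True
    let ?y = "s (z g)"
    have zg: "z g \<in> cyc N ?n" and y: "?y \<in> cyc Q ?n" using z_cyc[OF g] True s(1) by auto
    have \<beta>: "\<zeta> ?y - z g \<in> bdy N ?n" by (rule s(2)[OF zg])
    have "s (z g + (\<zeta> ?y - z g)) - (s (z g) + s (\<zeta> ?y - z g)) \<in> bdy Q ?n"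
      by (rule s_add[OF zg N.bdy_cyc[OF \<beta>]])
    from Q.bdy_add[OF this s(3)[OF \<beta>]] have "s (\<zeta> ?y) - ?y \<in> bdy Q ?n" by (simp add: algebra_simps)
    from Q.bdy_neg[OF Q.bdy_add[OF E_s[OF y] this]] show ?thesis using E_x[OF g] True by simp
  next
    case False
    then show ?thesis using E_x[OF g] Q.bdy_zero by simp
  qed
  \<comment> \<open>This is the condition under which \<open>\<zeta>\<close> extends over the
    cone.\<close>
  have \<zeta>E: "\<zeta> (?x g) - \<zeta> (E (?x g)) \<in> bdy N (fst g)" if g: "g \<in> G" for g
  proof (cases "fst g = ?n")
    case True
    then show ?thesis using N.bdy_neg[OF s(2)[of "z g"]] z_cyc[OF g] E_x[OF g] \<zeta>_x[OF g] by simp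
  next
    case False
    then show ?thesis using E_x[OF g] N.bdy_zero by simp
  qed
  interpret B: idem_block "AA A" G fst E
    by (intro idem_block.intro idem_block_axioms.intro AA.dga_axioms) (use E EE in \<open>simp_all add: Q_def\<close>)
  obtain \<Phi> where \<Phi>: "cmap (AA A) B.P N 0 \<Phi>" "\<And>q. \<Phi> (B.incl q) = \<zeta> q"
    using B.cmap_on_P[OF N \<zeta>[unfolded Q_def]] \<zeta>E by blast
  interpret C: slot_cone "AA A" B.P N i \<Phi>
    by (intro slot_cone.intro slot_cone_axioms.intro AA.dga_axioms B.P.mdl_axioms N \<Phi>(1)) (rule supp)
  note incl = B.incl_cmap[folded Q_def]
  have "killing TYPE('t) (AA A) n N C.N'"
  proof (rule C.killing_N')
    fix m y assume m: "n < m" and y: "y \<in> cyc N m"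
    have g: "(m, c y) \<in> G" by (rule GI[OF m y])
    have "B.incl (?x (m, c y)) \<in> cyc B.P m" using cmap_cyc0[OF Q.mdl_axioms B.P.mdl_axioms incl x_cyc[OF g]] by simp
    then show "\<exists>w\<in>cyc B.P m. \<Phi> w = y" using \<Phi>(2) \<zeta>_x[OF g] zc[OF cyc_mc[OF y]] by metis
  next
    fix p assume "p \<le> n"
    then show "cyc B.P p \<subseteq> bdy B.P p" using G_deg by (intro subsetI B.P_low[OF van, of ?n]) fastforce+
  next
    \<comment> \<open>Injectivity on H^{n+1}: a class of the cone comes from some E q, and if
      \<zeta> (E q) bounds then so does s (\<zeta> (E q)), which agrees up to boundaries with E (E
      q) and hence with E q.\<close>
    fix w assume w: "w \<in> cyc B.P ?n" and \<Phi>w: "\<Phi> w \<in> bdy N ?n"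
    obtain q where q: "q \<in> cyc Q ?n" "w - B.incl (E q) \<in> bdy B.P ?n" using B.P_normal[OF w] by (auto simp: Q_def)
    have Eq: "E q \<in> cyc Q ?n" by (rule E_cyc[OF q(1)])
    have iEq: "B.incl (E q) \<in> mc B.P ?n" by (rule lmap_in0[OF cmap_lmap[OF incl] cyc_mc[OF Eq]])
    have "\<Phi> w - \<zeta> (E q) \<in> bdy N ?n"
      using cmap_bdy0[OF B.P.mdl_axioms N \<Phi>(1) q(2)] lmap_diff[OF B.P.mdl_axioms N cmap_lmap[OF \<Phi>(1)] cyc_mc[OF w] iEq] \<Phi>(2) by simp
    then have "\<zeta> (E q) \<in> bdy N ?n" using N.bdy_cong \<Phi>w by blast
    then have "E (E q) \<in> bdy Q ?n" using Q.bdy_cong[OF E_s[OF Eq]] s(3) by blast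
    then have "E q \<in> bdy Q ?n" using Q.bdy_cong B.EE_cyc[folded Q_def, OF q(1)] by blast
    then have "B.incl (E q) \<in> bdy B.P ?n" by (rule cmap_bdy0[OF Q.mdl_axioms B.P.mdl_axioms incl])
    then show "w \<in> bdy B.P ?n" using B.P.bdy_cong[OF q(2)] by blast
  next
    fix T :: "('a ambient, 't) mdl" and g
    assume T: "mdl (AA A) T" "\<And>p. n < p \<Longrightarrow> cyc T p \<subseteq> bdy T p" "cmap (AA A) B.P T 0 g"
    show "\<exists>h. lmap (AA A) B.P T (- 1) h \<and> (\<forall>p. \<forall>w\<in>mc B.P p. g w = md T (h w) + h (md B.P w))"
    proof (rule B.P_null_homotopy[OF T(1,3)])
      fix ig :: "nat \<times> int \<times> 'u" assume "ig \<in> UNIV \<times> G"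
      then show "cyc T (case ig of (i, g) \<Rightarrow> fst g) \<subseteq> bdy T (case ig of (i, g) \<Rightarrow> fst g)"
        using T(2) G_deg[of "snd ig"] by (simp add: case_prod_unfold mem_Times_iff)
    qed blast
  qed
  moreover have "(\<Union>p. mc C.N' p) \<lesssim> (UNIV :: 'u set)"
  proof -
    have "(\<Union>p. mc C.N' p) \<subseteq> (\<lambda>(x, w). x(i := w)) ` ((\<Union>p. mc N p) \<times> (\<Union>p. mc B.P p))"
    proof
      fix y assume "y \<in> (\<Union>p. mc C.N' p)"
      then obtain p where "y(i := 0) \<in> mc N p" "y i \<in> mc B.P (p + 1)" by (auto simp: C.cone.C_mc)
      then show "y \<in> (\<lambda>(x, w). x(i := w)) ` ((\<Union>p. mc N p) \<times> (\<Union>p. mc B.P p))"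
        by (intro image_eqI[of _ _ "(y(i := 0), y i)"]) auto
    qed
    then show ?thesis by (rule small_subset_image[OF _ small_times[OF small small_P[OF G_small]]])
  qed
  moreover have "x j = 0" if "x \<in> mc C.N' p" "Suc i \<le> j" for p x j using C.N'_supp that by blast
  ultimately show ?thesis using that[of C.N'] C.N'.mdl_axioms by blast
qed

end

section \<open>The tower\<close>

text \<open>This moves the first block into the common type of the tower.\<close>

definition slot0 :: "('b, 'p::ab_group_add) mdl \<Rightarrow> ('b, nat \<Rightarrow> 'p) mdl"
  where "slot0 P = \<lparr>mc = (\<lambda>p. sngl 0 ` mc P p), ma = (\<lambda>x a. sngl 0 (ma P (x 0) a)), md = (\<lambda>x. sngl 0 (md P (x 0)))\<rparr>"

lemma sngl_simps [simp]: "sngl g a g = a" "sngl g a = sngl g b \<longleftrightarrow> a = b"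
  "sngl g (a + b) = sngl g a + sngl g (b :: 'c::ab_group_add)" "sngl g (a - b) = sngl g a - sngl g (b :: 'c)"
  "sngl g (0 :: 'c) = 0" "sngl g (sg k b) = sg k (sngl g b)"
  by (auto simp: sngl_def fun_eq_iff sg_def)

lemma slot0_simps [simp]: "mc (slot0 P) p = sngl 0 ` mc P p" "ma (slot0 P) (sngl 0 x) a = sngl 0 (ma P x a)"
  "md (slot0 P) (sngl 0 x) = sngl 0 (md P x)"
  by (simp_all add: slot0_def)

lemma mdl_slot0:
  assumes "mdl A P" shows "mdl A (slot0 P)" "cmap A P (slot0 P) 0 (sngl 0)" "cmap A (slot0 P) P 0 (\<lambda>x. x 0)"
proof -
  interpret P: mdl A P by fact
  show "mdl A (slot0 P)"
  proof
    show "0 \<in> mc (slot0 P) p" for p using P.zero[of p] by (auto intro: image_eqI[of _ _ 0])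
    fix p q r x y a b assume "x \<in> mc (slot0 P) p"
    then obtain x' where x: "x' \<in> mc P p" "x = sngl 0 x'" by auto
    show "md (slot0 P) x \<in> mc (slot0 P) (p + 1)" "md (slot0 P) (md (slot0 P) x) = 0" "ma (slot0 P) x (au A) = x"
      using x P.d P.d_d P.act_unit by auto
    show "x - y \<in> mc (slot0 P) p" "md (slot0 P) (x + y) = md (slot0 P) x + md (slot0 P) y" if "y \<in> mc (slot0 P) p"
      using that x P.diff P.d_add by (auto simp flip: sngl_simps(3,4))
    assume a: "a \<in> ac A q"
    show "ma (slot0 P) x a \<in> mc (slot0 P) (p + q)"
      "md (slot0 P) (ma (slot0 P) x a) = ma (slot0 P) (md (slot0 P) x) a + sg p (ma (slot0 P) x (ad A a))"
      using x P.act[OF x(1) a] P.d_act[OF x(1) a] by auto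
    show "ma (slot0 P) (x + y) a = ma (slot0 P) x a + ma (slot0 P) y a" if "y \<in> mc (slot0 P) p"
      using that x P.act_addl[OF _ _ a] by (auto simp flip: sngl_simps(3))
    show "ma (slot0 P) x (a + b) = ma (slot0 P) x a + ma (slot0 P) x b" if "b \<in> ac A q"
      using x P.act_addr[OF x(1) a that] by auto
    show "ma (slot0 P) (ma (slot0 P) x a) b = ma (slot0 P) x (am A a b)" if "b \<in> ac A r"
      using x P.act_act[OF x(1) a that] by auto
  qed
  show "cmap A P (slot0 P) 0 (sngl 0)" "cmap A (slot0 P) P 0 (\<lambda>x. x 0)"
    by (auto simp: cmap_def lmap_def)
qed

context positive_dg_algebra
begin

text \<open>The cone built from left multiplication by \<open>e\<close> on A[-n] models the homotopy
  summand e A[-n], and \<open>u\<close> plays the part of e. Hence its annihilator is that of e, and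
  a map to \<open>T\<close> may send \<open>u\<close> to any class t with t e = t.\<close>

lemma tower_base:
  fixes e :: "'a ambient"
  assumes e: "e \<in> Z0" "e - am (AA A) e e \<in> B0"
  obtains N :: "('a, 'u) tower_mdl" and u where "mdl (AA A) N" "\<And>p x j. x \<in> mc N p \<Longrightarrow> Suc 0 \<le> j \<Longrightarrow> x j = 0"
    "(\<Union>p. mc N p) \<lesssim> (UNIV :: 'u set)" "u \<in> cyc N n" "\<And>p. p < n \<Longrightarrow> cyc N p \<subseteq> bdy N p"
    "\<And>c. c \<in> cyc N n \<Longrightarrow> \<exists>a\<in>Z0. c - ma N u a \<in> bdy N n"
    "\<And>a. a \<in> Z0 \<Longrightarrow> ma N u a \<in> bdy N n \<longleftrightarrow> am (AA A) e a \<in> B0"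
    "\<And>(T :: ('a ambient, 't::ab_group_add) mdl) t. mdl (AA A) T \<Longrightarrow> t \<in> cyc T n \<Longrightarrow> t - ma T t e \<in> bdy T n \<Longrightarrow>
      \<exists>f. cmap (AA A) N T 0 f \<and> f u - t \<in> bdy T n"
proof -
  \<comment> \<open>A single generator in degree \<open>n\<close>; its code is arbitrary.\<close>
  define g :: "int \<times> 'u" where "g = (n, undefined)"
  define Q where "Q = free_mdl (AA A) {g} (\<lambda>_. n)"
  interpret Q: mdl "AA A" Q unfolding Q_def by (rule AA.free_mdl_mdl)
  let ?x = "sngl g (au (AA A))"
  have x: "?x \<in> cyc Q n" unfolding Q_def by (rule AA.sngl_unit) simp
  note act = AA.sngl_unit_act[of _ _ "{g}" "\<lambda>_. n" g, folded Q_def]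
  have ac: "a \<in> ac (AA A) 0" if "a \<in> Z0" for a using that by (auto simp: cyc_def)
  have xa: "sngl g a = ma Q ?x a" if "a \<in> Z0" for a using act[OF ac[OF that]] by simp
  have sngl_cyc: "sngl g a \<in> cyc Q n" if "a \<in> Z0" for a
    using Q.cyc_act[OF AA.dga_axioms x that] xa[OF that] by simp
  have sngl_bdy: "sngl g a \<in> bdy Q n" if "a \<in> B0" for a
    using Q.act_bdy[OF AA.dga_axioms x that] xa[OF S.M.bdy_cyc[OF that]] by simp
  have bdy_sngl: "a \<in> B0" if a: "a \<in> Z0" "sngl g a \<in> bdy Q n" for a
  proof -
    obtain s where s: "s \<in> mc Q (n - 1)" "sngl g a = md Q s" using a(2) by (rule bdyE)
    have "a = md Q s g" using s(2) by (metis sngl_simps(1))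
    then have "a = sg n (ad (AA A) (s g))" by (simp add: Q_def AA.free_mdl_md)
    moreover have "s g \<in> ac (AA A) (- 1)" using AA.free_mdl_in[of s "{g}" "\<lambda>_. n" "n - 1" g] s(1) by (simp add: Q_def)
    ultimately show ?thesis using S.M.bdy_sg[OF bdyI[of "s g" "self (AA A)" 0]] by simp
  qed
  \<comment> \<open>Left multiplication by \<open>e\<close>, which commutes with the right
    action.\<close>
  define E where "E = lin Q (\<lambda>_ :: int \<times> 'u. sngl g e)"
  have E: "cmap (AA A) Q Q 0 E" unfolding E_def by (subst (1) Q_def, rule AA.lin_cmap[OF Q.mdl_axioms]) (use sngl_cyc[OF e(1)] in simp)
  have E_sngl: "E (sngl g a) = sngl g (am (AA A) e a)" if a: "a \<in> Z0" for a
  proof -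
    have "E (sngl g a) = ma Q (sngl g e) a"
      unfolding E_def by (rule AA.lin_sngl[OF Q.mdl_axioms, of "{g}" _ "\<lambda>_. n" 0]) (use cyc_mc[OF sngl_cyc[OF e(1)]] ac[OF a] in auto)
    also have "\<dots> = ma Q (ma Q ?x e) a" using xa[OF e(1)] by simp
    also have "\<dots> = sngl g (am (AA A) e a)"
      using Q.act_act[OF cyc_mc[OF x] ac[OF e(1)] ac[OF a]] xa[OF Z0_mult[OF e(1) a]] by simp
    finally show ?thesis .
  qed
  have Ex: "E ?x = sngl g e" using E_sngl[OF Z0_unit] S.M.act_unit[of e 0] ac[OF e(1)] by simp
  have EE: "E ?x - E (E ?x) \<in> bdy Q n"
    using sngl_bdy[OF e(2)] by (simp add: Ex E_sngl[OF e(1)])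
  interpret B: idem_block "AA A" "{g}" "\<lambda>_. n" E
    by (intro idem_block.intro idem_block_axioms.intro AA.dga_axioms) (use E EE in \<open>simp_all add: Q_def\<close>)
  note incl = B.incl_cmap[folded Q_def]
  define w where "w = B.incl (E ?x)"
  note Pmdl = B.P.mdl_axioms
  have w: "w \<in> cyc B.P n"
    unfolding w_def by (intro cmap_cyc0[OF Q.mdl_axioms Pmdl incl] cmap_cyc0[OF Q.mdl_axioms Q.mdl_axioms E] x)
  have wa: "ma B.P w a = B.incl (sngl g (am (AA A) e a))" if a: "a \<in> Z0" for a
  proof -
    have "ma B.P w a = B.incl (ma Q (E ?x) a)"
      unfolding w_def by (rule lmap_act[OF cmap_lmap[OF incl] _ ac[OF a], symmetric]) (use cyc_mc[OF sngl_cyc[OF e(1)]] Ex in simp)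
    also have "ma Q (E ?x) a = E (ma Q ?x a)" using lmap_act[OF cmap_lmap[OF E] cyc_mc[OF x] ac[OF a]] by simp
    also have "\<dots> = sngl g (am (AA A) e a)" using E_sngl[OF a] xa[OF a] by simp
    finally show ?thesis .
  qed
  have gen: "\<exists>a\<in>Z0. c - ma B.P w a \<in> bdy B.P n" if c: "c \<in> cyc B.P n" for c
  proof -
    obtain q where q: "q \<in> cyc Q n" "c - B.incl (E q) \<in> bdy B.P n" using B.P_normal[OF c] by (auto simp: Q_def)
    have q': "q \<in> mc (free_mdl (AA A) {g} (\<lambda>_. n)) n" using cyc_mc[OF q(1)] by (simp add: Q_def)
    have "q g \<in> Z0" using AA.free_mdl_in[OF q', of g] cyc_d[OF q(1)] by (auto simp: cyc_def AA.free_mdl_md Q_def dest: fun_cong[of _ _ g])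
    moreover have "q = sngl g (q g)" using q' by (auto simp: AA.free_mdl_mc sngl_def fun_eq_iff)
    then have "B.incl (E q) = ma B.P w (q g)" using wa[OF \<open>q g \<in> Z0\<close>] E_sngl[OF \<open>q g \<in> Z0\<close>] by metis
    ultimately show ?thesis using q(2) by auto
  qed
  have ann: "ma B.P w a \<in> bdy B.P n \<longleftrightarrow> am (AA A) e a \<in> B0" if a: "a \<in> Z0" for a
  proof
    let ?b = "am (AA A) e a"
    have b: "?b \<in> Z0" by (rule Z0_mult[OF e(1) a])
    show "?b \<in> B0 \<Longrightarrow> ma B.P w a \<in> bdy B.P n"
      unfolding wa[OF a] by (rule cmap_bdy0[OF Q.mdl_axioms Pmdl incl sngl_bdy])
    assume *: "ma B.P w a \<in> bdy B.P n"
    \<comment> \<open>\<open>E\<close> itself extends to a map from the cone back to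
      \<open>Q\<close>. It detects e (e a), which agrees with e a modulo boundaries.\<close>
    obtain \<Phi> where \<Phi>: "cmap (AA A) B.P Q 0 \<Phi>" "\<And>q. \<Phi> (B.incl q) = E q"
      using B.cmap_on_P[OF Q.mdl_axioms[unfolded Q_def] E[unfolded Q_def]] EE by (auto simp: Q_def)
    have "\<Phi> (ma B.P w a) = sngl g (am (AA A) e ?b)" using \<Phi>(2) wa[OF a] E_sngl[OF b] by simp
    then have "sngl g (am (AA A) e ?b) \<in> bdy Q n" using cmap_bdy0[OF Pmdl Q.mdl_axioms \<Phi>(1) *] by simp
    then have 1: "am (AA A) e ?b \<in> B0" by (rule bdy_sngl[OF Z0_mult[OF e(1) b]])
    have "am (AA A) (e - am (AA A) e e) a \<in> B0" using S.M.bdy_act[OF AA.dga_axioms e(2) a] by simp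
    moreover have "am (AA A) (e - am (AA A) e e) a = ?b - am (AA A) e ?b"
      using S.M.act_diffl[of e 0 "am (AA A) e e" a 0] S.M.act_act[of e 0 e 0 a 0] ac[OF e(1)] ac[OF Z0_mult[OF e(1) e(1)]] ac[OF a] by simp
    ultimately show "?b \<in> B0" using S.M.bdy_cong 1 by metis
  qed
  have maps: "\<exists>f. cmap (AA A) B.P T 0 f \<and> f w - t \<in> bdy T n"
    if T: "mdl (AA A) T" and t: "t \<in> cyc T n" "t - ma T t e \<in> bdy T n" for T :: "('a ambient, 't) mdl" and t
  proof -
    interpret T: mdl "AA A" T by (rule T)
    define f where "f = lin T (\<lambda>_ :: int \<times> 'u. t)"
    have f: "cmap (AA A) (free_mdl (AA A) {g} (\<lambda>_. n)) T 0 f" unfolding f_def by (rule AA.lin_cmap[OF T]) (use t(1) in simp)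
    have fs: "f (sngl g a) = ma T t a" if "a \<in> Z0" for a
      unfolding f_def by (rule AA.lin_sngl[OF T, of "{g}" _ "\<lambda>_. n" 0]) (use cyc_mc[OF t(1)] ac[OF that] in auto)
    have "f ?x = t" using fs[OF Z0_unit] T.act_unit[OF cyc_mc[OF t(1)]] by simp
    moreover have fEx: "f (E ?x) = ma T t e" using fs[OF e(1)] Ex by simp
    ultimately have "f ?x - f (E ?x) \<in> bdy T n" using t(2) by simp
    then obtain \<Phi> where \<Phi>: "cmap (AA A) B.P T 0 \<Phi>" "\<And>q. \<Phi> (B.incl q) = f q"
      using B.cmap_on_P[OF T f] by auto
    have "\<Phi> w - t \<in> bdy T n" using T.bdy_neg[OF t(2)] \<Phi>(2) fEx by (simp add: w_def)
    then show ?thesis using \<Phi>(1) by blast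
  qed
  note s0 = mdl_slot0[OF Pmdl]
  have cyc0: "cyc (slot0 B.P) p = sngl 0 ` cyc B.P p" and bdy0: "bdy (slot0 B.P) p = sngl 0 ` bdy B.P p" for p
    by (auto simp: cyc_def bdy_def image_image sngl_simps(2)[of 0 _ 0, simplified] image_iff)
  show ?thesis
  proof (rule that[of "slot0 B.P" "sngl 0 w"])
    show "mdl (AA A) (slot0 B.P)" by (rule s0(1))
    show "x j = 0" if "x \<in> mc (slot0 B.P) p" "Suc 0 \<le> j" for p x j using that by (auto simp: sngl_def)
    have "(\<Union>p. mc (slot0 B.P) p) \<subseteq> sngl 0 ` (\<Union>p. mc B.P p)" by auto
    then show "(\<Union>p. mc (slot0 B.P) p) \<lesssim> (UNIV :: 'u set)"
      by (rule small_subset_image) (rule small_P, rule small_subset_image[OF _ small_UNIV, of _ "\<lambda>_. g"], auto)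
    show "sngl 0 w \<in> cyc (slot0 B.P) n" using w by (simp add: cyc0)
    show "cyc (slot0 B.P) p \<subseteq> bdy (slot0 B.P) p" if "p < n" for p
      unfolding cyc0 bdy0 by (intro image_mono subsetI B.P_low[OF van, of n]) (use that in auto)
    show "\<exists>a\<in>Z0. c - ma (slot0 B.P) (sngl 0 w) a \<in> bdy (slot0 B.P) n" if "c \<in> cyc (slot0 B.P) n" for c
    proof -
      obtain c' where c': "c' \<in> cyc B.P n" "c = sngl 0 c'" using \<open>c \<in> _\<close> by (auto simp: cyc0)
      obtain a where "a \<in> Z0" "c' - ma B.P w a \<in> bdy B.P n" using gen[OF c'(1)] by blast
      then show ?thesis using c'(2) by (intro bexI[of _ a]) (auto simp: bdy0 simp flip: sngl_simps(4))
    qed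
    show "ma (slot0 B.P) (sngl 0 w) a \<in> bdy (slot0 B.P) n \<longleftrightarrow> am (AA A) e a \<in> B0" if "a \<in> Z0" for a
      using ann[OF that] by (auto simp: bdy0)
    show "\<exists>f. cmap (AA A) (slot0 B.P) T 0 f \<and> f (sngl 0 w) - t \<in> bdy T n"
      if T: "mdl (AA A) T" and t: "t \<in> cyc T n" "t - ma T t e \<in> bdy T n" for T :: "('a ambient, 't) mdl" and t
    proof -
      obtain f where f: "cmap (AA A) B.P T 0 f" "f w - t \<in> bdy T n" using maps[OF T t] by blast
      have "cmap (AA A) (slot0 B.P) T 0 (\<lambda>x. f (x 0))" by (rule cmap_comp0[OF s0(1) Pmdl T s0(3) f(1)])
      then show ?thesis using f(2) by (intro exI[of _ "\<lambda>x. f (x 0)"]) simp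
    qed
  qed
qed

end

section \<open>The union of a chain of dg modules\<close>

definition level :: "(nat \<Rightarrow> ('b, 'm) mdl) \<Rightarrow> 'm \<Rightarrow> nat"
  where "level N x = (LEAST i. \<exists>p. x \<in> mc (N i) p)"

text \<open>The stages are nested subsets of one type, so the colimit is a union. Each element uses
  the operations of the first stage containing it; in a chain linked by \<open>sub_mdl\<close> the
  later stages agree.\<close>

definition union_mdl :: "(nat \<Rightarrow> ('b, 'm) mdl) \<Rightarrow> ('b, 'm) mdl"
  where "union_mdl N = \<lparr>mc = (\<lambda>p. \<Union>i. mc (N i) p), ma = (\<lambda>x. ma (N (level N x)) x), md = (\<lambda>x. md (N (level N x)) x)\<rparr>"

locale mdl_chain = dga A
  for A :: "'b::ab_group_add alg" +
  fixes N :: "nat \<Rightarrow> ('b, 'm::ab_group_add) mdl"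
  assumes mdl: "mdl A (N i)" and sub: "sub_mdl A (N i) (N (Suc i))"
begin

lemma sub_le: "i \<le> j \<Longrightarrow> sub_mdl A (N i) (N j)"
proof (induction rule: dec_induct)
  case base
  then show ?case by (simp add: sub_mdl_def)
next
  case (step j)
  show ?case
    unfolding sub_mdl_def
  proof (intro allI ballI)
    fix p x assume "x \<in> mc (N i) p"
    then have 1: "x \<in> mc (N j) p" "md (N j) x = md (N i) x" "\<And>q a. a \<in> ac A q \<Longrightarrow> ma (N j) x a = ma (N i) x a"
      using step.IH by (auto simp: sub_mdl_def)
    then show "x \<in> mc (N (Suc j)) p \<and> md (N (Suc j)) x = md (N i) x \<and> (\<forall>q. \<forall>a\<in>ac A q. ma (N (Suc j)) x a = ma (N i) x a)"
      using sub[of j] by (simp add: sub_mdl_def)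
  qed
qed

lemma sub_D:
  assumes "i \<le> j" "x \<in> mc (N i) p"
  shows "x \<in> mc (N j) p" "md (N j) x = md (N i) x" "a \<in> ac A q \<Longrightarrow> ma (N j) x a = ma (N i) x a"
  using sub_le[OF assms(1)] assms(2) by (auto simp: sub_mdl_def)

lemma level: assumes "x \<in> mc (N i) p" shows "level N x \<le> i" "\<exists>p. x \<in> mc (N (level N x)) p"
proof -
  show "level N x \<le> i" unfolding level_def by (rule Least_le) (use assms in blast)
  show "\<exists>p. x \<in> mc (N (level N x)) p" unfolding level_def by (rule LeastI[of _ i]) (use assms in blast)
qed

abbreviation "V \<equiv> union_mdl N"

lemma V_mc: "mc V p = (\<Union>i. mc (N i) p)"
  by (simp add: union_mdl_def)

lemma V_md: "x \<in> mc (N i) p \<Longrightarrow> md V x = md (N i) x"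
  using level[of x i p] sub_D(2)[of "level N x" i x] by (auto simp: union_mdl_def)

lemma V_ma: "x \<in> mc (N i) p \<Longrightarrow> a \<in> ac A q \<Longrightarrow> ma V x a = ma (N i) x a"
  using level[of x i p] sub_D(3)[of "level N x" i x] by (auto simp: union_mdl_def)

lemma V_common:
  assumes "x \<in> mc V p" "y \<in> mc V q"
  obtains i where "x \<in> mc (N i) p" "y \<in> mc (N i) q"
proof -
  obtain j k where "x \<in> mc (N j) p" "y \<in> mc (N k) q" using assms by (auto simp: V_mc)
  then show ?thesis using sub_D(1)[of j "max j k" x p] sub_D(1)[of k "max j k" y q] that[of "max j k"] by simp
qed

lemma mdl_V: "mdl A V"
proof
  show "0 \<in> mc V p" for p using mdl.zero[OF mdl] by (auto simp: V_mc)
  fix p q r x y a b assume x: "x \<in> mc V p"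
  then obtain i where i: "x \<in> mc (N i) p" by (auto simp: V_mc)
  interpret M: mdl A "N i" by (rule mdl)
  show "md V x \<in> mc V (p + 1)" using M.d[OF i] V_md[OF i] by (auto simp: V_mc)
  show "md V (md V x) = 0" using M.d_d[OF i] V_md[OF i] V_md[OF M.d[OF i]] by simp
  show "x - y \<in> mc V p" "md V (x + y) = md V x + md V y" if y: "y \<in> mc V p"
  proof -
    obtain k where k: "x \<in> mc (N k) p" "y \<in> mc (N k) p" by (rule V_common[OF x y])
    show "x - y \<in> mc V p" using mdl.diff[OF mdl k] by (auto simp: V_mc)
    show "md V (x + y) = md V x + md V y"
      using mdl.d_add[OF mdl k] V_md[OF k(1)] V_md[OF k(2)] V_md[OF mdl.add[OF mdl k]] by simp
  qed
  show "ma V x (au A) = x" using M.act_unit[OF i] V_ma[OF i unit] by simp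
  assume a: "a \<in> ac A q"
  note xa = M.act[OF i a]
  show "ma V x a \<in> mc V (p + q)" using xa V_ma[OF i a] by (auto simp: V_mc)
  show "ma V (x + y) a = ma V x a + ma V y a" if y: "y \<in> mc V p"
  proof -
    obtain k where k: "x \<in> mc (N k) p" "y \<in> mc (N k) p" by (rule V_common[OF x y])
    show ?thesis
      using mdl.act_addl[OF mdl k a] V_ma[OF k(1) a] V_ma[OF k(2) a] V_ma[OF mdl.add[OF mdl k] a] by simp
  qed
  show "ma V x (a + b) = ma V x a + ma V x b" if b: "b \<in> ac A q"
    using M.act_addr[OF i a b] V_ma[OF i a] V_ma[OF i b] V_ma[OF i, of "a + b" q] A.add[of a q b] a b by simp
  show "ma V (ma V x a) b = ma V x (am A a b)" if b: "b \<in> ac A r"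
    using M.act_act[OF i a b] V_ma[OF i a] V_ma[OF xa b] V_ma[OF i, of "am A a b" "q + r"] A.act[of a q b r] a b by simp
  show "md V (ma V x a) = ma V (md V x) a + sg p (ma V x (ad A a))"
    using M.d_act[OF i a] V_ma[OF i a] V_md[OF i] V_md[OF xa] V_ma[OF M.d[OF i] a] V_ma[OF i, of "ad A a" "q + 1"] A.d[of a q] a
    by simp
qed

text \<open>Being a cocycle and being a boundary are both witnessed at a finite stage; this is how
  cohomology commutes with the union.\<close>

lemma V_cyc: "cyc V p = (\<Union>i. cyc (N i) p)"
proof -
  have "x \<in> mc (N i) p \<Longrightarrow> md V x = 0 \<longleftrightarrow> md (N i) x = 0" for x i by (simp add: V_md)
  then show ?thesis unfolding cyc_def V_mc by blast
qed

lemma V_bdy: "bdy V p = (\<Union>i. bdy (N i) p)"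
proof -
  have "md V ` mc V (p - 1) = (\<Union>i. md V ` mc (N i) (p - 1))" unfolding V_mc by blast
  moreover have "md V ` mc (N i) (p - 1) = md (N i) ` mc (N i) (p - 1)" for i
    by (rule image_cong) (simp_all add: V_md)
  ultimately show ?thesis by (simp add: bdy_def)
qed

lemma bdy_mono: "i \<le> j \<Longrightarrow> bdy (N i) p \<subseteq> bdy (N j) p"
proof
  fix x assume "i \<le> j" "x \<in> bdy (N i) p"
  then obtain y where y: "y \<in> mc (N i) (p - 1)" "x = md (N i) y" by (auto elim: bdyE)
  then show "x \<in> bdy (N j) p" using sub_D(1,2)[OF \<open>i \<le> j\<close> y(1)] by (intro bdyI[of y]) simp_all
qed

lemma cmap_V:
  assumes T: "mdl A T" and f: "\<And>i. cmap A (N i) T r (f i)" and ext: "\<And>i p x. x \<in> mc (N i) p \<Longrightarrow> f (Suc i) x = f i x"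
  obtains F where "cmap A V T r F" "\<And>i p x. x \<in> mc (N i) p \<Longrightarrow> F x = f i x"
proof -
  have f_le: "f j x = f i x" if "i \<le> j" "x \<in> mc (N i) p" for i j x p
    using that(1)
  proof (induction rule: dec_induct)
    case (step k)
    then show ?case using ext[OF sub_D(1)[OF step.hyps(1) that(2)]] by simp
  qed simp
  define F where "F = (\<lambda>x. f (level N x) x)"
  have F: "F x = f i x" if "x \<in> mc (N i) p" for x i p
    using level[OF that] f_le[of "level N x" i x] by (auto simp: F_def)
  have "cmap A V T r F"
    unfolding cmap_def lmap_def
  proof (intro conjI allI ballI)
    fix p x assume x: "x \<in> mc V p"
    then obtain i where i: "x \<in> mc (N i) p" by (auto simp: V_mc)
    note fl = cmap_lmap[OF f]
    show "F x \<in> mc T (p + r)" using lmap_in[OF fl i] F[OF i] by simp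
    show "md T (F x) = sg r (F (md V x))"
      using cmap_d[OF f i] F[OF i] V_md[OF i] F[OF mdl.d[OF mdl i]] by simp
    show "F (x + y) = F x + F y" if y: "y \<in> mc V p" for y
    proof -
      obtain k where k: "x \<in> mc (N k) p" "y \<in> mc (N k) p" by (rule V_common[OF x y])
      show ?thesis using lmap_add[OF fl k] F[OF k(1)] F[OF k(2)] F[OF mdl.add[OF mdl k]] by simp
    qed
    show "F (ma V x a) = ma T (F x) a" if a: "a \<in> ac A q" for a q
      using lmap_act[OF fl i a] F[OF i] V_ma[OF i a] F[OF mdl.act[OF mdl i a]] by simp
  qed
  then show ?thesis using that F by blast
qed

end

context positive_dg_algebra
begin

text \<open>A cocycle of degree above \<open>n\<close> appears at some finite stage and bounds at
  the next one, while cohomology in degrees <= n does not change along the chain; hence the union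
  has cohomology in degree \<open>n\<close> only.\<close>

lemma tower:
  assumes e: "e \<in> Z0" "e - am (AA A) e e \<in> B0"
  obtains V :: "('a, 'u) tower_mdl" and u where "mdl (AA A) V"
    "(\<Union>p. mc V p) \<lesssim> (UNIV :: 'u set)" "u \<in> cyc V n" "\<And>p. p \<noteq> n \<Longrightarrow> cyc V p \<subseteq> bdy V p"
    "\<And>c. c \<in> cyc V n \<Longrightarrow> \<exists>a\<in>Z0. c - ma V u a \<in> bdy V n"
    "\<And>a. a \<in> Z0 \<Longrightarrow> ma V u a \<in> bdy V n \<longleftrightarrow> am (AA A) e a \<in> B0"
    "\<And>(T :: ('a ambient, 't::ab_group_add) mdl) t. mdl (AA A) T \<Longrightarrow> \<forall>p>n. cyc T p \<subseteq> bdy T p \<Longrightarrow>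
      t \<in> cyc T n \<Longrightarrow> t - ma T t e \<in> bdy T n \<Longrightarrow> \<exists>f. cmap (AA A) V T 0 f \<and> f u - t \<in> bdy T n"
proof -
  define ok where "ok = (\<lambda>i (N :: ('a, 'u) tower_mdl). mdl (AA A) N \<and>
    (\<forall>p x j. x \<in> mc N p \<longrightarrow> Suc i \<le> j \<longrightarrow> x j = 0) \<and> (\<Union>p. mc N p) \<lesssim> (UNIV :: 'u set))"
  obtain N0 :: "('a, 'u) tower_mdl" and u where N0: "mdl (AA A) N0" "\<And>p x j. x \<in> mc N0 p \<Longrightarrow> Suc 0 \<le> j \<Longrightarrow> x j = 0"
    "(\<Union>p. mc N0 p) \<lesssim> (UNIV :: 'u set)" and u: "u \<in> cyc N0 n" and low: "\<And>p. p < n \<Longrightarrow> cyc N0 p \<subseteq> bdy N0 p"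
    and gen: "\<And>c. c \<in> cyc N0 n \<Longrightarrow> \<exists>a\<in>Z0. c - ma N0 u a \<in> bdy N0 n"
    and ann: "\<And>a. a \<in> Z0 \<Longrightarrow> ma N0 u a \<in> bdy N0 n \<longleftrightarrow> am (AA A) e a \<in> B0"
    and maps: "\<And>(T :: ('a ambient, 't) mdl) t. mdl (AA A) T \<Longrightarrow> t \<in> cyc T n \<Longrightarrow> t - ma T t e \<in> bdy T n \<Longrightarrow>
      \<exists>f. cmap (AA A) N0 T 0 f \<and> f u - t \<in> bdy T n"
    by (rule tower_base[OF e, where n = n and 't = 't]) (rule that)
  have "ok 0 N0" using N0 by (auto simp: ok_def)
  moreover have "\<exists>N'. ok (Suc i) N' \<and> killing TYPE('t) (AA A) n N N'" if "ok i N" for i N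
  proof -
    have N: "mdl (AA A) N" "\<And>p x j. x \<in> mc N p \<Longrightarrow> Suc i \<le> j \<Longrightarrow> x j = 0" "(\<Union>p. mc N p) \<lesssim> (UNIV :: 'u set)"
      using that by (auto simp: ok_def)
    show ?thesis
    \<comment> \<open>Stage \<open>i\<close> occupies the slots 0 to i, so the next block goes into
      slot i + 1.\<close>
    proof (rule killing_step[where N = N and i = "Suc i" and n = n and 't = 't])
      fix N' :: "('a, 'u) tower_mdl"
      assume "mdl (AA A) N'" "\<And>p x j. x \<in> mc N' p \<Longrightarrow> Suc (Suc i) \<le> j \<Longrightarrow> x j = 0"
        "(\<Union>p. mc N' p) \<lesssim> (UNIV :: 'u set)" "killing TYPE('t) (AA A) n N N'"
      then show ?thesis by (intro exI[of _ N']) (auto simp: ok_def)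
    qed (use N in auto)
  qed
  \<comment> \<open>The conjunct on \<open>i = 0\<close> fixes the first stage, so that what is
    known about \<open>u\<close> in \<open>N0\<close> applies.\<close>
  ultimately have "\<exists>N. \<forall>i. (ok i (N i) \<and> (i = 0 \<longrightarrow> N i = N0)) \<and> killing TYPE('t) (AA A) n (N i) (N (Suc i))"
    by (intro dependent_nat_choice) auto
  then obtain N where ok: "\<And>i. ok i (N i)" and N_0: "N 0 = N0" and kill: "\<And>i. killing TYPE('t) (AA A) n (N i) (N (Suc i))"
    by blast
  have mdlN: "mdl (AA A) (N i)" for i using ok by (simp add: ok_def)
  interpret mdl_chain "AA A" N
    by (intro mdl_chain.intro mdl_chain_axioms.intro AA.dga_axioms mdlN) (use kill in \<open>simp add: killing_def\<close>)
  have kill1: "m > n \<Longrightarrow> cyc (N i) m \<subseteq> bdy (N (Suc i)) m"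
    and kill2: "p \<le> n \<Longrightarrow> c \<in> cyc (N (Suc i)) p \<Longrightarrow> \<exists>x\<in>cyc (N i) p. c - x \<in> bdy (N (Suc i)) p"
    and kill3: "p \<le> n \<Longrightarrow> x \<in> mc (N i) p \<Longrightarrow> x \<in> bdy (N (Suc i)) p \<Longrightarrow> x \<in> bdy (N i) p"
    and kill4: "mdl (AA A) T \<Longrightarrow> (\<forall>p>n. cyc T p \<subseteq> bdy T p) \<Longrightarrow> cmap (AA A) (N i) T 0 f \<Longrightarrow>
      \<exists>f'. cmap (AA A) (N (Suc i)) T 0 f' \<and> (\<forall>p. \<forall>x\<in>mc (N i) p. f' x = f x)" for m i p c x f and T :: "('a ambient, 't) mdl"
    using kill[of i] unfolding killing_def by blast+
  have u_in: "u \<in> mc (N i) n" for i using sub_D(1)[of 0 i u n] cyc_mc[OF u] N_0 by simp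
  have ac: "a \<in> ac (AA A) 0" if "a \<in> Z0" for a using that by (auto simp: cyc_def)
  have ua: "ma (N i) u a = ma N0 u a" "ma N0 u a \<in> mc (N i) n" if "a \<in> Z0" for i a
    using sub_D(3)[of 0 i u n a 0] sub_D(1)[of 0 i "ma N0 u a" n] u_in[of 0] mdl.act[OF N0(1) cyc_mc[OF u] ac[OF that]] ac[OF that] N_0 by simp_all
  have low_i: "cyc (N i) p \<subseteq> bdy (N i) p" if "p < n" for i p
  proof (induction i)
    case 0
    then show ?case using low[OF that] N_0 by simp
  next
    case (Suc i)
    show ?case
    proof
      fix c assume "c \<in> cyc (N (Suc i)) p"
      then obtain x where x: "x \<in> cyc (N i) p" "c - x \<in> bdy (N (Suc i)) p" using kill2[of p c i] \<open>p < n\<close> by auto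
      then have "x \<in> bdy (N (Suc i)) p" using Suc bdy_mono[of i "Suc i" p] by auto
      then show "c \<in> bdy (N (Suc i)) p" using mdl.bdy_cong[OF mdlN x(2)] by blast
    qed
  qed
  have gen_i: "\<exists>a\<in>Z0. c - ma N0 u a \<in> bdy (N i) n" if "c \<in> cyc (N i) n" for i c
    using that
  proof (induction i arbitrary: c)
    case 0
    then show ?case unfolding N_0 by (rule gen)
  next
    case (Suc i)
    obtain x where x: "x \<in> cyc (N i) n" "c - x \<in> bdy (N (Suc i)) n" using kill2[of n c i] Suc.prems by auto
    obtain a where a: "a \<in> Z0" "x - ma N0 u a \<in> bdy (N i) n" using Suc.IH[OF x(1)] by blast
    have "x - ma N0 u a \<in> bdy (N (Suc i)) n" using bdy_mono[of i "Suc i" n] a(2) by auto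
    from mdl.bdy_add[OF mdlN x(2) this] have "c - ma N0 u a \<in> bdy (N (Suc i)) n" by simp
    then show ?case using a(1) by blast
  qed
  have ann_i: "ma N0 u a \<in> bdy (N i) n \<Longrightarrow> ma N0 u a \<in> bdy N0 n" if "a \<in> Z0" for i a
  proof (induction i)
    case 0
    then show ?case using N_0 by simp
  next
    case (Suc i)
    then show ?case using kill3[of n "ma N0 u a" i] ua(2)[OF that] by simp
  qed
  have uaV: "ma V u a = ma N0 u a" if "a \<in> Z0" for a
    using V_ma[OF u_in[of 0] ac[OF that]] N_0 by simp
  show ?thesis
  proof (rule that[of V u])
    show "mdl (AA A) V" by (rule mdl_V)
    have "(\<Union>p. mc V p) = (\<Union>i. \<Union>p. mc (N i) p)" by (auto simp: V_mc)
    also have "\<dots> \<lesssim> (UNIV :: 'u set)" by (rule small_UN) (use ok in \<open>simp add: ok_def\<close>)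
    finally show "(\<Union>p. mc V p) \<lesssim> (UNIV :: 'u set)" .
    show "u \<in> cyc V n" using u N_0 unfolding V_cyc by blast
    show "cyc V p \<subseteq> bdy V p" if "p \<noteq> n" for p
    proof (cases "p < n")
      case True
      then show ?thesis using low_i unfolding V_cyc V_bdy by blast
    next
      case False
      then have "n < p" using that by simp
      then show ?thesis using kill1 unfolding V_cyc V_bdy by blast
    qed
    show "\<exists>a\<in>Z0. c - ma V u a \<in> bdy V n" if c: "c \<in> cyc V n" for c
    proof -
      obtain i where "c \<in> cyc (N i) n" using c by (auto simp: V_cyc)
      then obtain a where "a \<in> Z0" "c - ma N0 u a \<in> bdy (N i) n" using gen_i by blast
      then show ?thesis using uaV unfolding V_bdy by (intro bexI[of _ a] UN_I[of i]) simp_all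
    qed
    show "ma V u a \<in> bdy V n \<longleftrightarrow> am (AA A) e a \<in> B0" if a: "a \<in> Z0" for a
    proof -
      have "ma N0 u a \<in> bdy V n \<longleftrightarrow> ma N0 u a \<in> bdy N0 n"
        using ann_i[OF a] N_0 unfolding V_bdy by blast
      then show ?thesis using uaV[OF a] ann[OF a] by simp
    qed
    show "\<exists>f. cmap (AA A) V T 0 f \<and> f u - t \<in> bdy T n"
      if T: "mdl (AA A) T" "\<forall>p>n. cyc T p \<subseteq> bdy T p" and t: "t \<in> cyc T n" "t - ma T t e \<in> bdy T n"
      for T :: "('a ambient, 't) mdl" and t
    proof -
      obtain f0 where f0: "cmap (AA A) N0 T 0 f0" "f0 u - t \<in> bdy T n" using maps[OF T(1) t] by blast
      \<comment> \<open>Each extension must restrict to the previous one, so the maps are chosen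
        dependently, starting from \<open>f0\<close>.\<close>
      have "\<exists>f. \<forall>i. (cmap (AA A) (N i) T 0 (f i) \<and> (i = 0 \<longrightarrow> f i = f0)) \<and> (\<forall>p. \<forall>x\<in>mc (N i) p. f (Suc i) x = f i x)"
      proof (rule dependent_nat_choice)
        show "\<exists>f. cmap (AA A) (N 0) T 0 f \<and> (0 = 0 \<longrightarrow> f = f0)" using f0(1) N_0 by auto
        show "\<exists>f'. (cmap (AA A) (N (Suc i)) T 0 f' \<and> (Suc i = 0 \<longrightarrow> f' = f0)) \<and> (\<forall>p. \<forall>x\<in>mc (N i) p. f' x = f x)"
          if "cmap (AA A) (N i) T 0 f \<and> (i = 0 \<longrightarrow> f = f0)" for f i
          using kill4[of T i f] T that by auto
      qed
      then obtain f where f: "\<And>i. cmap (AA A) (N i) T 0 (f i)" "f 0 = f0" "\<And>i p x. x \<in> mc (N i) p \<Longrightarrow> f (Suc i) x = f i x"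
        by blast
      show ?thesis
      proof (rule cmap_V[OF T(1) f(1)])
        fix F assume F: "cmap (AA A) V T 0 F" "\<And>i p x. x \<in> mc (N i) p \<Longrightarrow> F x = f i x"
        then show ?thesis using F(2)[OF u_in[of 0]] f(2) f0(2) by auto
      qed (rule f(3))
    qed
  qed
qed

end

section \<open>Modules with simple cohomology\<close>

text \<open>Truncations of \<open>S\<close> from below are graded submodules. If S^n is nonzero,
  simplicity makes the truncation at n everything and the one at n + 1 zero. Any nonzero element of
  S^n then generates.\<close>

lemma (in positive_dg_algebra) graded_simple_cyclic:
  assumes "graded_simple (cohomology_ring A) S"
  obtains n s0 where "graded_module (cohomology_ring A) S" "\<And>p. p \<noteq> n \<Longrightarrow> carrier (mgrp S p) = {\<one>\<^bsub>mgrp S p\<^esub>}"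
    "s0 \<in> carrier (mgrp S n)"
    "\<And>x. x \<in> carrier (mgrp S n) \<Longrightarrow> \<exists>r\<in>carrier (rgrp (cohomology_ring A) 0). x = mact S n 0 s0 r"
proof -
  let ?H = "cohomology_ring A"
  interpret gm: graded_module ?H S using assms by (simp add: graded_simple_def)
  have sub: "(\<forall>p. N p = {\<one>\<^bsub>mgrp S p\<^esub>}) \<or> (\<forall>p. N p = carrier (mgrp S p))" if "graded_submodule ?H S N" for N
    using assms that by (simp add: graded_simple_def)
  obtain n where n: "carrier (mgrp S n) \<noteq> {\<one>\<^bsub>mgrp S n\<^esub>}" using assms by (auto simp: graded_simple_def)
  note one = comm_group_simps(1)[OF gm.mgrp]
  have grp: "group (mgrp S p)" for p using gm.mgrp by (simp add: comm_group_def)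
  have act_in: "mact S p q x a \<in> carrier (mgrp S (p + q))" if "x \<in> carrier (mgrp S p)" "a \<in> carrier (rgrp ?H q)" for p q x a
    using gm.mact_right that hom_in_carrier by metis
  have act_one: "mact S p q \<one>\<^bsub>mgrp S p\<^esub> a = \<one>\<^bsub>mgrp S (p + q)\<^esub>" if "a \<in> carrier (rgrp ?H q)" for p q a
    using hom_one_comm[OF gm.mgrp gm.mgrp gm.mact_left[OF that]] .
  have triv: "subgroup {\<one>\<^bsub>mgrp S p\<^esub>} (mgrp S p)" and full: "subgroup (carrier (mgrp S p)) (mgrp S p)" for p
    using group.triv_subgroup[OF grp] group.subgroup_self[OF grp] by auto
  \<comment> \<open>Only scalars of negative degree could leave the truncation, and they are
    zero.\<close>
  have "graded_submodule ?H S (\<lambda>p. if k \<le> p then carrier (mgrp S p) else {\<one>\<^bsub>mgrp S p\<^esub>})" for k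
    unfolding graded_submodule_def
  proof (intro conjI allI ballI)
    fix p q x a assume x: "x \<in> (if k \<le> p then carrier (mgrp S p) else {\<one>\<^bsub>mgrp S p\<^esub>})" and a: "a \<in> carrier (rgrp ?H q)"
    then have x': "x \<in> carrier (mgrp S p)" using one by (auto split: if_splits)
    show "mact S p q x a \<in> (if k \<le> p + q then carrier (mgrp S (p + q)) else {\<one>\<^bsub>mgrp S (p + q)\<^esub>})"
    proof (cases "q < 0")
      case True
      then have "a = \<one>\<^bsub>rgrp ?H q\<^esub>" using vanishing a by auto
      then have "mact S p q x a = \<one>\<^bsub>mgrp S (p + q)\<^esub>"
        using hom_one_comm[OF gm.rgrp gm.mgrp gm.mact_right[OF x']] by simp
      then show ?thesis using one by simp
    next
      case False
      then show ?thesis using act_in[OF x' a] x act_one[OF a] by (auto split: if_splits)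
    qed
  qed (simp add: triv full)
  note * = sub[OF this]
  have below: "carrier (mgrp S p) = {\<one>\<^bsub>mgrp S p\<^esub>}" if "p < n" for p
    using *[of n] n that by (metis linorder_not_le order_refl)
  have above: "carrier (mgrp S p) = {\<one>\<^bsub>mgrp S p\<^esub>}" if "n < p" for p
    using *[of "n + 1"] n that by (metis add1_zle_eq less_irrefl)
  have conc: "carrier (mgrp S p) = {\<one>\<^bsub>mgrp S p\<^esub>}" if "p \<noteq> n" for p
    using below above that by (metis linorder_neqE)
  obtain s0 where s0: "s0 \<in> carrier (mgrp S n)" "s0 \<noteq> \<one>\<^bsub>mgrp S n\<^esub>" using n one[of n] by blast
  \<comment> \<open>Scalars of nonzero degree move \<open>?C\<close> into degrees where
    \<open>S\<close> is already known to vanish, so \<open>?C\<close> placed in degree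
    \<open>n\<close> is a graded submodule.\<close>
  let ?C = "mact S n 0 s0 ` carrier (rgrp ?H 0)"
  have h: "mact S n 0 s0 \<in> hom (rgrp ?H 0) (mgrp S n)" using gm.mact_right[OF s0(1), of 0] by simp
  have "group_hom (rgrp ?H 0) (mgrp S n) (mact S n 0 s0)"
    using h grp[of n] gm.rgrp[of 0] by (simp add: group_hom_def group_hom_axioms_def comm_group_def)
  then have C: "subgroup ?C (mgrp S n)" by (rule group_hom.img_is_subgroup)
  have "graded_submodule ?H S (\<lambda>p. if p = n then ?C else {\<one>\<^bsub>mgrp S p\<^esub>})"
    unfolding graded_submodule_def
  proof (intro conjI allI ballI)
    fix p q x a assume x: "x \<in> (if p = n then ?C else {\<one>\<^bsub>mgrp S p\<^esub>})" and a: "a \<in> carrier (rgrp ?H q)"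
    then have x': "x \<in> carrier (mgrp S p)" using one subgroup.subset[OF C] by (auto split: if_splits)
    show "mact S p q x a \<in> (if p + q = n then ?C else {\<one>\<^bsub>mgrp S (p + q)\<^esub>})"
    proof (cases "p + q = n")
      case True
      show ?thesis
      proof (cases "p = n")
        case p: True
        then have q: "q = 0" using True by simp
        obtain r where r: "r \<in> carrier (rgrp ?H 0)" "x = mact S n 0 s0 r" using x p by auto
        have a0: "a \<in> carrier (rgrp ?H 0)" using a q by simp
        have "mact S n 0 x a = mact S n 0 s0 (rmul ?H 0 0 r a)"
          using gm.mact_assoc[OF s0(1) r(1) a0] r(2) by simp
        moreover have "rmul ?H 0 0 r a \<in> carrier (rgrp ?H 0)"
          using hom_in_carrier[OF gm.rmul_right[OF r(1)] a0] by simp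
        ultimately show ?thesis using p q by simp
      next
        case False
        then have "mact S p q x a = \<one>\<^bsub>mgrp S n\<^esub>" using x act_one[OF a, of p] True by simp
        then show ?thesis using subgroup.one_closed[OF C] True by simp
      qed
    next
      case False
      then show ?thesis using act_in[OF x' a] conc[of "p + q"] by simp
    qed
  qed (simp add: triv C)
  from sub[OF this] have "?C = {\<one>\<^bsub>mgrp S n\<^esub>} \<or> ?C = carrier (mgrp S n)" by metis
  moreover have "s0 \<in> ?C" using gm.mact_one[OF s0(1)] gm.rone by (metis imageI)
  ultimately have "?C = carrier (mgrp S n)" using s0(2) by blast
  then have "\<exists>r\<in>carrier (rgrp ?H 0). x = mact S n 0 s0 r" if "x \<in> carrier (mgrp S n)" for x using that by blast
  then show ?thesis using that[OF gm.graded_module_axioms conc s0(1)] by blast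
qed

section \<open>The nonzero part of \<open>S\<close> as a quotient of the degree zero
  cocycles\<close>

locale simple_module = positive_dg_algebra K A U + gm: graded_module "cohomology_ring A" S
  for K :: "'k ring" and A :: "('k, 'a) dg_algebra" and U :: "'u itself" and S :: "('a set, 's) graded_module" +
  fixes n :: int and s0 :: 's
  assumes conc: "p \<noteq> n \<Longrightarrow> carrier (mgrp S p) = {\<one>\<^bsub>mgrp S p\<^esub>}"
    and s0: "s0 \<in> carrier (mgrp S n)"
    and s0_gen: "x \<in> carrier (mgrp S n) \<Longrightarrow> \<exists>r\<in>carrier (rgrp (cohomology_ring A) 0). x = mact S n 0 s0 r"
begin

abbreviation "HA \<equiv> cohomology_ring A"

definition "cz \<alpha> = acl 0 (SOME a. a \<in> acoc 0 \<and> \<alpha> = \<epsilon> 0 a)"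

lemma cz_acl: assumes "a \<in> acoc 0" shows "cz (\<epsilon> 0 a) = acl 0 a"
proof -
  have "(SOME b. b \<in> acoc 0 \<and> \<epsilon> 0 a = \<epsilon> 0 b) = a"
    by (rule some_equality) (use assms S.\<phi>_eq[of _ 0 a] in \<open>auto simp: acoc_iff\<close>)
  then show ?thesis by (simp add: cz_def)
qed

lemma HA_carrier: "carrier (rgrp HA q) = acl q ` acoc q"
  using S.H_carrier[of q] by (simp add: cohomology_ring_grp)

definition "act0 \<alpha> = mact S n 0 s0 (cz \<alpha>)"

text \<open>The preimage in \<open>Z0\<close> of the annihilator of \<open>s0\<close>: a right ideal
  containing \<open>B0\<close>, with Z0 / I isomorphic to S^n through \<open>act0\<close>.\<close>

definition "I = {\<alpha> \<in> Z0. act0 \<alpha> = \<one>\<^bsub>mgrp S n\<^esub>}"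

lemma S_act: "x \<in> carrier (mgrp S p) \<Longrightarrow> a \<in> carrier (rgrp HA q) \<Longrightarrow> mact S p q x a \<in> carrier (mgrp S (p + q))"
  using gm.mact_right hom_in_carrier by metis

lemma S_act_one: "a \<in> carrier (rgrp HA q) \<Longrightarrow> mact S p q \<one>\<^bsub>mgrp S p\<^esub> a = \<one>\<^bsub>mgrp S (p + q)\<^esub>"
  using hom_one_comm[OF gm.mgrp gm.mgrp gm.mact_left] .

lemma cz_in: "\<alpha> \<in> Z0 \<Longrightarrow> cz \<alpha> \<in> carrier (rgrp HA 0)"
  by (elim Z0_rep) (simp add: cz_acl HA_carrier)

lemma act0_in: "\<alpha> \<in> Z0 \<Longrightarrow> act0 \<alpha> \<in> carrier (mgrp S n)"
  using S_act[OF s0 cz_in] by (simp add: act0_def)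

lemma act0_surj: assumes "x \<in> carrier (mgrp S n)" obtains \<alpha> where "\<alpha> \<in> Z0" "act0 \<alpha> = x"
proof -
  obtain r where r: "r \<in> carrier (rgrp HA 0)" "x = mact S n 0 s0 r" using s0_gen[OF assms] by blast
  then obtain a where a: "a \<in> acoc 0" "r = acl 0 a" by (auto simp: HA_carrier)
  then have "\<epsilon> 0 a \<in> Z0" "act0 (\<epsilon> 0 a) = x" using r by (simp_all add: act0_def cz_acl) (simp add: acoc_iff)
  then show ?thesis by (rule that)
qed

lemma act0_add:
  assumes "\<alpha> \<in> Z0" "\<beta> \<in> Z0" shows "act0 (\<alpha> + \<beta>) = act0 \<alpha> \<otimes>\<^bsub>mgrp S n\<^esub> act0 \<beta>"
proof -
  obtain a where a: "a \<in> acoc 0" "\<alpha> = \<epsilon> 0 a" using assms(1) by (rule Z0_rep)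
  obtain b where b: "b \<in> acoc 0" "\<beta> = \<epsilon> 0 b" using assms(2) by (rule Z0_rep)
  have ab: "a \<in> carrier (rgrp A 0)" "b \<in> carrier (rgrp A 0)" using a b by (simp_all add: acoc_iff)
  have "\<alpha> + \<beta> = \<epsilon> 0 (a \<otimes>\<^bsub>rgrp A 0\<^esub> b)" using emb_add[OF rgrp ab] a b by simp
  then have "cz (\<alpha> + \<beta>) = cz \<alpha> \<otimes>\<^bsub>rgrp HA 0\<^esub> cz \<beta>"
    using cz_acl[OF acoc_closed(1)[OF a(1) b(1)]] a b S.H_mult[of a 0 b] by (simp add: cz_acl cohomology_ring_grp)
  then show ?thesis
    using hom_mult[OF gm.mact_right[OF s0, of 0] cz_in[OF assms(1)] cz_in[OF assms(2)]] by (simp add: act0_def)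
qed

lemma act0_mult:
  assumes "\<alpha> \<in> Z0" "\<beta> \<in> Z0" shows "act0 (am (AA A) \<alpha> \<beta>) = mact S n 0 (act0 \<alpha>) (cz \<beta>)"
proof -
  obtain a where a: "a \<in> acoc 0" "\<alpha> = \<epsilon> 0 a" using assms(1) by (rule Z0_rep)
  obtain b where b: "b \<in> acoc 0" "\<beta> = \<epsilon> 0 b" using assms(2) by (rule Z0_rep)
  have ab: "a \<in> carrier (rgrp A 0)" "b \<in> carrier (rgrp A 0)" using a b by (simp_all add: acoc_iff)
  have "am (AA A) \<alpha> \<beta> = \<epsilon> 0 (rmul A 0 0 a b)" using AA_simps(3)[OF ab] a b by simp
  then have "cz (am (AA A) \<alpha> \<beta>) = rmul HA 0 0 (cz \<alpha>) (cz \<beta>)"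
    using cz_acl[OF acoc_closed(4)[OF a(1) b(1)]] a b S.H_act(2)[of a 0 b 0] by (simp add: cz_acl cohomology_ring_act)
  then show ?thesis using gm.mact_assoc[OF s0 cz_in[OF assms(1)] cz_in[OF assms(2)]] by (simp add: act0_def)
qed

lemma act0_bdy: assumes "\<alpha> \<in> B0" shows "act0 \<alpha> = \<one>\<^bsub>mgrp S n\<^esub>"
proof -
  obtain a where a: "a \<in> acoc 0" "\<alpha> = \<epsilon> 0 a" using S.M.bdy_cyc[OF assms] by (rule Z0_rep)
  then have "acl 0 a = acl 0 \<one>\<^bsub>rgrp A 0\<^esub>" using acl_eq0[OF a(1) acoc_closed(2)] assms emb_one[OF rgrp, of 0 0] by simp
  then have "cz \<alpha> = \<one>\<^bsub>rgrp HA 0\<^esub>" using a S.H_one[of 0] by (simp add: cz_acl cohomology_ring_grp)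
  then show ?thesis using hom_one_comm[OF gm.rgrp gm.mgrp gm.mact_right[OF s0], of 0] by (simp add: act0_def)
qed

lemma act0_eq: assumes "\<alpha> \<in> Z0" "\<beta> \<in> Z0" shows "act0 \<alpha> = act0 \<beta> \<longleftrightarrow> \<alpha> - \<beta> \<in> I"
proof -
  interpret G: comm_group "mgrp S n" by (rule gm.mgrp)
  have d: "\<alpha> - \<beta> \<in> Z0" using S.M.cyc_diff assms by blast
  have "act0 \<alpha> = act0 (\<alpha> - \<beta>) \<otimes>\<^bsub>mgrp S n\<^esub> act0 \<beta>" using act0_add[OF d assms(2)] by simp
  then show ?thesis
    using d act0_in[OF d] act0_in[OF assms(2)] by (auto simp: I_def)
qed

lemma I_diff: assumes "\<alpha> \<in> I" "\<beta> \<in> I" shows "\<alpha> - \<beta> \<in> I"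
  using act0_eq[of \<alpha> \<beta>] assms by (simp add: I_def)

lemma I_Z0: "\<alpha> \<in> I \<Longrightarrow> \<alpha> \<in> Z0" and B0_I: "\<alpha> \<in> B0 \<Longrightarrow> \<alpha> \<in> I"
  using act0_bdy S.M.bdy_cyc by (auto simp: I_def)

lemma I_mult: assumes "\<alpha> \<in> I" "\<beta> \<in> Z0" shows "am (AA A) \<alpha> \<beta> \<in> I"
  using act0_mult[OF I_Z0[OF assms(1)] assms(2)] assms Z0_mult[OF I_Z0[OF assms(1)] assms(2)]
    S_act_one[OF cz_in[OF assms(2)], of n] by (simp add: I_def)

lemma Z0_ac: "\<alpha> \<in> Z0 \<Longrightarrow> \<alpha> \<in> ac (AA A) 0"
  by (auto simp: cyc_def)

text \<open>Semisimplicity splits the projection Z0/B0 -> Z0/I by a right linear section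
  \<open>s\<close>, and e = s 1. Modulo \<open>B0\<close>, linearity gives s \<alpha> = e \<alpha>,
  so \<open>e\<close> kills \<open>I\<close>; as e - 1 lies in \<open>I\<close>, also e (e - 1) =
  0.\<close>

lemma idempotent:
  obtains e where "e \<in> Z0" "e - am (AA A) e e \<in> B0" "au (AA A) - e \<in> I"
    "\<And>\<alpha>. \<alpha> \<in> Z0 \<Longrightarrow> am (AA A) e \<alpha> \<in> B0 \<longleftrightarrow> \<alpha> \<in> I"
proof -
  obtain c :: "'a ambient \<Rightarrow> 'u" where "inj_on c (\<Union>p. ac (AA A) p)" using small_AA unfolding lepoll_def by blast
  then have c: "inj_on c Z0" by (rule inj_on_subset) (auto simp: cyc_def)
  have sq1: "subquotient K A (self (AA A)) 0 Z0 B0 c"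
    by (intro subquotient.intro subquotient_axioms.intro dg_algebra_axioms S.M.mdl_axioms S.M.subquot_cohomology AA.dga_axioms c)
  have "subquot (AA A) (self (AA A)) 0 Z0 I"
    using I_Z0 B0_I[OF S.M.bdy_zero] S.M.cyc_diff I_diff Z0_mult I_mult B0_I S.M.act_bdy[OF AA.dga_axioms, of _ 0 _ 0] Z0_ac
    by (auto simp: subquot_def)
  then have sq2: "subquotient K A (self (AA A)) 0 Z0 I c"
    by (intro subquotient.intro subquotient_axioms.intro dg_algebra_axioms S.M.mdl_axioms c)
  obtain s where s: "\<And>y. y \<in> Z0 \<Longrightarrow> s y \<in> Z0" "\<And>y. y \<in> Z0 \<Longrightarrow> s y - y \<in> I" "\<And>y. y \<in> I \<Longrightarrow> s y \<in> B0"
    "\<And>y a. y \<in> Z0 \<Longrightarrow> a \<in> Z0 \<Longrightarrow> s (am (AA A) y a) - am (AA A) (s y) a \<in> B0"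
  proof (rule semisimple_section[OF semisimple sq1 sq2, where f = "\<lambda>x. x"])
    show "\<exists>x\<in>Z0. x - y \<in> I" if "y \<in> Z0" for y using that B0_I[OF S.M.bdy_zero] by (intro bexI[of _ y]) simp_all
  qed (use B0_I in auto)
  define e where "e = s (au (AA A))"
  have e: "e \<in> Z0" and e1: "e - au (AA A) \<in> I" using s(1,2)[OF Z0_unit] by (simp_all add: e_def)
  have se: "s \<alpha> - am (AA A) e \<alpha> \<in> B0" if "\<alpha> \<in> Z0" for \<alpha>
    using s(4)[OF Z0_unit that] AA.unit_left[OF Z0_ac[OF that]] by (simp add: e_def)
  have I_e: "am (AA A) e \<alpha> \<in> B0" if "\<alpha> \<in> I" for \<alpha>
    using S.M.bdy_diff[OF s(3)[OF that] se[OF I_Z0[OF that]]] by simp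
  have "am (AA A) e (e - au (AA A)) = am (AA A) e e - e"
    using S.M.act_diffr[OF AA.dga_axioms, of e 0 e 0 "au (AA A)"] S.M.act_unit[of e 0] e Z0_unit Z0_ac by simp
  then have "am (AA A) e e - e \<in> B0" using I_e[OF e1] by simp
  then have "e - am (AA A) e e \<in> B0" using S.M.bdy_neg by fastforce
  moreover have "au (AA A) - e \<in> I" using I_diff[OF B0_I[OF S.M.bdy_zero] e1] by simp
  moreover have "am (AA A) e \<alpha> \<in> B0 \<longleftrightarrow> \<alpha> \<in> I" if \<alpha>: "\<alpha> \<in> Z0" for \<alpha>
  proof
    assume "am (AA A) e \<alpha> \<in> B0"
    \<comment> \<open>Here \<alpha> is written as e \<alpha> - (e - 1) \<alpha>, and both terms lie
      in the right ideal \<open>I\<close>.\<close>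
    then have "am (AA A) e \<alpha> - am (AA A) (e - au (AA A)) \<alpha> \<in> I" by (intro I_diff B0_I I_mult e1 \<alpha>)
    moreover have "am (AA A) (e - au (AA A)) \<alpha> = am (AA A) e \<alpha> - \<alpha>"
      using S.M.act_diffl[of e 0 "au (AA A)" \<alpha> 0] AA.unit_left[OF Z0_ac[OF \<alpha>]] e Z0_unit \<alpha> Z0_ac by simp
    ultimately show "\<alpha> \<in> I" by simp
  qed (rule I_e)
  ultimately show ?thesis using that e by blast
qed

text \<open>An isomorphism from the cohomology of \<open>M\<close> to \<open>S\<close> taking the
  class of \<open>u\<close> to \<open>s0\<close>, expressed by cocycles: the class generates and is
  annihilated exactly by \<open>I\<close>. In this form two realisations are compared by moving one
  generator.\<close>

definition realizes :: "('a ambient, 'm::ab_group_add) mdl \<Rightarrow> 'm \<Rightarrow> bool"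
  where "realizes M u \<longleftrightarrow> u \<in> cyc M n \<and> (\<forall>p. p \<noteq> n \<longrightarrow> cyc M p \<subseteq> bdy M p) \<and>
    (\<forall>c\<in>cyc M n. \<exists>\<alpha>\<in>Z0. c - ma M u \<alpha> \<in> bdy M n) \<and>
    (\<forall>\<alpha>\<in>Z0. ma M u \<alpha> \<in> bdy M n \<longleftrightarrow> \<alpha> \<in> I)"

text \<open>In degree \<open>n\<close> the isomorphism sends the class of u \<alpha> to s0 \<alpha>;
  it is well defined and injective because both vanish exactly for \<alpha> in
  \<open>I\<close>.\<close>

lemma realizes_iso:
  assumes "dg_rep K A X M \<phi>" and r: "realizes M u"
  shows "graded_iso HA (cohomology_module X) S"
proof -
  interpret X: dg_rep K A X M \<phi> by fact
  have u: "u \<in> cyc M n" and triv: "\<And>p. p \<noteq> n \<Longrightarrow> cyc M p \<subseteq> bdy M p"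
    and gen: "\<And>c. c \<in> cyc M n \<Longrightarrow> \<exists>\<alpha>\<in>Z0. c - ma M u \<alpha> \<in> bdy M n"
    and ann: "\<And>\<alpha>. \<alpha> \<in> Z0 \<Longrightarrow> ma M u \<alpha> \<in> bdy M n \<longleftrightarrow> \<alpha> \<in> I"
    using r by (auto simp: realizes_def)
  have u_cyc: "ma M u \<alpha> \<in> cyc M n" if "\<alpha> \<in> Z0" for \<alpha>
    using X.M.cyc_act[OF AA.dga_axioms u that] by simp
  define xx where "xx = (\<lambda>\<alpha>. inv_into (carrier (mgrp X n)) (\<phi> n) (ma M u \<alpha>))"
  have xx: "xx \<alpha> \<in> X.coc n" "\<phi> n (xx \<alpha>) = ma M u \<alpha>" if "\<alpha> \<in> Z0" for \<alpha>
  proof -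
    have "ma M u \<alpha> \<in> \<phi> n ` carrier (mgrp X n)" using X.bij[of n] cyc_mc[OF u_cyc[OF that]] by (simp add: bij_betw_def)
    then show "\<phi> n (xx \<alpha>) = ma M u \<alpha>" "xx \<alpha> \<in> X.coc n"
      using u_cyc[OF that] by (simp_all add: xx_def f_inv_into_f inv_into_into X.coc_iff)
  qed
  have xc: "xx \<alpha> \<in> carrier (mgrp X n)" if "\<alpha> \<in> Z0" for \<alpha> using xx[OF that] X.coc_carrier by blast
  define uc where "uc = (\<lambda>\<alpha>. X.cl n (xx \<alpha>))"
  have uc_eq: "uc \<alpha> = uc \<beta> \<longleftrightarrow> act0 \<alpha> = act0 \<beta>" if "\<alpha> \<in> Z0" "\<beta> \<in> Z0" for \<alpha> \<beta>
  proof -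
    have "ma M u \<alpha> - ma M u \<beta> = ma M u (\<alpha> - \<beta>)"
      using X.M.act_diffr[OF AA.dga_axioms cyc_mc[OF u] Z0_ac Z0_ac] that by simp
    then show ?thesis
      using X.cl_eq[OF xc[OF that(1)] xc[OF that(2)]] xx(2) that ann[OF S.M.cyc_diff[OF that]] act0_eq[OF that] by (simp add: uc_def)
  qed
  have uc_in: "uc \<alpha> \<in> carrier (X.H n)" if "\<alpha> \<in> Z0" for \<alpha> using xx(1)[OF that] by (simp add: uc_def X.H_carrier)
  have uc_surj: "\<exists>\<alpha>\<in>Z0. C = uc \<alpha>" if C: "C \<in> carrier (X.H n)" for C
  proof -
    obtain z where z: "z \<in> X.coc n" "C = X.cl n z" using C by (auto simp: X.H_carrier)
    then obtain \<alpha> where \<alpha>: "\<alpha> \<in> Z0" "\<phi> n z - ma M u \<alpha> \<in> bdy M n" using gen by (auto simp: X.coc_iff)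
    then show ?thesis using X.cl_eq[OF X.coc_carrier[OF z(1)] xc[OF \<alpha>(1)]] xx(2)[OF \<alpha>(1)] z(2) by (auto simp: uc_def)
  qed
  have uc_add: "uc \<alpha> \<otimes>\<^bsub>X.H n\<^esub> uc \<beta> = uc (\<alpha> + \<beta>)" if "\<alpha> \<in> Z0" "\<beta> \<in> Z0" for \<alpha> \<beta>
  proof -
    have s: "\<alpha> + \<beta> \<in> Z0" using S.M.cyc_add that by blast
    have "\<phi> n (xx \<alpha> \<otimes>\<^bsub>mgrp X n\<^esub> xx \<beta>) = \<phi> n (xx (\<alpha> + \<beta>))"
      using X.\<phi>_add[OF xc[OF that(1)] xc[OF that(2)]] xx(2)[OF s] xx(2) that X.M.act_addr[OF cyc_mc[OF u] Z0_ac Z0_ac] by simp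
    then show ?thesis
      using X.H_mult[OF xx(1)[OF that(1)] xx(1)[OF that(2)]] X.\<phi>_eq[OF X.X_closed(2)[OF xc[OF that(1)] xc[OF that(2)]] xc[OF s]]
      by (simp add: uc_def)
  qed
  have uc_act: "mact (cohomology_module X) n 0 (uc \<alpha>) (cz \<beta>) = uc (am (AA A) \<alpha> \<beta>)" if "\<alpha> \<in> Z0" and \<beta>: "\<beta> \<in> Z0" for \<alpha> \<beta>
  proof -
    obtain b where b: "b \<in> acoc 0" "\<beta> = \<epsilon> 0 b" using \<beta> by (rule Z0_rep)
    have b': "b \<in> carrier (rgrp A 0)" using b by (simp add: acoc_iff)
    note s = Z0_mult[OF that]
    have "\<phi> n (mact X n 0 (xx \<alpha>) b) = \<phi> n (xx (am (AA A) \<alpha> \<beta>))"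
      using X.\<phi>_act[OF xc[OF that(1)] b'] xx(2)[OF s] xx(2)[OF that(1)] b(2) X.M.act_act[OF cyc_mc[OF u] Z0_ac[OF that(1)] Z0_ac[OF that(2)]]
      by simp
    then have "mact X n 0 (xx \<alpha>) b = xx (am (AA A) \<alpha> \<beta>)"
      using X.\<phi>_eq[OF _ xc[OF s], of "mact X n 0 (xx \<alpha>) b"] X.X.mact_closed[OF xc[OF that(1)] b'] by simp
    then show ?thesis using X.H_act(2)[OF xx(1)[OF that(1)] b(1)] by (simp add: uc_def b(2) cz_acl[OF b(1)])
  qed
  define f where "f = (\<lambda>p C. if p = n then act0 (SOME \<alpha>. \<alpha> \<in> Z0 \<and> C = uc \<alpha>) else \<one>\<^bsub>mgrp S p\<^esub>)"
  have f_uc: "f n (uc \<alpha>) = act0 \<alpha>" if "\<alpha> \<in> Z0" for \<alpha>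
  proof -
    have "\<exists>\<beta>. \<beta> \<in> Z0 \<and> uc \<alpha> = uc \<beta>" using that by blast
    from someI_ex[OF this] have \<beta>: "(SOME \<beta>. \<beta> \<in> Z0 \<and> uc \<alpha> = uc \<beta>) \<in> Z0" "uc \<alpha> = uc (SOME \<beta>. \<beta> \<in> Z0 \<and> uc \<alpha> = uc \<beta>)"
      by blast+
    show ?thesis using uc_eq[OF that \<beta>(1)] \<beta>(2) by (simp only: f_def if_True simp_thms)
  qed
  have f_other: "f p C = \<one>\<^bsub>mgrp S p\<^esub>" if "p \<noteq> n" for p C using that by (simp add: f_def)
  have Htriv: "carrier (X.H p) = {\<one>\<^bsub>X.H p\<^esub>}" if "p \<noteq> n" for p using X.H_triv triv[OF that] by simp
  have grp_simps: "mgrp (cohomology_module X) = X.H" by (simp add: cohomology_module_def)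
  have f_in: "f p C \<in> carrier (mgrp S p)" if "C \<in> carrier (X.H p)" for p C
  proof (cases "p = n")
    case True
    then obtain \<alpha> where "\<alpha> \<in> Z0" "C = uc \<alpha>" using uc_surj \<open>C \<in> _\<close> by blast
    then show ?thesis using f_uc act0_in True by simp
  next
    case False
    then show ?thesis using f_other comm_group_simps(1)[OF gm.mgrp, of p] by simp
  qed
  have f_one: "f n \<one>\<^bsub>X.H n\<^esub> = \<one>\<^bsub>mgrp S n\<^esub>"
  proof -
    have "X.cl n \<one>\<^bsub>mgrp X n\<^esub> = uc 0"
      using X.cl_eq[OF X.X_closed(1) xc[OF S.M.cyc_zero]] xx(2)[OF S.M.cyc_zero] X.M.act_zeror[OF AA.dga_axioms cyc_mc[OF u]]
      by (simp add: uc_def X.\<phi>_one X.M.bdy_zero)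
    then show ?thesis using f_uc[OF S.M.cyc_zero] act0_bdy[OF S.M.bdy_zero] by (simp add: X.H_one)
  qed
  show ?thesis
    unfolding graded_iso_def grp_simps
  proof (intro exI[of _ f] conjI allI ballI)
    fix p
    show "f p \<in> iso (X.H p) (mgrp S p)"
    proof (cases "p = n")
      case True
      have "f n \<in> hom (X.H n) (mgrp S n)"
      proof (rule homI)
        fix C assume C: "C \<in> carrier (X.H n)"
        show "f n C \<in> carrier (mgrp S n)" by (rule f_in[OF C])
        fix D assume "D \<in> carrier (X.H n)"
        then obtain \<alpha> \<beta> where "\<alpha> \<in> Z0" "C = uc \<alpha>" "\<beta> \<in> Z0" "D = uc \<beta>" using C uc_surj by metis
        then show "f n (C \<otimes>\<^bsub>X.H n\<^esub> D) = f n C \<otimes>\<^bsub>mgrp S n\<^esub> f n D"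
          using f_uc uc_add act0_add S.M.cyc_add by simp
      qed
      moreover have "inj_on (f n) (carrier (X.H n))"
        by (rule inj_onI) (metis f_uc uc_surj uc_eq)
      moreover have "f n ` carrier (X.H n) = carrier (mgrp S n)"
      proof
        show "f n ` carrier (X.H n) \<subseteq> carrier (mgrp S n)" using f_in by blast
        show "carrier (mgrp S n) \<subseteq> f n ` carrier (X.H n)"
        proof
          fix x assume "x \<in> carrier (mgrp S n)"
          then obtain \<alpha> where "\<alpha> \<in> Z0" "act0 \<alpha> = x" by (rule act0_surj)
          then show "x \<in> f n ` carrier (X.H n)" using uc_in f_uc by (metis imageI)
        qed
      qed
      ultimately show ?thesis using True by (simp add: iso_def bij_betw_def)
    next
      case False
      have "\<one>\<^bsub>mgrp S p\<^esub> = \<one>\<^bsub>mgrp S p\<^esub> \<otimes>\<^bsub>mgrp S p\<^esub> \<one>\<^bsub>mgrp S p\<^esub>"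
        using comm_group_simps(4)[OF gm.mgrp comm_group_simps(1)[OF gm.mgrp], of p] by simp
      then show ?thesis
        using Htriv[OF False] conc[OF False] f_other[OF False] by (auto simp: iso_def hom_def bij_betw_def)
    qed
    fix q C B assume C: "C \<in> carrier (X.H p)" and B: "B \<in> carrier (rgrp HA q)"
    show "f (p + q) (mact (cohomology_module X) p q C B) = mact S p q (f p C) B"
    proof (cases "p + q = n")
      case False
      then show ?thesis using S_act[OF f_in[OF C] B] conc[OF False] f_other[OF False] by simp
    next
      case True
      show ?thesis
      proof (cases "p = n")
        case p: True
        then have q: "q = 0" using True by simp
        obtain \<alpha> where \<alpha>: "\<alpha> \<in> Z0" "C = uc \<alpha>" using C p uc_surj by blast
        obtain b where b: "b \<in> acoc 0" "B = acl 0 b" using B q by (auto simp: HA_carrier)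
        have \<beta>: "\<epsilon> 0 b \<in> Z0" using b by (simp add: acoc_iff)
        have B: "B = cz (\<epsilon> 0 b)" using b cz_acl by simp
        show ?thesis
          using uc_act[OF \<alpha>(1) \<beta>] f_uc[OF Z0_mult[OF \<alpha>(1) \<beta>]] act0_mult[OF \<alpha>(1) \<beta>] f_uc[OF \<alpha>(1)] p q \<alpha>(2) B by simp
      next
        case False
        \<comment> \<open>Outside degree \<open>n\<close> the class is zero, so both sides are
          neutral although the target degree is \<open>n\<close>.\<close>
        then have "C = X.cl p \<one>\<^bsub>mgrp X p\<^esub>" using C Htriv[OF False] X.H_one by auto
        moreover obtain b where b: "b \<in> acoc q" "B = acl q b" using B by (auto simp: HA_carrier)
        ultimately have "mact (cohomology_module X) p q C B = \<one>\<^bsub>X.H n\<^esub>"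
          using X.H_act(2)[OF X.coc_one b(1)] X.X.mact_one_left[of b q p] b True S.coc_carrier[of b q] by (simp add: X.H_one)
        then show ?thesis using f_one f_other[OF False] S_act_one[OF B, of p] True by simp
      qed
    qed
  qed
qed

text \<open>A representative of the class corresponding to \<open>s0\<close> serves as generator;
  its properties are those of \<open>s0\<close>, carried back along the isomorphism.\<close>

lemma iso_realizes:
  assumes "dg_rep K A X M \<phi>" and "graded_iso HA (cohomology_module X) S"
  obtains u where "realizes M u"
proof -
  interpret X: dg_rep K A X M \<phi> by fact
  have grp_simps: "mgrp (cohomology_module X) = X.H" by (simp add: cohomology_module_def)
  obtain f where f: "\<And>p. f p \<in> iso (X.H p) (mgrp S p)"
    and lin: "\<And>p q C B. C \<in> carrier (X.H p) \<Longrightarrow> B \<in> carrier (rgrp HA q) \<Longrightarrow>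
      f (p + q) (mact (cohomology_module X) p q C B) = mact S p q (f p C) B"
    using assms(2) unfolding graded_iso_def grp_simps by blast
  have bij: "bij_betw (f p) (carrier (X.H p)) (carrier (mgrp S p))" for p using f[of p] by (simp add: iso_def)
  have f_eq: "f p C = f p D \<longleftrightarrow> C = D" if "C \<in> carrier (X.H p)" "D \<in> carrier (X.H p)" for p C D
    using bij[of p] that by (auto simp: bij_betw_def inj_on_def)
  have f_one: "f p \<one>\<^bsub>X.H p\<^esub> = \<one>\<^bsub>mgrp S p\<^esub>" for p
    using hom_one_comm[OF X.H_comm_group gm.mgrp] f[of p] by (simp add: iso_def)
  have "s0 \<in> f n ` carrier (X.H n)" using bij[of n] s0 by (simp add: bij_betw_def)
  then obtain t where t: "t \<in> X.coc n" "f n (X.cl n t) = s0" unfolding X.H_carrier by blast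
  have t': "t \<in> carrier (mgrp X n)" using t X.coc_carrier by blast
  let ?u = "\<phi> n t"
  have H_one_in: "\<one>\<^bsub>X.H p\<^esub> \<in> carrier (X.H p)" for p by (rule comm_group_simps(1)[OF X.H_comm_group])
  have act: "f n (X.cl n (mact X n 0 t a)) = act0 (\<epsilon> 0 a)" "mact X n 0 t a \<in> X.coc n"
    "\<phi> n (mact X n 0 t a) = ma M ?u (\<epsilon> 0 a)" if a: "a \<in> acoc 0" for a
  proof -
    have "acl 0 a \<in> carrier (rgrp HA 0)" using a by (simp add: HA_carrier)
    then show "f n (X.cl n (mact X n 0 t a)) = act0 (\<epsilon> 0 a)"
      using X.H_act(2)[OF t(1) a] lin[of "X.cl n t" n "acl 0 a" 0] t by (simp add: X.H_carrier act0_def cz_acl[OF a])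
    show "mact X n 0 t a \<in> X.coc n" using X.H_act(1)[OF t(1) a] by simp
    show "\<phi> n (mact X n 0 t a) = ma M ?u (\<epsilon> 0 a)" using X.\<phi>_act[OF t', of a 0] a by (simp add: acoc_iff)
  qed
  have "realizes M ?u"
    unfolding realizes_def
  proof (intro conjI allI impI ballI)
    show "?u \<in> cyc M n" using t by (simp add: X.coc_iff)
    show "cyc M p \<subseteq> bdy M p" if "p \<noteq> n" for p
    proof -
      have "C = \<one>\<^bsub>X.H p\<^esub>" if C: "C \<in> carrier (X.H p)" for C
        using bij_betwE[OF bij] C conc[OF \<open>p \<noteq> n\<close>] f_one f_eq[OF C H_one_in] by fastforce
      then show ?thesis using X.H_triv H_one_in by blast
    qed
    show "\<exists>\<alpha>\<in>Z0. c - ma M ?u \<alpha> \<in> bdy M n" if c: "c \<in> cyc M n" for c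
    proof -
      obtain z where z: "z \<in> carrier (mgrp X n)" "c = \<phi> n z" using X.\<phi>_surj cyc_mc[OF c] by blast
      then have zc: "z \<in> X.coc n" using c by (simp add: X.coc_iff)
      then have "X.cl n z \<in> carrier (X.H n)" by (simp add: X.H_carrier)
      then have "f n (X.cl n z) \<in> carrier (mgrp S n)" using bij_betwE[OF bij] by blast
      then obtain \<alpha> where \<alpha>: "\<alpha> \<in> Z0" "act0 \<alpha> = f n (X.cl n z)" by (rule act0_surj)
      obtain a where a: "a \<in> acoc 0" "\<alpha> = \<epsilon> 0 a" using \<alpha>(1) by (rule Z0_rep)
      have "X.cl n z = X.cl n (mact X n 0 t a)"
        using f_eq[of "X.cl n z" n "X.cl n (mact X n 0 t a)"] act[OF a(1)] zc \<alpha>(2) a(2) by (simp add: X.H_carrier)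
      then have "\<phi> n z - ma M ?u \<alpha> \<in> bdy M n"
        using X.cl_eq[OF z(1) X.coc_carrier[OF act(2)[OF a(1)]]] act(3)[OF a(1)] a(2) by simp
      then show ?thesis using \<alpha>(1) z(2) by blast
    qed
    fix \<alpha> assume \<alpha>: "\<alpha> \<in> Z0"
    obtain a where a: "a \<in> acoc 0" "\<alpha> = \<epsilon> 0 a" using \<alpha> by (rule Z0_rep)
    have "ma M ?u \<alpha> \<in> bdy M n \<longleftrightarrow> X.cl n (mact X n 0 t a) = \<one>\<^bsub>X.H n\<^esub>"
      using X.cl_eq[OF X.coc_carrier[OF act(2)[OF a(1)]] X.X_closed(1)] act(3)[OF a(1)] a(2) by (simp add: X.H_one X.\<phi>_one)
    also have "\<dots> \<longleftrightarrow> act0 \<alpha> = \<one>\<^bsub>mgrp S n\<^esub>"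
      using f_eq[OF _ H_one_in, of "X.cl n (mact X n 0 t a)" n] f_one[of n] act[OF a(1)] a(2) by (simp add: X.H_carrier)
    finally show "ma M ?u \<alpha> \<in> bdy M n \<longleftrightarrow> \<alpha> \<in> I" using \<alpha> by (simp add: I_def)
  qed
  then show ?thesis by (rule that)
qed

text \<open>Modulo boundaries \<open>F\<close> sends u \<alpha> to t \<alpha>, since F u and t are
  cohomologous. Both generators have the annihilator \<open>I\<close>, so \<open>F\<close> is
  bijective on cohomology in degree \<open>n\<close>; elsewhere both sides vanish.\<close>

lemma realizes_quasi_iso:
  fixes X Y :: "('a, 'v) dg_module"
  assumes "dg_rep K A X M \<phi>" "dg_rep K A Y N \<psi>" and M: "realizes M u" and N: "realizes N t"
    and F: "cmap (AA A) M N 0 F" and Fu: "F u - t \<in> bdy N n"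
  shows "\<exists>s. quasi_iso A X Y s"
proof -
  interpret X: dg_rep K A X M \<phi> by fact
  interpret Y: dg_rep K A Y N \<psi> by fact
  define f where "f = (\<lambda>p x. inv_into (carrier (mgrp Y p)) (\<psi> p) (F (\<phi> p x)))"
  have f: "f p x \<in> carrier (mgrp Y p)" "\<psi> p (f p x) = F (\<phi> p x)" if "x \<in> carrier (mgrp X p)" for p x
  proof -
    have "F (\<phi> p x) \<in> \<psi> p ` carrier (mgrp Y p)"
      using Y.bij[of p] lmap_in0[OF cmap_lmap[OF F] X.\<phi>_in[OF that]] by (simp add: bij_betw_def)
    then show "f p x \<in> carrier (mgrp Y p)" "\<psi> p (f p x) = F (\<phi> p x)"
      by (simp_all add: f_def f_inv_into_f inv_into_into)
  qed
  have f_hom: "f p \<in> hom (mgrp X p) (mgrp Y p)" for p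
  proof (rule homI)
    fix x y assume x: "x \<in> carrier (mgrp X p)" and y: "y \<in> carrier (mgrp X p)"
    have "\<psi> p (f p (x \<otimes>\<^bsub>mgrp X p\<^esub> y)) = \<psi> p (f p x \<otimes>\<^bsub>mgrp Y p\<^esub> f p y)"
      using f(2)[OF X.X_closed(2)[OF x y]] f[OF x] f[OF y] X.\<phi>_add[OF x y] Y.\<phi>_add lmap_add[OF cmap_lmap[OF F] X.\<phi>_in[OF x] X.\<phi>_in[OF y]]
      by simp
    then show "f p (x \<otimes>\<^bsub>mgrp X p\<^esub> y) = f p x \<otimes>\<^bsub>mgrp Y p\<^esub> f p y"
      using Y.\<phi>_eq[OF f(1)[OF X.X_closed(2)[OF x y]] Y.X_closed(2)[OF f(1)[OF x] f(1)[OF y]]] by blast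
  qed (rule f(1))
  have "f (p + q) (mact X p q x a) = mact Y p q (f p x) a" if x: "x \<in> carrier (mgrp X p)" and a: "a \<in> carrier (rgrp A q)" for p q x a
  proof -
    have "\<epsilon> q a \<in> ac (AA A) q" using a by (simp add: AA_simps)
    then have "\<psi> (p + q) (f (p + q) (mact X p q x a)) = \<psi> (p + q) (mact Y p q (f p x) a)"
      using f(2)[OF X.X.mact_closed[OF x a]] X.\<phi>_act[OF x a] Y.\<phi>_act[OF f(1)[OF x] a] f(2)[OF x]
        lmap_act[OF cmap_lmap[OF F] X.\<phi>_in[OF x]] by simp
    then show ?thesis using Y.\<phi>_eq[OF f(1)[OF X.X.mact_closed[OF x a]] Y.X.mact_closed[OF f(1)[OF x] a]] by blast
  qed
  moreover have "f (p + 1) (mdiff X p x) = mdiff Y p (f p x)" if x: "x \<in> carrier (mgrp X p)" for p x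
  proof -
    have "\<psi> (p + 1) (f (p + 1) (mdiff X p x)) = \<psi> (p + 1) (mdiff Y p (f p x))"
      using f(2)[OF X.X.mdiff_closed[OF x]] X.\<phi>_d[OF x] Y.\<phi>_d[OF f(1)[OF x]] f(2)[OF x] cmap_d0[OF F X.\<phi>_in[OF x]] by simp
    then show ?thesis using Y.\<phi>_eq[OF f(1)[OF X.X.mdiff_closed[OF x]] Y.X.mdiff_closed[OF f(1)[OF x]]] by blast
  qed
  ultimately have hom: "dg_hom A X Y f"
    using f_hom X.X.dg_module_axioms Y.X.dg_module_axioms by (auto simp: dg_hom_def)
  have f_coc: "f p x \<in> Y.coc p" if "x \<in> X.coc p" for p x
    using that f[of x p] cmap_cyc0[OF X.M.mdl_axioms Y.M.mdl_axioms F] by (auto simp: X.coc_iff Y.coc_iff)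
  have map_cl: "cohomology_map Y f p (X.cl p x) = Y.cl p (f p x)" if x: "x \<in> X.coc p" for p x
  proof -
    have x': "x \<in> carrier (mgrp X p)" using x X.coc_carrier by blast
    have eq: "Y.cl p (f p y) = Y.cl p (f p x)" if "y \<in> X.cl p x" for y
    proof -
      have y: "y \<in> carrier (mgrp X p)" "\<phi> p y - \<phi> p x \<in> bdy M p" using that X.cl_iff[OF x'] by auto
      have "F (\<phi> p y) - F (\<phi> p x) \<in> bdy N p"
        using cmap_bdy0[OF X.M.mdl_axioms Y.M.mdl_axioms F y(2)]
          lmap_diff[OF X.M.mdl_axioms Y.M.mdl_axioms cmap_lmap[OF F] X.\<phi>_in[OF y(1)] X.\<phi>_in[OF x']] by simp
      then show ?thesis using Y.cl_eq[OF f(1)[OF y(1)] f(1)[OF x']] f(2) y(1) x' by simp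
    qed
    have "x \<in> X.cl p x" by (rule X.cl_self[OF x'])
    then show ?thesis unfolding cohomology_map_def using eq by blast
  qed
  let ?h = "cohomology_map Y f"
  have h_hom: "?h p \<in> hom (X.H p) (Y.H p)" for p
  proof (rule homI)
    fix C assume "C \<in> carrier (X.H p)"
    then obtain x where x: "x \<in> X.coc p" "C = X.cl p x" by (auto simp: X.H_carrier)
    show "?h p C \<in> carrier (Y.H p)" using x f_coc by (simp add: map_cl Y.H_carrier)
    fix D assume "D \<in> carrier (X.H p)"
    then obtain y where y: "y \<in> X.coc p" "D = X.cl p y" by (auto simp: X.H_carrier)
    show "?h p (C \<otimes>\<^bsub>X.H p\<^esub> D) = ?h p C \<otimes>\<^bsub>Y.H p\<^esub> ?h p D"
      using x y f_coc hom_mult[OF f_hom X.coc_carrier[OF x(1)] X.coc_carrier[OF y(1)]]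
      by (simp add: X.H_mult Y.H_mult map_cl X.coc_mult)
  qed
  have u: "u \<in> cyc M n" and M_triv: "\<And>p. p \<noteq> n \<Longrightarrow> cyc M p \<subseteq> bdy M p"
    and M_gen: "\<And>c. c \<in> cyc M n \<Longrightarrow> \<exists>\<alpha>\<in>Z0. c - ma M u \<alpha> \<in> bdy M n"
    and M_ann: "\<And>\<alpha>. \<alpha> \<in> Z0 \<Longrightarrow> ma M u \<alpha> \<in> bdy M n \<longleftrightarrow> \<alpha> \<in> I"
    using M by (auto simp: realizes_def)
  have t: "t \<in> cyc N n" and N_triv: "\<And>p. p \<noteq> n \<Longrightarrow> cyc N p \<subseteq> bdy N p"
    and N_gen: "\<And>c. c \<in> cyc N n \<Longrightarrow> \<exists>\<alpha>\<in>Z0. c - ma N t \<alpha> \<in> bdy N n"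
    and N_ann: "\<And>\<alpha>. \<alpha> \<in> Z0 \<Longrightarrow> ma N t \<alpha> \<in> bdy N n \<longleftrightarrow> \<alpha> \<in> I"
    using N by (auto simp: realizes_def)
  have F_in: "F x \<in> mc N p" if "x \<in> mc M p" for x p by (rule lmap_in0[OF cmap_lmap[OF F] that])
  have Fua: "F (ma M u \<alpha>) - ma N t \<alpha> \<in> bdy N n" if \<alpha>: "\<alpha> \<in> Z0" for \<alpha>
    using Y.M.bdy_act[OF AA.dga_axioms Fu \<alpha>] lmap_act[OF cmap_lmap[OF F] cyc_mc[OF u] Z0_ac[OF \<alpha>]]
      Y.M.act_diffl[OF F_in[OF cyc_mc[OF u]] cyc_mc[OF t] Z0_ac[OF \<alpha>]] by simp
  have u_cyc: "ma M u \<alpha> \<in> cyc M n" if "\<alpha> \<in> Z0" for \<alpha>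
    using X.M.cyc_act[OF AA.dga_axioms u that] by simp
  have Fd: "F x - F y = F (x - y)" if "x \<in> cyc M p" "y \<in> cyc M p" for x y p
    using lmap_diff[OF X.M.mdl_axioms Y.M.mdl_axioms cmap_lmap[OF F] cyc_mc[OF that(1)] cyc_mc[OF that(2)]] by simp
  have inj_F: "z \<in> bdy M p" if z: "z \<in> cyc M p" "F z \<in> bdy N p" for z p
  proof (cases "p = n")
    case False then show ?thesis using M_triv z by blast
  next
    case True
    then obtain \<alpha> where \<alpha>: "\<alpha> \<in> Z0" "z - ma M u \<alpha> \<in> bdy M n" using M_gen z by blast
    have "F z - F (ma M u \<alpha>) \<in> bdy N n"
      using cmap_bdy0[OF X.M.mdl_axioms Y.M.mdl_axioms F \<alpha>(2)] Fd[OF _ u_cyc[OF \<alpha>(1)]] z True by simp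
    then have "F (ma M u \<alpha>) \<in> bdy N n" using Y.M.bdy_diff[of "F z" n "F z - F (ma M u \<alpha>)"] z True by simp
    then have "ma N t \<alpha> \<in> bdy N n" using Y.M.bdy_cong[OF Fua[OF \<alpha>(1)]] by blast
    then have "ma M u \<alpha> \<in> bdy M n" using N_ann M_ann \<alpha>(1) by blast
    then show ?thesis using X.M.bdy_cong[OF \<alpha>(2)] True by blast
  qed
  have surj_F: "\<exists>z\<in>cyc M p. y - F z \<in> bdy N p" if y: "y \<in> cyc N p" for y p
  proof (cases "p = n")
    case False
    then show ?thesis
      using N_triv y lmap_zero[OF X.M.mdl_axioms Y.M.mdl_axioms cmap_lmap[OF F]] X.M.cyc_zero by (intro bexI[of _ 0]) auto
  next
    case True
    then obtain \<alpha> where \<alpha>: "\<alpha> \<in> Z0" "y - ma N t \<alpha> \<in> bdy N n" using N_gen y by blast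
    have "y - F (ma M u \<alpha>) \<in> bdy N n" using Y.M.bdy_diff[OF \<alpha>(2) Fua[OF \<alpha>(1)]] by simp
    then show ?thesis using u_cyc[OF \<alpha>(1)] True by blast
  qed
  have "inj_on (?h p) (carrier (X.H p))" for p
  proof (rule inj_onI)
    fix C D assume "C \<in> carrier (X.H p)" "D \<in> carrier (X.H p)" and eq: "?h p C = ?h p D"
    then obtain x y where x: "x \<in> X.coc p" "C = X.cl p x" and y: "y \<in> X.coc p" "D = X.cl p y" by (auto simp: X.H_carrier)
    note x' = X.coc_carrier[OF x(1)] and y' = X.coc_carrier[OF y(1)]
    have c: "\<phi> p x \<in> cyc M p" "\<phi> p y \<in> cyc M p" using x y by (auto simp: X.coc_iff)
    have "F (\<phi> p x) - F (\<phi> p y) \<in> bdy N p"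
      using eq Y.cl_eq[OF f(1)[OF x'] f(1)[OF y']] f(2)[OF x'] f(2)[OF y'] by (simp add: x y map_cl)
    then have "\<phi> p x - \<phi> p y \<in> bdy M p" using inj_F[OF X.M.cyc_diff[OF c]] Fd[OF c] by simp
    then show "C = D" using X.cl_eq[OF x' y'] x y by simp
  qed
  moreover have "?h p ` carrier (X.H p) = carrier (Y.H p)" for p
  proof
    show "?h p ` carrier (X.H p) \<subseteq> carrier (Y.H p)"
      by (rule image_subsetI) (rule hom_in_carrier[OF h_hom])
    show "carrier (Y.H p) \<subseteq> ?h p ` carrier (X.H p)"
    proof
      fix D assume "D \<in> carrier (Y.H p)"
      then obtain y where y: "y \<in> Y.coc p" "D = Y.cl p y" by (auto simp: Y.H_carrier)
      then obtain z where z: "z \<in> cyc M p" "\<psi> p y - F z \<in> bdy N p" using surj_F by (auto simp: Y.coc_iff)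
      obtain x where x: "x \<in> carrier (mgrp X p)" "z = \<phi> p x" using X.\<phi>_surj cyc_mc[OF z(1)] by blast
      have xc: "x \<in> X.coc p" using x z by (simp add: X.coc_iff)
      have "D = Y.cl p (f p x)" using Y.cl_eq[OF Y.coc_carrier[OF y(1)] f(1)[OF x(1)]] f(2)[OF x(1)] z(2) x(2) y(2) by simp
      then show "D \<in> ?h p ` carrier (X.H p)" using xc by (auto simp: X.H_carrier map_cl intro!: image_eqI[of _ _ "X.cl p x"])
    qed
  qed
  ultimately have "?h p \<in> iso (X.H p) (Y.H p)" for p using h_hom by (simp add: iso_def bij_betw_def)
  then have "quasi_iso A X Y f" using hom by (simp add: quasi_iso_def cohomology_module_def)
  then show ?thesis by blast
qed

end

lemma quasi_iso_derived_iso: "quasi_iso A X Y s \<Longrightarrow> derived_iso A X Y"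
  unfolding derived_iso_def
  by (intro exI[of _ "[Fwd X Y s]"] exI[of _ "[Bwd X Y s]"])
    (auto simp: quasi_iso_def dg_hom_def intro: zigzag_eq.inverse_right zigzag_eq.inverse_left)

text \<open>The type \<open>'u\<close> is the universe both for the dg modules in the conclusion and
  for the semisimplicity hypothesis; being infinite and at least as large as \<open>'a\<close>, it
  has room for the whole tower.\<close>

theorem corollary5p7:
  fixes K :: "'k ring"
    and A :: "('k, 'a) dg_algebra"
    and S :: "('a set, 's) graded_module"
  assumes dg: "dg_algebra K A"
    and universe: "infinite (UNIV :: 'u set)" "\<exists>i :: 'a \<Rightarrow> 'u. inj i"
    and vanishing: "\<And>p. p < 0 \<Longrightarrow>
      carrier (rgrp (cohomology_ring A) p) = {\<one>\<^bsub>rgrp (cohomology_ring A) p\<^esub>}"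
    and semisimple: "Mod_semisimple TYPE('u) (degree_zero_ring (cohomology_ring A))"
    and simple: "graded_simple (cohomology_ring A) S"
  shows "\<exists>St :: ('a, 'u) dg_module.
    dg_module A St \<and> graded_iso (cohomology_ring A) (cohomology_module St) S \<and>
    (\<forall>T :: ('a, 'u) dg_module.
      dg_module A T \<and> graded_iso (cohomology_ring A) (cohomology_module T) S \<longrightarrow>
      derived_iso A St T)"
proof -
  interpret positive_dg_algebra K A "TYPE('u)"
    by (intro positive_dg_algebra.intro positive_dg_algebra_axioms.intro dg universe vanishing semisimple)
  obtain n s0 where gm: "graded_module (cohomology_ring A) S" and s0: "\<And>p. p \<noteq> n \<Longrightarrow> carrier (mgrp S p) = {\<one>\<^bsub>mgrp S p\<^esub>}"
    "s0 \<in> carrier (mgrp S n)"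
    "\<And>x. x \<in> carrier (mgrp S n) \<Longrightarrow> \<exists>r\<in>carrier (rgrp (cohomology_ring A) 0). x = mact S n 0 s0 r"
    by (rule graded_simple_cyclic[OF simple]) (rule that)
  interpret simple_module K A "TYPE('u)" S n s0
    by (intro simple_module.intro simple_module_axioms.intro positive_dg_algebra_axioms gm s0)
  obtain e where e: "e \<in> Z0" "e - am (AA A) e e \<in> B0" "au (AA A) - e \<in> I"
    "\<And>\<alpha>. \<alpha> \<in> Z0 \<Longrightarrow> am (AA A) e \<alpha> \<in> B0 \<longleftrightarrow> \<alpha> \<in> I"
    by (rule idempotent) (rule that)
  \<comment> \<open>The competing module \<open>T\<close> is compared in its ambient form, hence the
    type \<open>'u ambient\<close> for the test modules.\<close>
  obtain V :: "('a, 'u) tower_mdl" and u where V: "mdl (AA A) V"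
    "(\<Union>p. mc V p) \<lesssim> (UNIV :: 'u set)" and u: "u \<in> cyc V n" "\<And>p. p \<noteq> n \<Longrightarrow> cyc V p \<subseteq> bdy V p"
    "\<And>c. c \<in> cyc V n \<Longrightarrow> \<exists>a\<in>Z0. c - ma V u a \<in> bdy V n"
    "\<And>a. a \<in> Z0 \<Longrightarrow> ma V u a \<in> bdy V n \<longleftrightarrow> am (AA A) e a \<in> B0"
    and maps: "\<And>(T :: ('a ambient, 'u ambient) mdl) t. mdl (AA A) T \<Longrightarrow> \<forall>p>n. cyc T p \<subseteq> bdy T p \<Longrightarrow>
      t \<in> cyc T n \<Longrightarrow> t - ma T t e \<in> bdy T n \<Longrightarrow> \<exists>f. cmap (AA A) V T 0 f \<and> f u - t \<in> bdy T n"
    by (rule tower[OF e(1,2), where n = n and 't = "'u ambient"]) (rule that)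
  obtain c :: "_ \<Rightarrow> 'u" where c: "inj_on c (\<Union>p. mc V p)" using V(2) unfolding lepoll_def by blast
  define St where "St = transport_mdl A V c"
  have rV: "realizes V u" using u e(4) by (simp add: realizes_def)
  have rep_St: "dg_rep K A St V (\<lambda>p. inv_into (\<Union>p. mc V p) c)" unfolding St_def by (rule dg_rep_transport[OF dg V(1) c])
  have "derived_iso A St T" if T: "dg_module A T" "graded_iso (cohomology_ring A) (cohomology_module T) S" for T :: "('a, 'u) dg_module"
  proof -
    note rep_T = dg_rep_ambient[OF dg T(1)]
    interpret T: dg_rep K A T "ambient_mdl A T" "\<lambda>p. emb p (mgrp T p)" by (rule rep_T)
    obtain t where rt: "realizes (ambient_mdl A T) t" by (rule iso_realizes[OF rep_T T(2)])
    then have t: "t \<in> cyc (ambient_mdl A T) n" by (simp add: realizes_def)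
    \<comment> \<open>1 - e lies in \<open>I\<close>, which annihilates the class of
      \<open>t\<close>; so t and t e are cohomologous, the condition for mapping the tower to
      \<open>T\<close>.\<close>
    have "ma (ambient_mdl A T) t (au (AA A) - e) \<in> bdy (ambient_mdl A T) n"
      using rt e(3) I_Z0[OF e(3)] by (simp add: realizes_def)
    then have "t - ma (ambient_mdl A T) t e \<in> bdy (ambient_mdl A T) n"
      using T.M.act_diffr[OF AA.dga_axioms cyc_mc[OF t] Z0_ac[OF Z0_unit] Z0_ac[OF e(1)]] T.M.act_unit[OF cyc_mc[OF t]] by simp
    then obtain F where F: "cmap (AA A) V (ambient_mdl A T) 0 F" "F u - t \<in> bdy (ambient_mdl A T) n"
      using maps[OF T.M.mdl_axioms _ t] rt by (auto simp: realizes_def)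
    have "\<exists>s. quasi_iso A St T s" by (rule realizes_quasi_iso[OF rep_St rep_T rV rt F(1)]) (rule F(2))
    then show ?thesis using quasi_iso_derived_iso by blast
  qed
  moreover have "dg_module A St" using rep_St by (simp add: dg_rep_def)
  ultimately show ?thesis using realizes_iso[OF rep_St rV] by blast
qed

end
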